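(* Let $\mathcal A$ be a canonically labelled alphabet, $\mathbf{Free}(\mathcal A)$ the free abstract tensor system over $\mathcal A$, and $\mathbb C[\mathbf{Free}(\mathcal A)]$ its associated strict traced symmetric monoidal category. Then $\mathbb C[\mathbf{Free}(\mathcal A)]$ is the free strict traced symmetric monoidal category over the monoidal signature $\mathbf{Sig}(\mathcal A)$. That is, there is a monoidal signature homomorphism $\eta$ from $\mathbf{Sig}(\mathcal A)$ to (the underlying signature of) $\mathbb C[\mathbf{Free}(\mathcal A)]$ such that for every strict traced symmetric monoidal category $\mathcal C$ and every monoidal signature homomorphism $v$ from $\mathbf{Sig}(\mathcal A)$ to (the underlying signature of) $\mathcal C$ there is a unique strict traced symmetric monoidal functor $\widetilde v:\mathbb C[\mathbf{Free}(\mathcal A)]\to\mathcal C$ with $\widetilde v\circ\eta=v$.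
   Context: **Labels.** Fix a set $\mathcal U$ of types, a set $\mathcal L$ of labels and a typing function $\tau:\mathcal L\to\mathcal U$ with at least countably infinitely many labels of each type, together with a subset of canonical labels $\mathcal L_c\subseteq\mathcal L$, $\mathcal L_c\cong\mathcal U\times\mathbb N\times\{0,1\}$, where $(X,i,0)$, $(X,i,1)$ are written $x_i^{(0)},x_i^{(1)}$ and have type $X$. For a list of types $\vec X=[X_1,\ldots,X_N]$, $\epsilon\in\{0,1\}$ and $s\ge0$, let $\vec x^{(\epsilon)}_{s+1..s+N}$ be the list $(X_1,s+1,\epsilon),\ldots,(X_N,s+N,\epsilon)$; for $s=0$ it is written $\vec x^{(\epsilon)}$, and its set of elements $\mathbf x^{(\epsilon)}$. **Alphabet and signature.** A canonically labelled alphabet $\mathcal A$ is a set of formal tensor symbols of the form $\psi_{\vec x^{(0)}}^{\vec y^{(1)}}$, each symbol $\psi$ occurring once, with associated lists of types $\vec X,\vec Y\in\mathcal U^*$. A monoidal signature $(O,M,\mathrm{dom},\mathrm{cod})$ is a set $O$ of objects, a set $M$ of morphisms and functions $\mathrm{dom},\mathrm{cod}:M\to O^*$ ($O^*$: finite lists). $\mathbf{Sig}(\mathcal A)$ is the signature with objects $\mathcal U$, morphisms $\mathcal A$, $\mathrm{dom}(\psi_{\vec x^{(0)}}^{\vec y^{(1)}})=\vec X$, $\mathrm{cod}(\psi_{\vec x^{(0)}}^{\vec y^{(1)}})=\vec Y$. A homomorphism of signatures consists of functions $f_O$ on objects and $f_M$ on morphisms commuting with $\mathrm{dom},\mathrm{cod}$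 (via $f_O^*$ on lists). The underlying signature of a strict monoidal category forgets composition; thus a homomorphism $v$ from a signature into a strict monoidal category $\mathcal C$ assigns to each object $A$ an object $v(A)$ and to each $m$ with $\mathrm{dom}(m)=[A_1,\ldots,A_p]$, $\mathrm{cod}(m)=[B_1,\ldots,B_q]$ a morphism $v(m):v(A_1)\otimes\cdots\otimes v(A_p)\to v(B_1)\otimes\cdots\otimes v(B_q)$ (empty product $=I$). **Einstein expressions and the free ATS.** An Einstein expression over $\mathcal A$ is a finite list of formal $\delta$-elements $\delta_a^b$ ($\tau(a)=\tau(b)$) and relabelled tensor symbols $\psi_{a_1,\ldots,a_m}^{b_1,\ldots,b_n}$ ($\psi$ from $\mathcal A$, labels replaced by labels of the same types), where each label occurs either exactly once, or exactly twice, once as an upper and once as a lower label (such labels are called repeated or bound; the others are free). $E_{[a\mapsto a']}$, $E^{[a\mapsto a']}$ denote $E$ with the lower, resp. upper, label $a$ replaced by $a'$. Let $\approx$ be the equivalence relation on Einstein expressions generated by: permuting the entries of the list; renaming a repeated label (both occurrences) to a fresh label of the same type; $E\,\delta_a^b\approx E^{[a\mapsto b]}$ if $E$ contains $a$ as an upper label; $E\,\delta_a^b\approx E_{[b\mapsto a]}$ if $E$ contains $b$ as a lower label. Let $|E|$ be the $\approx$-class of $E$. $\mathbf{Free}(\mathcal A)$ has: $\mathcal T(\mathbf x,\mathbf y)$ = the set of $|E|$ whose sets of non-repeated lower and upper labels are $\mathbf x$ and $\mathbf y$; product $|E|\cdot|E'|=|EE'|$ with $E,E'$ chosen with no common labels;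 contraction $\mathcal K_a^b(|E|)=|E^{[b\mapsto a]}|$ (for a free lower label $a$ and a free upper label $b$ of the same type, with $a$ and $b$ distinct); relabelling $|E|[f]$ = the class of $E$ with bound labels renamed to fresh labels not in $\mathrm{cod}(f)$ and free labels replaced according to $f$; $\delta$-elements $|\delta_a^b|$; and $1=|\text{empty list}|$. **The category $\mathbb C[\mathcal S]$ of $\mathcal S=\mathbf{Free}(\mathcal A)$.** For a tensor $\psi$ with ordered lower and upper labels, $\psi_{\vec a}^{\vec b}$ denotes the relabelling of $\psi$ with these labels replaced by $\vec a,\vec b$; juxtaposition with labels repeated (once lower, once upper) denotes the product (formed with distinct fresh labels) followed by contraction of the corresponding pairs of labels; $\delta_{\vec x}^{\vec y}=\delta_{x_1}^{y_1}\cdots\delta_{x_n}^{y_n}$. Objects are $\mathcal U^*$; $\hom(\vec X,\vec Y)=\mathcal T(\mathbf x^{(0)},\mathbf y^{(1)})$; $\vec X\otimes\vec Y$ is concatenation, $I=[\,]$. With $\vec{x'},\vec{y'}$ fresh labels: - $\phi\circ\psi=\psi_{\vec x^{(0)}}^{\vec{y'}}\phi_{\vec{y'}}^{\vec z^{(1)}}$ for $\psi:\vec X\to\vec Y$, $\phi:\vec Y\to\vec Z$; - $\psi\otimes\widetilde\psi=\psi_{\vec x_{1..m}^{(0)}}^{\vec y_{1..n}^{(1)}}\widetilde\psi_{\vec u_{m+1..m+m'}^{(0)}}^{\vec v_{n+1..n+n'}^{(1)}}$ for $\psi:\vec X\to\vec Y$, $\widetilde\psi:\vec U\to\vec V$,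 where $m,n,m',n'$ are the lengths of $\vec X,\vec Y,\vec U,\vec V$; - $\mathrm{id}_{\vec X}=\delta_{\vec x^{(0)}}^{\vec x^{(1)}}$; - $\sigma_{\vec X,\vec Y}=\delta_{\vec x_{1..m}^{(0)}}^{\vec x_{n+1..n+m}^{(1)}}\delta_{\vec y_{m+1..m+n}^{(0)}}^{\vec y_{1..n}^{(1)}}$, with $m=|\vec X|$, $n=|\vec Y|$; - $\mathrm{Tr}^{\vec X}(\xi)=\xi_{\vec u_{1..m}^{(0)}\vec{x'}}^{\vec v_{1..n}^{(1)}\vec{x'}}$ for $\xi:\vec U\otimes\vec X\to\vec V\otimes\vec X$, with $m=|\vec U|$, $n=|\vec V|$. **Traced symmetric monoidal category.** A symmetric monoidal category with functions $\mathrm{Tr}^X:\hom(A\otimes X,B\otimes X)\to\hom(A,B)$ satisfying: (1) $\mathrm{Tr}^X((g\otimes X)\circ f\circ(h\otimes X))=g\circ\mathrm{Tr}^X(f)\circ h$; (2) $\mathrm{Tr}^Y(f\circ(A\otimes g))=\mathrm{Tr}^X((B\otimes g)\circ f)$; (3) $\mathrm{Tr}^I(f)=f$, $\mathrm{Tr}^{X\otimes Y}(f)=\mathrm{Tr}^X(\mathrm{Tr}^Y(f))$; (4) $\mathrm{Tr}^X(g\otimes f)=g\otimes\mathrm{Tr}^X(f)$; (5) $\mathrm{Tr}^X(\sigma_{X,X})=1_X$. It is strict if the associator and unitors are identities. A strict traced symmetric monoidal functor preserves $\otimes$, $I$, symmetries and traces on the nose. *)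

theory Defs
  imports "HOL-Library.Multiset" "HOL-Library.FuncSet"
begin

section \<open>Labels, alphabets and monoidal signatures\<close>

text \<open>
  The superscript \<open>\<epsilon> \<in> {0, 1}\<close> of a canonical label is a Boolean: \<open>canon \<Lambda> X i False\<close> is
  \<open>x\<^sub>i\<close> with superscript 0 and \<open>canon \<Lambda> X i True\<close> is \<open>x\<^sub>i\<close> with superscript 1.  The set of
  canonical labels is the image of this (injective) map.  Types and labels form carrier sets, so
  that the set of types may be empty.
\<close>

record ('u, 'l) labelling =
  types :: "'u set"
  labels :: "'l set"
  label_type :: "'l \<Rightarrow> 'u"
  canon :: "'u \<Rightarrow> nat \<Rightarrow> bool \<Rightarrow> 'l"

definition labelling :: "('u, 'l) labelling \<Rightarrow> bool" where
  "labelling \<Lambda> \<longleftrightarrow>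
     label_type \<Lambda> \<in> labels \<Lambda> \<rightarrow> types \<Lambda> \<and>
     (\<forall>X\<in>types \<Lambda>. infinite {a \<in> labels \<Lambda>. label_type \<Lambda> a = X}) \<and>
     (\<forall>X\<in>types \<Lambda>. \<forall>i \<epsilon>. canon \<Lambda> X i \<epsilon> \<in> labels \<Lambda> \<and> label_type \<Lambda> (canon \<Lambda> X i \<epsilon>) = X) \<and>
     inj_on (\<lambda>(X, i, \<epsilon>). canon \<Lambda> X i \<epsilon>) (types \<Lambda> \<times> UNIV \<times> UNIV)"

text \<open>The list \<open>(X\<^sub>1, s + 1, \<epsilon>), \<dots>, (X\<^sub>N, s + N, \<epsilon>)\<close>.\<close>

definition canons :: "('u, 'l) labelling \<Rightarrow> bool \<Rightarrow> nat \<Rightarrow> 'u list \<Rightarrow> 'l list" where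
  "canons \<Lambda> \<epsilon> s Xs = map2 (\<lambda>X i. canon \<Lambda> X i \<epsilon>) Xs [s + 1..<s + length Xs + 1]"

text \<open>
  A tensor symbol of a canonically labelled alphabet carries the canonical label lists determined
  by its two lists of types, so an alphabet is given by its set of symbols and these type lists.
\<close>

record ('s, 'u) alphabet =
  symbols :: "'s set"
  lower_types :: "'s \<Rightarrow> 'u list"
  upper_types :: "'s \<Rightarrow> 'u list"

definition alphabet :: "('u, 'l) labelling \<Rightarrow> ('s, 'u) alphabet \<Rightarrow> bool" where
  "alphabet \<Lambda> \<A> \<longleftrightarrow>
     (\<forall>s\<in>symbols \<A>. lower_types \<A> s \<in> lists (types \<Lambda>) \<and> upper_types \<A> s \<in> lists (types \<Lambda>))"

record ('a, 'm) signature =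
  sig_obj :: "'a set"
  sig_mor :: "'m set"
  sig_dom :: "'m \<Rightarrow> 'a list"
  sig_cod :: "'m \<Rightarrow> 'a list"

definition Sig :: "('u, 'l) labelling \<Rightarrow> ('s, 'u) alphabet \<Rightarrow> ('u, 's) signature" where
  "Sig \<Lambda> \<A> = \<lparr>sig_obj = types \<Lambda>, sig_mor = symbols \<A>,
     sig_dom = lower_types \<A>, sig_cod = upper_types \<A>\<rparr>"


section \<open>Einstein expressions\<close>

text \<open>
  \<open>Delta a b\<close> is the \<open>\<delta>\<close>-element with lower label \<open>a\<close> and upper label \<open>b\<close>; \<open>Tensor \<psi> as bs\<close> is
  the symbol \<open>\<psi>\<close> with lower labels \<open>as\<close> and upper labels \<open>bs\<close>.
\<close>

datatype ('s, 'l) elem = Delta 'l 'l | Tensor 's "'l list" "'l list"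

type_synonym ('s, 'l) expr = "('s, 'l) elem list"

primrec elem_lower :: "('s, 'l) elem \<Rightarrow> 'l list" where
  "elem_lower (Delta a b) = [a]"
| "elem_lower (Tensor \<psi> as bs) = as"

primrec elem_upper :: "('s, 'l) elem \<Rightarrow> 'l list" where
  "elem_upper (Delta a b) = [b]"
| "elem_upper (Tensor \<psi> as bs) = bs"

primrec elem_ok :: "('u, 'l) labelling \<Rightarrow> ('s, 'u) alphabet \<Rightarrow> ('s, 'l) elem \<Rightarrow> bool" where
  "elem_ok \<Lambda> \<A> (Delta a b) \<longleftrightarrow> a \<in> labels \<Lambda> \<and> b \<in> labels \<Lambda> \<and> label_type \<Lambda> a = label_type \<Lambda> b"
| "elem_ok \<Lambda> \<A> (Tensor \<psi> as bs) \<longleftrightarrow> \<psi> \<in> symbols \<A> \<and> as \<in> lists (labels \<Lambda>) \<and> bs \<in> lists (labels \<Lambda>) \<and>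
     map (label_type \<Lambda>) as = lower_types \<A> \<psi> \<and> map (label_type \<Lambda>) bs = upper_types \<A> \<psi>"

text \<open>\<open>elem_map f g\<close> applies \<open>f\<close> to the lower and \<open>g\<close> to the upper labels.\<close>

primrec elem_map :: "('l \<Rightarrow> 'l) \<Rightarrow> ('l \<Rightarrow> 'l) \<Rightarrow> ('s, 'l) elem \<Rightarrow> ('s, 'l) elem" where
  "elem_map f g (Delta a b) = Delta (f a) (g b)"
| "elem_map f g (Tensor \<psi> as bs) = Tensor \<psi> (map f as) (map g bs)"

definition lower :: "('s, 'l) expr \<Rightarrow> 'l list" where
  "lower E = concat (map elem_lower E)"

definition upper :: "('s, 'l) expr \<Rightarrow> 'l list" where
  "upper E = concat (map elem_upper E)"

definition expr_labels :: "('s, 'l) expr \<Rightarrow> 'l set" where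
  "expr_labels E = set (lower E) \<union> set (upper E)"

definition bound :: "('s, 'l) expr \<Rightarrow> 'l set" where
  "bound E = set (lower E) \<inter> set (upper E)"

definition free :: "('s, 'l) expr \<Rightarrow> 'l set" where
  "free E = expr_labels E - bound E"

definition free_lower :: "('s, 'l) expr \<Rightarrow> 'l set" where
  "free_lower E = set (lower E) - bound E"

definition free_upper :: "('s, 'l) expr \<Rightarrow> 'l set" where
  "free_upper E = set (upper E) - bound E"

text \<open>
  A label occurs exactly once, or exactly twice with one upper and one lower occurrence, iff it
  occurs at all and neither twice as a lower nor twice as an upper label.
\<close>

definition einstein :: "('u, 'l) labelling \<Rightarrow> ('s, 'u) alphabet \<Rightarrow> ('s, 'l) expr \<Rightarrow> bool" where
  "einstein \<Lambda> \<A> E \<longleftrightarrow> (\<forall>e\<in>set E. elem_ok \<Lambda> \<A> e) \<and> distinct (lower E) \<and> distinct (upper E)"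

text \<open>\<open>repl_lower a a' E\<close> and \<open>repl_upper a a' E\<close> replace the lower, resp. upper, label \<open>a\<close> by \<open>a'\<close>.\<close>

definition repl_lower :: "'l \<Rightarrow> 'l \<Rightarrow> ('s, 'l) expr \<Rightarrow> ('s, 'l) expr" where
  "repl_lower a a' E = map (elem_map (id(a := a')) id) E"

definition repl_upper :: "'l \<Rightarrow> 'l \<Rightarrow> ('s, 'l) expr \<Rightarrow> ('s, 'l) expr" where
  "repl_upper a a' E = map (elem_map id (id(a := a'))) E"

inductive expr_eq :: "('u, 'l) labelling \<Rightarrow> ('s, 'u) alphabet \<Rightarrow> ('s, 'l) expr \<Rightarrow> ('s, 'l) expr \<Rightarrow> bool"
  for \<Lambda> :: "('u, 'l) labelling" and \<A> :: "('s, 'u) alphabet"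
where
  refl: "einstein \<Lambda> \<A> E \<Longrightarrow> expr_eq \<Lambda> \<A> E E"
| sym: "expr_eq \<Lambda> \<A> E E' \<Longrightarrow> expr_eq \<Lambda> \<A> E' E"
| trans: "expr_eq \<Lambda> \<A> E E' \<Longrightarrow> expr_eq \<Lambda> \<A> E' E'' \<Longrightarrow> expr_eq \<Lambda> \<A> E E''"
| permute: "einstein \<Lambda> \<A> E \<Longrightarrow> mset E = mset E' \<Longrightarrow> expr_eq \<Lambda> \<A> E E'"
| rename: "einstein \<Lambda> \<A> E \<Longrightarrow> a \<in> bound E \<Longrightarrow> a' \<in> labels \<Lambda> \<Longrightarrow> a' \<notin> expr_labels E \<Longrightarrow>
    label_type \<Lambda> a' = label_type \<Lambda> a \<Longrightarrow> expr_eq \<Lambda> \<A> E (repl_lower a a' (repl_upper a a' E))"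
| delta_upper: "einstein \<Lambda> \<A> (E @ [Delta a b]) \<Longrightarrow> a \<in> set (upper E) \<Longrightarrow>
    expr_eq \<Lambda> \<A> (E @ [Delta a b]) (repl_upper a b E)"
| delta_lower: "einstein \<Lambda> \<A> (E @ [Delta a b]) \<Longrightarrow> b \<in> set (lower E) \<Longrightarrow>
    expr_eq \<Lambda> \<A> (E @ [Delta a b]) (repl_lower b a E)"

definition expr_class :: "('u, 'l) labelling \<Rightarrow> ('s, 'u) alphabet \<Rightarrow> ('s, 'l) expr \<Rightarrow> ('s, 'l) expr set"
where
  "expr_class \<Lambda> \<A> E = {E'. expr_eq \<Lambda> \<A> E E'}"


section \<open>The free abstract tensor system\<close>

text \<open>
  The operations of an abstract tensor system.  \<open>contract S a b\<close> contracts the free lower label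
  \<open>a\<close> with the free upper label \<open>b\<close>.  The argument \<open>f\<close> of \<open>relabel S f\<close> only matters on the free
  labels of the tensor; its codomain is their image under \<open>f\<close>.
\<close>

record ('l, 't) tensor_system =
  tensors :: "'l set \<Rightarrow> 'l set \<Rightarrow> 't set"
  product :: "'t \<Rightarrow> 't \<Rightarrow> 't"
  contract :: "'l \<Rightarrow> 'l \<Rightarrow> 't \<Rightarrow> 't"
  relabel :: "('l \<Rightarrow> 'l) \<Rightarrow> 't \<Rightarrow> 't"
  delta :: "'l \<Rightarrow> 'l \<Rightarrow> 't"
  one :: "'t"

text \<open>
  The operations on classes are lifted from representatives by unions over all admissible
  representatives; on the domains of the operations all of these give the same class.
\<close>

definition Free :: "('u, 'l) labelling \<Rightarrow> ('s, 'u) alphabet \<Rightarrow> ('l, ('s, 'l) expr set) tensor_system"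
where
  "Free \<Lambda> \<A> = \<lparr>
     tensors = (\<lambda>x y. {expr_class \<Lambda> \<A> E | E. einstein \<Lambda> \<A> E \<and> free_lower E = x \<and> free_upper E = y}),
     product = (\<lambda>t t'. \<Union>E\<in>t. \<Union>E'\<in>{E' \<in> t'. expr_labels E \<inter> expr_labels E' = {}}.
       expr_class \<Lambda> \<A> (E @ E')),
     contract = (\<lambda>a b t. \<Union>E\<in>t. expr_class \<Lambda> \<A> (repl_upper b a E)),
     relabel = (\<lambda>f t. \<Union>E\<in>{E \<in> t. bound E \<inter> f ` free E = {}}.
       let g = (\<lambda>a. if a \<in> bound E then a else f a)
       in expr_class \<Lambda> \<A> (map (elem_map g g) E)),
     delta = (\<lambda>a b. expr_class \<Lambda> \<A> [Delta a b]),
     one = expr_class \<Lambda> \<A> []\<rparr>"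


section \<open>Strict traced symmetric monoidal categories\<close>

text \<open>
  \<open>\<cdot>\<close> is composition in the order of functions, \<open>\<otimes>\<close> and \<open>\<odot>\<close> are the tensor product of morphisms
  and of objects.  \<open>Tr C A B X\<close> is the trace function \<open>hom(A \<odot> X, B \<odot> X) \<rightarrow> hom(A, B)\<close>; it takes \<open>A\<close>
  and \<open>B\<close> as arguments because they need not be determined by \<open>A \<odot> X\<close> and \<open>B \<odot> X\<close>.
\<close>

record ('o, 'c) moncat =
  Obj :: "'o set"
  Arr :: "'c set"
  Dom :: "'c \<Rightarrow> 'o"
  Cod :: "'c \<Rightarrow> 'o"
  Ide :: "'o \<Rightarrow> 'c"
  Comp :: "'c \<Rightarrow> 'c \<Rightarrow> 'c" (infixl "\<cdot>\<index>" 65)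
  OTens :: "'o \<Rightarrow> 'o \<Rightarrow> 'o" (infixl "\<odot>\<index>" 70)
  ATens :: "'c \<Rightarrow> 'c \<Rightarrow> 'c" (infixl "\<otimes>\<index>" 70)
  Unit :: "'o" ("\<one>\<index>")
  Symm :: "'o \<Rightarrow> 'o \<Rightarrow> 'c"
  Tr :: "'o \<Rightarrow> 'o \<Rightarrow> 'o \<Rightarrow> 'c \<Rightarrow> 'c"

definition Hom :: "('o, 'c) moncat \<Rightarrow> 'o \<Rightarrow> 'o \<Rightarrow> 'c set" where
  "Hom C A B = {f \<in> Arr C. Dom C f = A \<and> Cod C f = B}"

locale category =
  fixes C :: "('o, 'c) moncat" (structure)
  assumes Dom_Obj: "f \<in> Arr C \<Longrightarrow> Dom C f \<in> Obj C"
    and Cod_Obj: "f \<in> Arr C \<Longrightarrow> Cod C f \<in> Obj C"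
    and Ide_Hom: "A \<in> Obj C \<Longrightarrow> Ide C A \<in> Hom C A A"
    and Comp_Hom: "f \<in> Hom C A B \<Longrightarrow> g \<in> Hom C B D \<Longrightarrow> g \<cdot> f \<in> Hom C A D"
    and Comp_Ide: "f \<in> Hom C A B \<Longrightarrow> f \<cdot> Ide C A = f"
    and Ide_Comp: "f \<in> Hom C A B \<Longrightarrow> Ide C B \<cdot> f = f"
    and Comp_assoc: "f \<in> Hom C A B \<Longrightarrow> g \<in> Hom C B D \<Longrightarrow> h \<in> Hom C D E \<Longrightarrow>
      h \<cdot> (g \<cdot> f) = (h \<cdot> g) \<cdot> f"

locale strict_monoidal_category = category +
  assumes Unit_Obj: "\<one> \<in> Obj C"
    and OTens_Obj: "A \<in> Obj C \<Longrightarrow> B \<in> Obj C \<Longrightarrow> A \<odot> B \<in> Obj C"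
    and OTens_assoc: "A \<in> Obj C \<Longrightarrow> B \<in> Obj C \<Longrightarrow> D \<in> Obj C \<Longrightarrow> (A \<odot> B) \<odot> D = A \<odot> (B \<odot> D)"
    and Unit_OTens: "A \<in> Obj C \<Longrightarrow> \<one> \<odot> A = A"
    and OTens_Unit: "A \<in> Obj C \<Longrightarrow> A \<odot> \<one> = A"
    and ATens_Hom: "f \<in> Hom C A B \<Longrightarrow> g \<in> Hom C A' B' \<Longrightarrow> f \<otimes> g \<in> Hom C (A \<odot> A') (B \<odot> B')"
    and ATens_Ide: "A \<in> Obj C \<Longrightarrow> B \<in> Obj C \<Longrightarrow> Ide C A \<otimes> Ide C B = Ide C (A \<odot> B)"
    and ATens_Comp: "f \<in> Hom C A B \<Longrightarrow> g \<in> Hom C B D \<Longrightarrow> f' \<in> Hom C A' B' \<Longrightarrow> g' \<in> Hom C B' D' \<Longrightarrow>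
      (g \<cdot> f) \<otimes> (g' \<cdot> f') = (g \<otimes> g') \<cdot> (f \<otimes> f')"
    and ATens_assoc: "f \<in> Arr C \<Longrightarrow> g \<in> Arr C \<Longrightarrow> h \<in> Arr C \<Longrightarrow> (f \<otimes> g) \<otimes> h = f \<otimes> (g \<otimes> h)"
    and Unit_ATens: "f \<in> Arr C \<Longrightarrow> Ide C \<one> \<otimes> f = f"
    and ATens_Unit: "f \<in> Arr C \<Longrightarrow> f \<otimes> Ide C \<one> = f"

locale strict_symmetric_monoidal_category = strict_monoidal_category +
  assumes Symm_Hom: "A \<in> Obj C \<Longrightarrow> B \<in> Obj C \<Longrightarrow> Symm C A B \<in> Hom C (A \<odot> B) (B \<odot> A)"
    and Symm_natural: "f \<in> Hom C A A' \<Longrightarrow> g \<in> Hom C B B' \<Longrightarrow>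
      Symm C A' B' \<cdot> (f \<otimes> g) = (g \<otimes> f) \<cdot> Symm C A B"
    and Symm_Symm: "A \<in> Obj C \<Longrightarrow> B \<in> Obj C \<Longrightarrow> Symm C B A \<cdot> Symm C A B = Ide C (A \<odot> B)"
    and Symm_OTens: "A \<in> Obj C \<Longrightarrow> B \<in> Obj C \<Longrightarrow> D \<in> Obj C \<Longrightarrow>
      Symm C A (B \<odot> D) = (Ide C B \<otimes> Symm C A D) \<cdot> (Symm C A B \<otimes> Ide C D)"

locale strict_traced_category = strict_symmetric_monoidal_category +
  assumes Tr_Hom: "A \<in> Obj C \<Longrightarrow> B \<in> Obj C \<Longrightarrow> X \<in> Obj C \<Longrightarrow> f \<in> Hom C (A \<odot> X) (B \<odot> X) \<Longrightarrow>
      Tr C A B X f \<in> Hom C A B"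
    and Tr_natural: "A \<in> Obj C \<Longrightarrow> B \<in> Obj C \<Longrightarrow> X \<in> Obj C \<Longrightarrow> f \<in> Hom C (A \<odot> X) (B \<odot> X) \<Longrightarrow>
      h \<in> Hom C A' A \<Longrightarrow> g \<in> Hom C B B' \<Longrightarrow>
      Tr C A' B' X ((g \<otimes> Ide C X) \<cdot> f \<cdot> (h \<otimes> Ide C X)) = g \<cdot> Tr C A B X f \<cdot> h"
    and Tr_slide: "A \<in> Obj C \<Longrightarrow> B \<in> Obj C \<Longrightarrow> f \<in> Hom C (A \<odot> X) (B \<odot> Y) \<Longrightarrow> g \<in> Hom C Y X \<Longrightarrow>
      Tr C A B Y (f \<cdot> (Ide C A \<otimes> g)) = Tr C A B X ((Ide C B \<otimes> g) \<cdot> f)"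
    and Tr_Unit: "f \<in> Hom C A B \<Longrightarrow> Tr C A B \<one> f = f"
    and Tr_OTens: "A \<in> Obj C \<Longrightarrow> B \<in> Obj C \<Longrightarrow> X \<in> Obj C \<Longrightarrow> Y \<in> Obj C \<Longrightarrow>
      f \<in> Hom C (A \<odot> X \<odot> Y) (B \<odot> X \<odot> Y) \<Longrightarrow>
      Tr C A B (X \<odot> Y) f = Tr C A B X (Tr C (A \<odot> X) (B \<odot> X) Y f)"
    and Tr_ATens: "A \<in> Obj C \<Longrightarrow> B \<in> Obj C \<Longrightarrow> X \<in> Obj C \<Longrightarrow> f \<in> Hom C (A \<odot> X) (B \<odot> X) \<Longrightarrow>
      g \<in> Hom C D E \<Longrightarrow> Tr C (D \<odot> A) (E \<odot> B) X (g \<otimes> f) = g \<otimes> Tr C A B X f"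
    and Tr_Symm: "X \<in> Obj C \<Longrightarrow> Tr C X X X (Symm C X X) = Ide C X"

text \<open>
  A functor, or a homomorphism from a signature, is a pair of a function on objects and a function
  on morphisms.  The two functions of a functor are taken in the extensional function space, so
  that equality of functors is equality of pairs.
\<close>

definition strict_traced_functor ::
  "('o, 'c) moncat \<Rightarrow> ('p, 'd) moncat \<Rightarrow> ('o \<Rightarrow> 'p) \<times> ('c \<Rightarrow> 'd) \<Rightarrow> bool"
where
  "strict_traced_functor C D = (\<lambda>(F\<^sub>o, F).
     F\<^sub>o \<in> Obj C \<rightarrow>\<^sub>E Obj D \<and>
     F \<in> Arr C \<rightarrow>\<^sub>E Arr D \<and>
     (\<forall>f\<in>Arr C. Dom D (F f) = F\<^sub>o (Dom C f) \<and> Cod D (F f) = F\<^sub>o (Cod C f)) \<and>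
     (\<forall>A\<in>Obj C. F (Ide C A) = Ide D (F\<^sub>o A)) \<and>
     (\<forall>f\<in>Arr C. \<forall>g\<in>Arr C. Dom C g = Cod C f \<longrightarrow> F (g \<cdot>\<^bsub>C\<^esub> f) = F g \<cdot>\<^bsub>D\<^esub> F f) \<and>
     F\<^sub>o \<one>\<^bsub>C\<^esub> = \<one>\<^bsub>D\<^esub> \<and>
     (\<forall>A\<in>Obj C. \<forall>B\<in>Obj C. F\<^sub>o (A \<odot>\<^bsub>C\<^esub> B) = F\<^sub>o A \<odot>\<^bsub>D\<^esub> F\<^sub>o B) \<and>
     (\<forall>f\<in>Arr C. \<forall>g\<in>Arr C. F (f \<otimes>\<^bsub>C\<^esub> g) = F f \<otimes>\<^bsub>D\<^esub> F g) \<and>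
     (\<forall>A\<in>Obj C. \<forall>B\<in>Obj C. F (Symm C A B) = Symm D (F\<^sub>o A) (F\<^sub>o B)) \<and>
     (\<forall>A\<in>Obj C. \<forall>B\<in>Obj C. \<forall>X\<in>Obj C. \<forall>f\<in>Hom C (A \<odot>\<^bsub>C\<^esub> X) (B \<odot>\<^bsub>C\<^esub> X).
        F (Tr C A B X f) = Tr D (F\<^sub>o A) (F\<^sub>o B) (F\<^sub>o X) (F f)))"

definition OTens_list :: "('o, 'c) moncat \<Rightarrow> 'o list \<Rightarrow> 'o" where
  "OTens_list C As = foldr (OTens C) As \<one>\<^bsub>C\<^esub>"

definition signature_hom ::
  "('a, 'm) signature \<Rightarrow> ('o, 'c) moncat \<Rightarrow> ('a \<Rightarrow> 'o) \<times> ('m \<Rightarrow> 'c) \<Rightarrow> bool"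
where
  "signature_hom \<Sigma> C = (\<lambda>(v\<^sub>o, v).
     v\<^sub>o \<in> sig_obj \<Sigma> \<rightarrow> Obj C \<and>
     (\<forall>m\<in>sig_mor \<Sigma>.
        v m \<in> Hom C (OTens_list C (map v\<^sub>o (sig_dom \<Sigma> m))) (OTens_list C (map v\<^sub>o (sig_cod \<Sigma> m)))))"

text \<open>The equation \<open>F \<circ> \<eta> = v\<close> of homomorphisms from \<open>\<Sigma>\<close>.\<close>

definition extends_along ::
  "('a, 'm) signature \<Rightarrow> ('a \<Rightarrow> 'p) \<times> ('m \<Rightarrow> 'd) \<Rightarrow> ('p \<Rightarrow> 'o) \<times> ('d \<Rightarrow> 'c) \<Rightarrow>
   ('a \<Rightarrow> 'o) \<times> ('m \<Rightarrow> 'c) \<Rightarrow> bool"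
where
  "extends_along \<Sigma> \<eta> F v \<longleftrightarrow>
     (\<forall>A\<in>sig_obj \<Sigma>. fst F (fst \<eta> A) = fst v A) \<and> (\<forall>m\<in>sig_mor \<Sigma>. snd F (snd \<eta> m) = snd v m)"


section \<open>The category of a tensor system\<close>

definition fresh :: "('u, 'l) labelling \<Rightarrow> 'l set \<Rightarrow> 'u list \<Rightarrow> 'l list" where
  "fresh \<Lambda> N Xs = (SOME as. distinct as \<and> set as \<subseteq> labels \<Lambda> - N \<and> map (label_type \<Lambda>) as = Xs)"

definition lmap :: "'l list \<Rightarrow> 'l list \<Rightarrow> 'l \<Rightarrow> 'l" where
  "lmap as bs a = (case map_of (zip as bs) a of None \<Rightarrow> a | Some b \<Rightarrow> b)"

definition thom :: "('u, 'l) labelling \<Rightarrow> ('l, 't) tensor_system \<Rightarrow> 'u list \<Rightarrow> 'u list \<Rightarrow> 't set" where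
  "thom \<Lambda> S X Y = tensors S (set (canons \<Lambda> False 0 X)) (set (canons \<Lambda> True 0 Y))"

text \<open>
  As the labels \<open>canons \<Lambda> False 0 X\<close> and \<open>canons \<Lambda> True 0 Y\<close> determine \<open>X\<close> and \<open>Y\<close>, the hom-sets are
  pairwise disjoint and the following two functions recover the domain and the codomain.
\<close>

definition tdom :: "('u, 'l) labelling \<Rightarrow> ('l, 't) tensor_system \<Rightarrow> 't \<Rightarrow> 'u list" where
  "tdom \<Lambda> S t = (THE X. X \<in> lists (types \<Lambda>) \<and> (\<exists>Y\<in>lists (types \<Lambda>). t \<in> thom \<Lambda> S X Y))"

definition tcod :: "('u, 'l) labelling \<Rightarrow> ('l, 't) tensor_system \<Rightarrow> 't \<Rightarrow> 'u list" where
  "tcod \<Lambda> S t = (THE Y. Y \<in> lists (types \<Lambda>) \<and> (\<exists>X\<in>lists (types \<Lambda>). t \<in> thom \<Lambda> S X Y))"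

text \<open>
  \<open>at_labels \<Lambda> S X Y t as bs\<close> is the tensor \<open>t \<in> thom \<Lambda> S X Y\<close> with its ordered lower and upper labels
  replaced by \<open>as\<close> and \<open>bs\<close>.
\<close>

definition at_labels ::
  "('u, 'l) labelling \<Rightarrow> ('l, 't) tensor_system \<Rightarrow> 'u list \<Rightarrow> 'u list \<Rightarrow> 't \<Rightarrow> 'l list \<Rightarrow> 'l list \<Rightarrow> 't"
where
  "at_labels \<Lambda> S X Y t as bs =
     relabel S (lmap (canons \<Lambda> False 0 X @ canons \<Lambda> True 0 Y) (as @ bs)) t"

definition contracts :: "('l, 't) tensor_system \<Rightarrow> 'l list \<Rightarrow> 'l list \<Rightarrow> 't \<Rightarrow> 't" where
  "contracts S as bs t = fold (\<lambda>(a, b). contract S a b) (zip as bs) t"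

definition deltas :: "('l, 't) tensor_system \<Rightarrow> 'l list \<Rightarrow> 'l list \<Rightarrow> 't" where
  "deltas S as bs = foldr (\<lambda>(a, b). product S (delta S a b)) (zip as bs) (one S)"

text \<open>
  A list of repeated labels is split into two lists \<open>p\<close> (upper occurrences) and \<open>q\<close> (lower
  occurrences) of distinct fresh labels, which are contracted pairwise after taking the product.
\<close>

definition tcomp :: "('u, 'l) labelling \<Rightarrow> ('l, 't) tensor_system \<Rightarrow> 't \<Rightarrow> 't \<Rightarrow> 't" where
  "tcomp \<Lambda> S \<phi> \<psi> =
     (let X = tdom \<Lambda> S \<psi>; Y = tcod \<Lambda> S \<psi>; Z = tcod \<Lambda> S \<phi>;
          x = canons \<Lambda> False 0 X; z = canons \<Lambda> True 0 Z;
          w = fresh \<Lambda> (set x \<union> set z) (Y @ Y);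
          p = take (length Y) w; q = drop (length Y) w
      in contracts S q p (product S (at_labels \<Lambda> S X Y \<psi> x p) (at_labels \<Lambda> S Y Z \<phi> q z)))"

definition ttens :: "('u, 'l) labelling \<Rightarrow> ('l, 't) tensor_system \<Rightarrow> 't \<Rightarrow> 't \<Rightarrow> 't" where
  "ttens \<Lambda> S \<psi> \<phi> =
     (let X = tdom \<Lambda> S \<psi>; Y = tcod \<Lambda> S \<psi>; U = tdom \<Lambda> S \<phi>; V = tcod \<Lambda> S \<phi>
      in product S
        (at_labels \<Lambda> S X Y \<psi> (canons \<Lambda> False 0 X) (canons \<Lambda> True 0 Y))
        (at_labels \<Lambda> S U V \<phi> (canons \<Lambda> False (length X) U) (canons \<Lambda> True (length Y) V)))"

definition tsymm :: "('u, 'l) labelling \<Rightarrow> ('l, 't) tensor_system \<Rightarrow> 'u list \<Rightarrow> 'u list \<Rightarrow> 't" where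
  "tsymm \<Lambda> S X Y =
     product S
       (deltas S (canons \<Lambda> False 0 X) (canons \<Lambda> True (length Y) X))
       (deltas S (canons \<Lambda> False (length X) Y) (canons \<Lambda> True 0 Y))"

definition ttrace ::
  "('u, 'l) labelling \<Rightarrow> ('l, 't) tensor_system \<Rightarrow> 'u list \<Rightarrow> 'u list \<Rightarrow> 'u list \<Rightarrow> 't \<Rightarrow> 't"
where
  "ttrace \<Lambda> S U V X \<xi> =
     (let u = canons \<Lambda> False 0 U; v = canons \<Lambda> True 0 V;
          w = fresh \<Lambda> (set u \<union> set v) (X @ X);
          p = take (length X) w; q = drop (length X) w
      in contracts S q p (at_labels \<Lambda> S (U @ X) (V @ X) \<xi> (u @ q) (v @ p)))"

definition Cat :: "('u, 'l) labelling \<Rightarrow> ('l, 't) tensor_system \<Rightarrow> ('u list, 't) moncat" where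
  "Cat \<Lambda> S = \<lparr>
     Obj = lists (types \<Lambda>),
     Arr = (\<Union>X\<in>lists (types \<Lambda>). \<Union>Y\<in>lists (types \<Lambda>). thom \<Lambda> S X Y),
     Dom = tdom \<Lambda> S,
     Cod = tcod \<Lambda> S,
     Ide = (\<lambda>X. deltas S (canons \<Lambda> False 0 X) (canons \<Lambda> True 0 X)),
     Comp = tcomp \<Lambda> S,
     OTens = (@),
     ATens = ttens \<Lambda> S,
     Unit = [],
     Symm = tsymm \<Lambda> S,
     Tr = ttrace \<Lambda> S\<rparr>"

text \<open>
  The unit of the universal property: a type is sent to the one-element list and a symbol to the
  class of the one-element expression consisting of the symbol with its own canonical labels.
\<close>

definition eta ::
  "('u, 'l) labelling \<Rightarrow> ('s, 'u) alphabet \<Rightarrow> ('u \<Rightarrow> 'u list) \<times> ('s \<Rightarrow> ('s, 'l) expr set)"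
where
  "eta \<Lambda> \<A> =
     (\<lambda>X. [X],
      \<lambda>\<psi>. expr_class \<Lambda> \<A>
        [Tensor \<psi> (canons \<Lambda> False 0 (lower_types \<A> \<psi>)) (canons \<Lambda> True 0 (upper_types \<A> \<psi>))])"

end

theory Submission
  imports Defs
begin

text \<open>
  An Einstein expression is a string diagram with feedback written as a list: the entries are the boxes and
  plain wires (the deltas), and a repeated label is a wire from an upper label, an output, to a lower label, an
  input.  The relation generated by permutation, renaming and elimination of deltas says that only the diagram
  matters.  The theorem holds because every diagram can be cut into boxes placed side by side, a permutation of
  wires on either side, and a trace over the cut wires, and because the laws of a traced symmetric monoidal
  category make the result independent of the cut.

  The category of diagrams.  An expression \<open>E\<close> with its free lower and upper labels listed as \<open>as\<close> and
  \<open>bs\<close> names the arrow \<open>cls E as bs\<close>.  Equivalence is a congruence (\<open>expr_eq_context\<close>) and the names of labels are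
  irrelevant (\<open>cls_ren\<close>), so representatives can be chosen that share exactly the labels one wants.
  For such representatives composition and tensor product are both concatenation of lists (\<open>comp_cls\<close>,
  \<open>tens_cls\<close>), and the trace identifies labels (\<open>trace_cls\<close>).  Concatenation is associative and the order
  of a list is irrelevant, which settles all axioms without identities and symmetries.  Those two are
  lists of deltas, which are absorbed by the expression they are attached to (\<open>whisker_after\<close>,
  \<open>whisker_before\<close>, \<open>swap_after\<close>, \<open>swap_before\<close>); this gives the remaining axioms.

  Existence.  In a strict traced symmetric monoidal category \<open>C\<close> with values for types and symbols, the value
  \<open>val E as bs\<close> is the trace, over the bound wires, of the tensor product of the values of the entries,
  composed with permutations of wires on both sides.  It is well defined because a permutation of a list
  of distinct wires has only one interpretation (\<open>coherence\<close>) and because bound wires may be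
  reordered by sliding them around the trace (\<open>wired_unique\<close>).  It respects the equivalence: permuting entries is
  naturality of the symmetry (\<open>parallel_permute\<close>), and eliminating a delta is yanking a loop straight
  (\<open>tr_yank_inside\<close>).  The rules for concatenation and identification of labels hold for \<open>val\<close>
  as well (\<open>val_tens\<close>, \<open>val_comp\<close>, \<open>val_trace\<close>), so \<open>val\<close> is a functor.

  Uniqueness.  Cutting all bound wires of an expression shows that the symbols generate the category of
  diagrams under its operations (\<open>generated\<close>), so two functors that agree on the symbols are equal.
\<close>

section \<open>Renaming of Einstein expressions\<close>

definition emap :: "('l \<Rightarrow> 'l) \<Rightarrow> ('l \<Rightarrow> 'l) \<Rightarrow> ('s, 'l) expr \<Rightarrow> ('s, 'l) expr" where
  "emap f g E = map (elem_map f g) E"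

abbreviation "lbl \<equiv> expr_labels"

abbreviation ren :: "('l \<Rightarrow> 'l) \<Rightarrow> ('s, 'l) expr \<Rightarrow> ('s, 'l) expr" where
  "ren r \<equiv> emap r r"

lemma elem_lower_map [simp]: "elem_lower (elem_map f g e) = map f (elem_lower e)"
  by (cases e) auto

lemma elem_upper_map [simp]: "elem_upper (elem_map f g e) = map g (elem_upper e)"
  by (cases e) auto

lemma lower_Nil [simp]: "lower [] = []" and upper_Nil [simp]: "upper [] = []"
  by (auto simp: lower_def upper_def)

lemma lower_Cons [simp]: "lower (e # E) = elem_lower e @ lower E"
  and upper_Cons [simp]: "upper (e # E) = elem_upper e @ upper E"
  by (auto simp: lower_def upper_def)

lemma lower_append [simp]: "lower (E @ E') = lower E @ lower E'"
  and upper_append [simp]: "upper (E @ E') = upper E @ upper E'"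
  by (auto simp: lower_def upper_def)

lemma lower_emap [simp]: "lower (emap f g E) = map f (lower E)"
  and upper_emap [simp]: "upper (emap f g E) = map g (upper E)"
  by (induction E) (auto simp: emap_def)

lemma emap_Nil [simp]: "emap f g [] = []"
  and emap_Cons [simp]: "emap f g (e # E) = elem_map f g e # emap f g E"
  and emap_append [simp]: "emap f g (E @ E') = emap f g E @ emap f g E'"
  by (auto simp: emap_def)

lemma mset_emap: "mset E = mset E' \<Longrightarrow> mset (emap f g E) = mset (emap f g E')"
  by (simp add: emap_def)

lemma elem_map_elem_map: "elem_map f g (elem_map f' g' e) = elem_map (f \<circ> f') (g \<circ> g') e"
  by (cases e) auto

lemma emap_emap [simp]: "emap f g (emap f' g' E) = emap (f \<circ> f') (g \<circ> g') E"
  by (induction E) (auto simp only: emap_Nil emap_Cons elem_map_elem_map)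

lemma elem_map_cong:
  "(\<And>a. a \<in> set (elem_lower e) \<Longrightarrow> f a = f' a) \<Longrightarrow> (\<And>a. a \<in> set (elem_upper e) \<Longrightarrow> g a = g' a) \<Longrightarrow>
   elem_map f g e = elem_map f' g' e"
  by (cases e) auto

lemma emap_cong:
  "(\<And>a. a \<in> set (lower E) \<Longrightarrow> f a = f' a) \<Longrightarrow> (\<And>a. a \<in> set (upper E) \<Longrightarrow> g a = g' a) \<Longrightarrow>
   emap f g E = emap f' g' E"
  by (induction E) (auto intro!: elem_map_cong)

lemma elem_map_id: "elem_map id id e = e"
  by (cases e) auto

lemma emap_id: "emap id id E = E"
  by (induction E) (auto simp only: emap_Nil emap_Cons elem_map_id)

lemma emap_idI:
  "(\<And>a. a \<in> set (lower E) \<Longrightarrow> f a = a) \<Longrightarrow> (\<And>a. a \<in> set (upper E) \<Longrightarrow> g a = a) \<Longrightarrow> emap f g E = E"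
  using emap_cong[of E f id g id] by (simp add: emap_id)

lemma repl_lower_emap: "repl_lower a b E = emap (id(a := b)) id E"
  and repl_upper_emap: "repl_upper a b E = emap id (id(a := b)) E"
  by (auto simp: repl_lower_def repl_upper_def emap_def)

lemma mset_lower: "mset (lower E) = (\<Sum>e\<in>#mset E. mset (elem_lower e))"
  and mset_upper: "mset (upper E) = (\<Sum>e\<in>#mset E. mset (elem_upper e))"
  by (induction E) auto

lemma permute_labels:
  assumes "mset E = mset E'"
  shows "mset (lower E) = mset (lower E')" "mset (upper E) = mset (upper E')"
  by (simp_all add: mset_lower mset_upper assms)

lemma permute_label_sets:
  assumes "mset E = mset E'"
  shows "set (lower E) = set (lower E')" "set (upper E) = set (upper E')"
    "lbl E = lbl E'" "bound E = bound E'" "free E = free E'"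
    "free_lower E = free_lower E'" "free_upper E = free_upper E'"
  using permute_labels[OF assms, THEN mset_eq_setD]
  by (simp_all add: expr_labels_def bound_def free_def free_lower_def free_upper_def)

lemma free_lower_alt: "free_lower E = set (lower E) - set (upper E)"
  and free_upper_alt: "free_upper E = set (upper E) - set (lower E)"
  and free_alt: "free E = free_lower E \<union> free_upper E"
  by (auto simp: free_lower_def free_upper_def bound_def free_def expr_labels_def)

lemma labels_free_bound: "lbl E = free E \<union> bound E"
  and free_bound_disjoint: "free E \<inter> bound E = {}"
  by (auto simp: free_def bound_def expr_labels_def)

lemma finite_labels [simp]: "finite (lbl E)" "finite (free E)" "finite (bound E)"
  by (auto simp: free_def bound_def expr_labels_def)

lemma expr_labels_append [simp]: "lbl (E @ E') = lbl E \<union> lbl E'"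
  and expr_labels_Nil [simp]: "lbl [] = {}"
  and expr_labels_ren: "lbl (ren r E) = r ` lbl E"
  by (auto simp: expr_labels_def)

lemma bound_ren: "inj_on r (lbl E) \<Longrightarrow> bound (ren r E) = r ` bound E"
  by (simp add: bound_def expr_labels_def inj_on_image_Int[of r "set (lower E) \<union> set (upper E)"])

lemma free_lower_ren: "inj_on r (lbl E) \<Longrightarrow> free_lower (ren r E) = r ` free_lower E"
  and free_upper_ren: "inj_on r (lbl E) \<Longrightarrow> free_upper (ren r E) = r ` free_upper E"
  by (auto simp: free_lower_alt free_upper_alt expr_labels_def inj_on_def)

locale free_tensor_system =
  fixes \<Lambda> :: "('u, 'l) labelling" and \<A> :: "('s, 'u) alphabet"
  assumes labelling: "labelling \<Lambda>" and alphabet: "alphabet \<Lambda> \<A>"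
begin

abbreviation equiv_expr (infix "\<approx>" 50) where "E \<approx> E' \<equiv> expr_eq \<Lambda> \<A> E E'"
abbreviation "ein \<equiv> einstein \<Lambda> \<A>"
abbreviation "cl \<equiv> expr_class \<Lambda> \<A>"
abbreviation "ty \<equiv> label_type \<Lambda>"
abbreviation "ok \<equiv> elem_ok \<Lambda> \<A>"
abbreviation "can \<equiv> canons \<Lambda>"
abbreviation "tylists \<equiv> lists (types \<Lambda>)"

definition type_pres :: "('l \<Rightarrow> 'l) \<Rightarrow> 'l set \<Rightarrow> bool" where
  "type_pres r A \<longleftrightarrow> (\<forall>a\<in>A. r a \<in> labels \<Lambda> \<and> ty (r a) = ty a)"

lemma type_pres_subset: "type_pres r A \<Longrightarrow> B \<subseteq> A \<Longrightarrow> type_pres r B"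
  by (auto simp: type_pres_def)

lemmas [trans] = expr_eq.trans

lemma elem_ok_map:
  assumes "ok e" "type_pres f (set (elem_lower e))" "type_pres g (set (elem_upper e))"
  shows "ok (elem_map f g e)"
proof (cases e)
  case (Delta a b)
  then show ?thesis using assms by (auto simp: type_pres_def)
next
  case (Tensor \<psi> as bs)
  then have "map (ty \<circ> f) as = map ty as" "map (ty \<circ> g) bs = map ty bs"
    using assms(2,3) by (auto simp: type_pres_def)
  moreover have "map ty as = lower_types \<A> \<psi>" "map ty bs = upper_types \<A> \<psi>"
    using assms Tensor by simp_all
  ultimately have "map (ty \<circ> f) as = lower_types \<A> \<psi>" "map (ty \<circ> g) bs = upper_types \<A> \<psi>"
    by (simp_all only:)
  with Tensor assms show ?thesis by (simp add: type_pres_def in_lists_conv_set)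
qed

lemma einstein_emap:
  assumes "ein E" "type_pres f (set (lower E))" "type_pres g (set (upper E))"
    "inj_on f (set (lower E))" "inj_on g (set (upper E))"
  shows "ein (emap f g E)"
proof -
  have "ok (elem_map f g e)" if "e \<in> set E" for e
    using that assms
    by (intro elem_ok_map) (auto simp: einstein_def type_pres_def lower_def upper_def)
  with assms show ?thesis by (auto simp: einstein_def emap_def distinct_map[symmetric])
      (auto simp: einstein_def emap_def[symmetric] distinct_map)
qed

lemma einstein_ren:
  "ein E \<Longrightarrow> type_pres r (lbl E) \<Longrightarrow> inj_on r (lbl E) \<Longrightarrow> ein (ren r E)"
  by (rule einstein_emap) (auto simp: expr_labels_def type_pres_def inj_on_def)

lemma einstein_labels: "ein E \<Longrightarrow> lbl E \<subseteq> labels \<Lambda>"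
proof -
  have "ok e \<Longrightarrow> set (elem_lower e) \<union> set (elem_upper e) \<subseteq> labels \<Lambda>" for e
    by (cases e) auto
  then show "ein E \<Longrightarrow> lbl E \<subseteq> labels \<Lambda>"
    by (fastforce simp: expr_labels_def lower_def upper_def einstein_def)
qed

lemma einstein_append:
  "ein (E @ E') \<longleftrightarrow> ein E \<and> ein E' \<and> set (lower E) \<inter> set (lower E') = {} \<and>
     set (upper E) \<inter> set (upper E') = {}"
  by (auto simp: einstein_def)

lemma einstein_permute: "ein E \<Longrightarrow> mset E = mset E' \<Longrightarrow> ein E'"
  by (simp add: einstein_def mset_eq_setD[of E E'] permute_labels[of E E', THEN mset_eq_imp_distinct_iff])

lemma einstein_delta:
  "ein [Delta a b] \<longleftrightarrow> a \<in> labels \<Lambda> \<and> b \<in> labels \<Lambda> \<and> ty a = ty b"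
  by (auto simp: einstein_def)

lemma einstein_repl_upper:
  "ein (E @ [Delta a b]) \<Longrightarrow> ein (repl_upper a b E)"
  "ein (E @ [Delta a b]) \<Longrightarrow> ein (repl_lower b a E)"
  unfolding repl_upper_emap repl_lower_emap using einstein_labels[of E]
  by (auto simp: einstein_append einstein_delta type_pres_def inj_on_def expr_labels_def intro!: einstein_emap)

lemma expr_eq_einstein: "E \<approx> E' \<Longrightarrow> ein E \<and> ein E'"
proof (induction rule: expr_eq.induct)
  case (permute E E')
  then show ?case using einstein_permute by blast
next
  case (rename E a a')
  have "ein (ren (id(a := a')) E)"
    using rename einstein_labels[OF rename(1)]
    by (intro einstein_ren) (auto simp: type_pres_def inj_on_def)
  with rename show ?case by (simp add: repl_lower_emap repl_upper_emap)
qed (auto intro: einstein_repl_upper)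

lemma free_delta_upper:
  assumes "ein (E @ [Delta a b])" "a \<in> set (upper E)"
  shows "free_lower (E @ [Delta a b]) = free_lower (repl_upper a b E)"
    "free_upper (E @ [Delta a b]) = free_upper (repl_upper a b E)"
proof -
  have *: "a \<notin> set (lower E)" "b \<notin> set (upper E)" using assms by (auto simp: einstein_append)
  have "set (upper (repl_upper a b E)) = insert b (set (upper E) - {a})"
    using assms * by (auto simp: repl_upper_emap)
  moreover have "lower (repl_upper a b E) = lower E" by (simp add: repl_upper_emap)
  ultimately show "free_lower (E @ [Delta a b]) = free_lower (repl_upper a b E)"
    "free_upper (E @ [Delta a b]) = free_upper (repl_upper a b E)"
    using assms(2) * by (auto simp: free_lower_alt free_upper_alt)
qed

lemma free_delta_lower:
  assumes "ein (E @ [Delta a b])" "b \<in> set (lower E)"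
  shows "free_lower (E @ [Delta a b]) = free_lower (repl_lower b a E)"
    "free_upper (E @ [Delta a b]) = free_upper (repl_lower b a E)"
proof -
  have *: "a \<notin> set (lower E)" "b \<notin> set (upper E)" using assms by (auto simp: einstein_append)
  have "set (lower (repl_lower b a E)) = insert a (set (lower E) - {b})"
    using assms * by (auto simp: repl_lower_emap)
  moreover have "upper (repl_lower b a E) = upper E" by (simp add: repl_lower_emap)
  ultimately show "free_lower (E @ [Delta a b]) = free_lower (repl_lower b a E)"
    "free_upper (E @ [Delta a b]) = free_upper (repl_lower b a E)"
    using assms(2) * by (auto simp: free_lower_alt free_upper_alt)
qed

lemma expr_eq_free:
  "E \<approx> E' \<Longrightarrow> free_lower E = free_lower E' \<and> free_upper E = free_upper E'"
proof (induction rule: expr_eq.induct)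
  case (permute E E')
  show ?case using permute_label_sets(6,7)[OF permute(2)] by simp
next
  case (rename E a a')
  have inj: "inj_on (id(a := a')) (lbl E)" using rename by (auto simp: inj_on_def)
  have "a \<notin> free_lower E" "a \<notin> free_upper E" using rename by (auto simp: free_lower_def free_upper_def)
  then have "id(a := a') ` free_lower E = free_lower E" "id(a := a') ` free_upper E = free_upper E"
    by force+
  then show ?case
    by (simp add: repl_lower_emap repl_upper_emap free_lower_ren[OF inj] free_upper_ren[OF inj])
qed (auto simp: free_delta_upper free_delta_lower)

lemma ex_fresh_renaming:
  assumes "finite B" "B \<subseteq> labels \<Lambda>" "finite N"
  shows "\<exists>s. inj_on s B \<and> type_pres s B \<and> s ` B \<inter> N = {}"
  using assms(1,2)
proof (induction rule: finite_induct)
  case empty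
  then show ?case by (auto simp: type_pres_def)
next
  case (insert c B)
  then obtain s where s: "inj_on s B" "type_pres s B" "s ` B \<inter> N = {}" by auto
  have "ty c \<in> types \<Lambda>" using labelling insert by (auto simp: labelling_def)
  then have "infinite {a \<in> labels \<Lambda>. ty a = ty c}" using labelling by (auto simp: labelling_def)
  from infinite_imp_nonempty[OF Diff_infinite_finite[OF _ this, of "N \<union> s ` B"]]
  obtain d where d: "d \<in> labels \<Lambda>" "ty d = ty c" "d \<notin> N" "d \<notin> s ` B"
    using \<open>finite N\<close> insert by auto
  have "inj_on (s(c := d)) (insert c B) \<and> type_pres (s(c := d)) (insert c B) \<and>
      (s(c := d)) ` insert c B \<inter> N = {}"
    using s d insert.hyps by (auto simp: type_pres_def inj_on_def split: if_splits)
  then show ?case by blast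
qed

lemma ex_extended_renaming:
  assumes "finite B" "B \<subseteq> labels \<Lambda>" "finite N" "finite A" "inj_on f A" "type_pres f A"
  shows "\<exists>r. inj_on r (A \<union> B) \<and> type_pres r (A \<union> B) \<and> (\<forall>a\<in>A. r a = f a) \<and> r ` (B - A) \<inter> N = {}"
proof -
  obtain s where s: "inj_on s B" "type_pres s B" "s ` B \<inter> (N \<union> f ` A) = {}"
    using ex_fresh_renaming[OF assms(1,2), of "N \<union> f ` A"] assms by auto
  define r where "r a = (if a \<in> A then f a else s a)" for a
  have "inj_on r (A \<union> B)"
    using s assms(5) unfolding inj_on_def r_def by (auto; blast)
  moreover have "type_pres r (A \<union> B)" "\<forall>a\<in>A. r a = f a" "r ` (B - A) \<inter> N = {}"
    using s assms by (auto simp: type_pres_def r_def)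
  ultimately show ?thesis by blast
qed

text \<open>
  A single renaming step changes one bound label, to one that does not occur.  As the new labels lie outside \<open>E\<close>,
  the labels in \<open>S\<close> can be changed one after the other without a clash.
\<close>

lemma rename_fresh:
  assumes "ein E" "finite S" "S \<subseteq> bound E" "inj_on r S" "type_pres r S" "r ` S \<inter> lbl E = {}"
  shows "E \<approx> ren (\<lambda>a. if a \<in> S then r a else a) E"
  using assms(2-)
proof (induction rule: finite_induct)
  case empty
  then show ?case using assms(1) by (simp add: emap_id[unfolded id_def] expr_eq.refl)
next
  case (insert c S)
  let ?s = "\<lambda>a. if a \<in> S then r a else a"
  let ?E = "ren ?s E"
  have IH: "E \<approx> ?E" using insert by (auto simp: type_pres_def inj_on_def)
  have c: "c \<in> lbl E" "c \<in> set (lower E)" "c \<in> set (upper E)"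
    using insert.prems by (auto simp: bound_def expr_labels_def)
  have "?E \<approx> repl_lower c (r c) (repl_upper c (r c) ?E)"
  proof (rule expr_eq.rename)
    show "ein ?E" using expr_eq_einstein[OF IH] by blast
    have "c \<in> ?s ` set (lower E)" "c \<in> ?s ` set (upper E)"
      using c insert.hyps by (auto simp: image_iff intro!: bexI[of _ c])
    then show "c \<in> bound ?E" by (simp add: bound_def)
    show "r c \<in> labels \<Lambda>" "ty (r c) = ty c" using insert by (auto simp: type_pres_def)
    show "r c \<notin> lbl ?E"
      using insert.prems insert.hyps c by (auto simp: expr_labels_ren inj_on_def)
  qed
  also have "repl_lower c (r c) (repl_upper c (r c) ?E) =
      ren (\<lambda>a. if a \<in> insert c S then r a else a) E"
    unfolding repl_lower_emap repl_upper_emap emap_emap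
  proof (rule emap_cong)
    have *: "r a \<noteq> c" if "a \<in> S" for a using that insert.prems c by auto
    show "((id(c := r c)) \<circ> (id \<circ> ?s)) a = (if a \<in> insert c S then r a else a)" for a
      using * by auto
    show "(id \<circ> (id(c := r c) \<circ> ?s)) a = (if a \<in> insert c S then r a else a)" for a
      using * by auto
  qed
  finally show ?case using IH expr_eq.trans by blast
qed

text \<open>
  A renaming may exchange bound labels or send one to the old name of another, which single steps cannot
  do directly.  Both sides become equal when their bound labels are moved to a third, fresh set of names.
\<close>

lemma rename_bound:
  assumes E: "ein E" and r: "inj_on r (lbl E)" "type_pres r (lbl E)"
    and fixed: "\<And>a. a \<in> free E \<Longrightarrow> r a = a"
  shows "E \<approx> ren r E"
proof -
  let ?B = "bound E"
  have B: "?B \<subseteq> lbl E" by (simp add: labels_free_bound)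
  \<comment> \<open>The third set of names, away from the labels of both expressions.\<close>
  obtain s where s: "inj_on s ?B" "type_pres s ?B" "s ` ?B \<inter> (lbl E \<union> r ` lbl E) = {}"
    using ex_fresh_renaming[of ?B "lbl E \<union> r ` lbl E"] einstein_labels[OF E] B
    by (meson finite_UnI finite_imageI finite_labels order_trans)
  have 1: "E \<approx> ren (\<lambda>a. if a \<in> ?B then s a else a) E"
    using s by (intro rename_fresh E) auto
  define q where "q = inv_into (lbl E) r"
  have q: "q (r a) = a" if "a \<in> lbl E" for a using r that by (simp add: q_def)
  have "ren r E \<approx> ren (\<lambda>a. if a \<in> r ` ?B then (s \<circ> q) a else a) (ren r E)"
  proof (rule rename_fresh)
    show "ein (ren r E)" by (intro einstein_ren E r)
    show "r ` ?B \<subseteq> bound (ren r E)" using r by (simp add: bound_ren)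
    show "inj_on (s \<circ> q) (r ` ?B)" using s q B by (auto simp: inj_on_def subset_iff)
    show "type_pres (s \<circ> q) (r ` ?B)" using s q B r by (auto simp: type_pres_def subset_iff)
    show "(s \<circ> q) ` r ` ?B \<inter> lbl (ren r E) = {}"
    proof -
      have "(s \<circ> q) ` r ` ?B = s ` ?B" using q B by (force simp: image_iff)
      with s show ?thesis by (auto simp: expr_labels_ren)
    qed
  qed simp
  also have "ren (\<lambda>a. if a \<in> r ` ?B then (s \<circ> q) a else a) (ren r E) =
      ren (\<lambda>a. if a \<in> ?B then s a else a) E"
  proof -
    have *: "(if r a \<in> r ` ?B then (s \<circ> q) (r a) else r a) = (if a \<in> ?B then s a else a)"
      if "a \<in> lbl E" for a
    proof (cases "a \<in> ?B")
      case False
      then have "a \<in> free E" using that by (simp add: labels_free_bound)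
      moreover have "r a \<notin> r ` ?B" using False that r(1) B by (auto simp: inj_on_def)
      ultimately show ?thesis using False fixed by simp
    qed (simp add: q that)
    show ?thesis unfolding emap_emap by (rule emap_cong) (use * in \<open>auto simp: expr_labels_def\<close>)
  qed
  finally show ?thesis using 1 expr_eq.sym expr_eq.trans by blast
qed

text \<open>
  The copy \<open>ren r E\<close> can be placed next to \<open>D\<close>: the two form an Einstein expression, and they share only labels
  that are free in the copy.
\<close>

definition fits :: "('l \<Rightarrow> 'l) \<Rightarrow> ('s, 'l) expr \<Rightarrow> ('s, 'l) expr \<Rightarrow> bool" where
  "fits r E D \<longleftrightarrow> inj_on r (lbl E) \<and> type_pres r (lbl E) \<and> ein (ren r E @ D) \<and>
     r ` bound E \<inter> lbl D = {}"

text \<open>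
  Seen in the whole expression, the two sides differ by a renaming of labels that are bound there.
\<close>

lemma rename_in_context:
  assumes r: "fits r E D" and r': "fits r' E D" and agree: "\<And>a. a \<in> free E \<Longrightarrow> r a = r' a"
  shows "ren r E @ D \<approx> ren r' E @ D"
proof -
  let ?L = "lbl E"
  define q where "q = inv_into ?L r"
  have q: "q (r a) = a" if "a \<in> ?L" for a using r that by (simp add: q_def fits_def)
  \<comment> \<open>The renaming of the whole expression that turns the first copy into the second.\<close>
  define s where "s a = (if a \<in> r ` ?L then r' (q a) else a)" for a
  have sr: "s (r a) = r' a" if "a \<in> ?L" for a using q that by (simp add: s_def)
  have sD: "s a = a" if "a \<in> lbl D" for a
  proof (cases "a \<in> r ` ?L")
    case True
    then obtain c where c: "c \<in> ?L" "a = r c" by blast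
    then have "c \<notin> bound E" using r that by (auto simp: fits_def)
    then have "r c = r' c" using c agree by (auto simp: labels_free_bound)
    then show ?thesis using c sr by metis
  qed (simp add: s_def)
  have "ren r E @ D \<approx> ren s (ren r E @ D)"
  proof (rule rename_bound)
    show "ein (ren r E @ D)" using r by (simp add: fits_def)
    have *: "r' c \<noteq> d" if "c \<in> ?L" "d \<in> lbl D" "d \<notin> r ` ?L" for c d
    proof (cases "c \<in> bound E")
      case True then show ?thesis using r' that by (auto simp: fits_def)
    next
      case False
      then have "r c = r' c" using agree that by (auto simp: labels_free_bound)
      then show ?thesis using that by (metis imageI)
    qed
    have "inj_on r' ?L" using r' by (simp add: fits_def)
    moreover have "s d = d" if "d \<in> lbl D" for d using sD that .
    ultimately show "inj_on s (lbl (ren r E @ D))"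
    proof -
      assume inj: "inj_on r' ?L"
      show ?thesis
      proof (rule inj_onI)
        fix x y assume xy: "x \<in> lbl (ren r E @ D)" "y \<in> lbl (ren r E @ D)" "s x = s y"
        have x: "(\<exists>c\<in>?L. x = r c \<and> s x = r' c) \<or> x \<in> lbl D \<and> x \<notin> r ` ?L \<and> s x = x"
          using xy(1) sr sD by (auto simp: expr_labels_ren)
        have y: "(\<exists>c\<in>?L. y = r c \<and> s y = r' c) \<or> y \<in> lbl D \<and> y \<notin> r ` ?L \<and> s y = y"
          using xy(2) sr sD by (auto simp: expr_labels_ren)
        from x y xy(3) inj * show "x = y" by (auto dest: inj_onD) metis+
      qed
    qed
    have "ein D" using r by (auto simp: fits_def einstein_append)
    then show "type_pres s (lbl (ren r E @ D))"
      using r r' sr sD einstein_labels[of D] by (auto simp: type_pres_def expr_labels_ren fits_def)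
    fix a assume a: "a \<in> free (ren r E @ D)"
    show "s a = a"
    proof (cases "a \<in> lbl D")
      case False
      with a obtain c where c: "c \<in> ?L" "a = r c"
        by (auto simp: free_def expr_labels_ren)
      have "c \<notin> bound E" using a c by (auto simp: free_def bound_def)
      then have "r c = r' c" using c agree by (auto simp: labels_free_bound)
      then show ?thesis using c sr by metis
    qed (rule sD)
  qed
  also have "ren s (ren r E @ D) = ren r' E @ D"
  proof -
    have "ren (s \<circ> r) E = ren r' E" using sr by (intro emap_cong) (auto simp: expr_labels_def)
    moreover have "ren s D = D" using sD by (intro emap_idI) (auto simp: expr_labels_def)
    ultimately show ?thesis by simp
  qed
  finally show ?thesis .
qed

lemma fits_cong:
  assumes "fits r E D" "lbl E' \<subseteq> lbl E" "bound E' \<subseteq> bound E" "ein (ren r E' @ D)"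
  shows "fits r E' D"
  using assms inj_on_subset[of r "lbl E" "lbl E'"] type_pres_subset[of r "lbl E" "lbl E'"]
  by (auto simp: fits_def)

text \<open>
  Provides the renaming of an intermediate expression in a chain of equivalences.  It must agree with \<open>r\<close> on
  the free labels, and its bound labels are chosen away from the context.
\<close>

lemma ex_fits:
  assumes r: "fits r E D" and eq: "free_lower E = free_lower E'" "free_upper E = free_upper E'"
    and E': "ein E'" and N: "finite N"
  shows "\<exists>r'. fits r' E' D \<and> (\<forall>a\<in>free E'. r' a = r a) \<and> r' ` bound E' \<inter> N = {}"
proof -
  have F: "free E' \<subseteq> lbl E" using eq by (auto simp: free_alt labels_free_bound)
  have "inj_on r (free E')" "type_pres r (free E')"
    using r F inj_on_subset type_pres_subset by (auto simp: fits_def)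
  then obtain r' where r': "inj_on r' (free E' \<union> bound E')" "type_pres r' (free E' \<union> bound E')"
     "\<forall>a\<in>free E'. r' a = r a" "r' ` (bound E' - free E') \<inter> (N \<union> lbl D) = {}"
    using ex_extended_renaming[of "bound E'" "N \<union> lbl D" "free E'" r] einstein_labels[OF E'] N
    by (auto simp: labels_free_bound)
  have r'b: "r' ` bound E' \<inter> (N \<union> lbl D) = {}"
    using r'(4) free_bound_disjoint[of E'] by (auto simp: disjoint_iff)
  have D: "ein D" using r by (auto simp: fits_def einstein_append)
  have "ein (ren r' E' @ D)"
    unfolding einstein_append
  proof (intro conjI D)
    show "ein (ren r' E')" using r' by (intro einstein_ren E') (auto simp: labels_free_bound)
    have "r' a \<notin> set (lower D)" if a: "a \<in> set (lower E')" for a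
    proof (cases "a \<in> bound E'")
      case True then show ?thesis using r'b by (auto simp: expr_labels_def)
    next
      case False
      then have "a \<in> free_lower E'" using a by (auto simp: free_lower_def)
      then have "a \<in> set (lower E)" "a \<in> free E'" using eq by (auto simp: free_lower_def free_alt)
      then show ?thesis using r r' by (auto simp: fits_def einstein_append)
    qed
    then show "set (lower (ren r' E')) \<inter> set (lower D) = {}" by auto
    have "r' a \<notin> set (upper D)" if a: "a \<in> set (upper E')" for a
    proof (cases "a \<in> bound E'")
      case True then show ?thesis using r'b by (auto simp: expr_labels_def)
    next
      case False
      then have "a \<in> free_upper E'" using a by (auto simp: free_upper_def)
      then have "a \<in> set (upper E)" "a \<in> free E'" using eq by (auto simp: free_upper_def free_alt)
      then show ?thesis using r r' by (auto simp: fits_def einstein_append)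
    qed
    then show "set (upper (ren r' E')) \<inter> set (upper D) = {}" by auto
  qed
  then have "fits r' E' D" using r' r'b by (auto simp: fits_def labels_free_bound)
  with r' r'b show ?thesis by blast
qed

text \<open>
  Equivalence is a congruence.  The two sides are renamed independently because the expressions on the
  way from \<open>E\<close> to \<open>E'\<close> may have bound labels that occur in \<open>D\<close>; with the renamings inside the
  statement, such a clash is avoided in each step of the induction.
\<close>

lemma expr_eq_context:
  assumes "E \<approx> E'" "fits r E D" "fits r' E' D" "\<And>a. a \<in> free E \<Longrightarrow> r a = r' a"
  shows "ren r E @ D \<approx> ren r' E' @ D"
  using assms
proof (induction arbitrary: r r' rule: expr_eq.induct)
  case (refl E)
  then show ?case using rename_in_context by blast
next
  case (sym E E')
  then have "free E = free E'" using expr_eq_free by (auto simp: free_alt)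
  then have "ren r' E @ D \<approx> ren r E' @ D" using sym by (intro sym.IH) auto
  then show ?case by (rule expr_eq.sym)
next
  case (trans E E' E'')
  obtain s where s: "fits s E' D" "\<forall>a\<in>free E'. s a = r a"
    using ex_fits[of r E D E' "{}"] trans expr_eq_free[OF trans(1)] expr_eq_einstein[OF trans(1)] by auto
  have f: "free E = free E'" "free E' = free E''"
    using expr_eq_free[OF trans(1)] expr_eq_free[OF trans(2)] by (auto simp: free_alt)
  have "ren r E @ D \<approx> ren s E' @ D" using trans s f by auto
  also have "ren s E' @ D \<approx> ren r' E'' @ D" using trans s f by auto
  finally show ?case .
next
  case (permute E E')
  have "ren r E @ D \<approx> ren r E' @ D"
    using permute by (intro expr_eq.permute) (auto simp: fits_def mset_emap[OF permute(2)])
  moreover from expr_eq_einstein[OF this] have "fits r E' D"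
    using fits_cong[OF permute(3), of E'] permute_label_sets(3,4)[OF permute(2)] by simp
  then have "ren r E' @ D \<approx> ren r' E' @ D"
    using permute permute_label_sets(5)[OF permute(2)] by (intro rename_in_context) simp_all
  ultimately show ?case by (rule expr_eq.trans)
next
  case (rename E a a')
  let ?s = "id(a := a')" and ?E = "repl_lower a a' (repl_upper a a' E)"
  have E: "?E = ren ?s E" by (simp add: repl_lower_emap repl_upper_emap)
  \<comment> \<open>A renaming step composed with \<open>r'\<close> is another renaming of the same expression.\<close>
  have inj: "inj_on ?s (lbl E)" using rename by (auto simp: inj_on_def)
  have "fits (r' \<circ> ?s) E D"
    unfolding fits_def
  proof (intro conjI)
    show "inj_on (r' \<circ> ?s) (lbl E)"
      using inj rename by (auto simp: fits_def E expr_labels_ren intro!: comp_inj_on)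
    show "type_pres (r' \<circ> ?s) (lbl E)"
      using rename by (auto simp: fits_def E expr_labels_ren type_pres_def)
    show "ein (ren (r' \<circ> ?s) E @ D)" using rename by (simp add: fits_def E)
    show "(r' \<circ> ?s) ` bound E \<inter> lbl D = {}"
      using rename(7) unfolding fits_def E bound_ren[OF inj] image_comp by blast
  qed
  moreover have "r c = (r' \<circ> ?s) c" if "c \<in> free E" for c
    using rename that free_bound_disjoint[of E] by auto
  ultimately have "ren r E @ D \<approx> ren (r' \<circ> ?s) E @ D"
    using rename by (intro rename_in_context) auto
  then show ?case by (simp add: E)
next
  case (delta_upper E a b)
  let ?E = "repl_upper a b E"
  have ab: "a \<in> bound (E @ [Delta a b])" using delta_upper by (auto simp: bound_def)
  have inj: "inj_on r (lbl (E @ [Delta a b]))" using delta_upper by (simp add: fits_def)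
  have "ren r (E @ [Delta a b]) @ D \<approx> (ren r E @ D) @ [Delta (r a) (r b)]"
    using delta_upper by (intro expr_eq.permute) (auto simp: fits_def)
  also from expr_eq_einstein[OF this] have "\<dots> \<approx> repl_upper (r a) (r b) (ren r E @ D)"
    using delta_upper by (intro expr_eq.delta_upper) auto
  also have "repl_upper (r a) (r b) (ren r E @ D) = ren r ?E @ D"
  proof -
    have "r a \<notin> lbl D" using ab delta_upper by (auto simp: fits_def)
    then have "emap id (id(r a := r b)) D = D" by (intro emap_idI) (auto simp: expr_labels_def)
    moreover have "emap (id \<circ> r) (id(r a := r b) \<circ> r) E = emap (r \<circ> id) (r \<circ> id(a := b)) E"
      using inj by (intro emap_cong) (auto simp: expr_labels_def inj_on_def)
    ultimately show ?thesis by (simp add: repl_upper_emap)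
  qed
  finally have *: "ren r (E @ [Delta a b]) @ D \<approx> ren r ?E @ D" .
  have "fits r ?E D"
    using expr_eq_einstein[OF *] delta_upper
    by (intro fits_cong[OF delta_upper(3)])
      (auto simp: expr_labels_def bound_def repl_upper_emap einstein_append split: if_splits)
  moreover have "r c = r' c" if "c \<in> free ?E" for c
    using expr_eq_free[OF expr_eq.delta_upper[OF delta_upper(1,2)]] that delta_upper(5) by (auto simp: free_alt)
  ultimately have "ren r ?E @ D \<approx> ren r' ?E @ D"
    using delta_upper by (intro rename_in_context) auto
  with * show ?case by (rule expr_eq.trans)
next
  case (delta_lower E a b)
  let ?E = "repl_lower b a E"
  have ab: "b \<in> bound (E @ [Delta a b])" using delta_lower by (auto simp: bound_def)
  have inj: "inj_on r (lbl (E @ [Delta a b]))" using delta_lower by (simp add: fits_def)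
  have "ren r (E @ [Delta a b]) @ D \<approx> (ren r E @ D) @ [Delta (r a) (r b)]"
    using delta_lower by (intro expr_eq.permute) (auto simp: fits_def)
  also from expr_eq_einstein[OF this] have "\<dots> \<approx> repl_lower (r b) (r a) (ren r E @ D)"
    using delta_lower by (intro expr_eq.delta_lower) auto
  also have "repl_lower (r b) (r a) (ren r E @ D) = ren r ?E @ D"
  proof -
    have "r b \<notin> lbl D" using ab delta_lower by (auto simp: fits_def)
    then have "emap (id(r b := r a)) id D = D" by (intro emap_idI) (auto simp: expr_labels_def)
    moreover have "emap (id(r b := r a) \<circ> r) (id \<circ> r) E = emap (r \<circ> id(b := a)) (r \<circ> id) E"
      using inj by (intro emap_cong) (auto simp: expr_labels_def inj_on_def)
    ultimately show ?thesis by (simp add: repl_lower_emap)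
  qed
  finally have *: "ren r (E @ [Delta a b]) @ D \<approx> ren r ?E @ D" .
  have "fits r ?E D"
    using expr_eq_einstein[OF *] delta_lower
    by (intro fits_cong[OF delta_lower(3)])
      (auto simp: expr_labels_def bound_def repl_lower_emap einstein_append split: if_splits)
  moreover have "r c = r' c" if "c \<in> free ?E" for c
    using expr_eq_free[OF expr_eq.delta_lower[OF delta_lower(1,2)]] that delta_lower(5) by (auto simp: free_alt)
  ultimately have "ren r ?E @ D \<approx> ren r' ?E @ D"
    using delta_lower by (intro rename_in_context) auto
  with * show ?case by (rule expr_eq.trans)
qed

lemma class_eqI: "E \<approx> E' \<Longrightarrow> cl E = cl E'"
proof -
  assume E: "E \<approx> E'"
  have "E \<approx> D \<longleftrightarrow> E' \<approx> D" for D
    using expr_eq.trans[OF E, of D] expr_eq.trans[OF expr_eq.sym[OF E], of D] by blast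
  then show ?thesis by (simp add: expr_class_def)
qed

lemma mem_class: "E1 \<in> cl E \<Longrightarrow> E1 \<approx> E"
  by (simp add: expr_class_def expr_eq.sym)

lemma Union_const: "x0 \<in> S \<Longrightarrow> (\<And>x. x \<in> S \<Longrightarrow> f x = c) \<Longrightarrow> \<Union> (f ` S) = c"
  by auto

lemma ren_id: "ren id E = E" by (rule emap_id)

lemma expr_eq_append:
  assumes "E \<approx> E'" "ein (E @ D)" "ein (E' @ D)" "bound E \<inter> lbl D = {}" "bound E' \<inter> lbl D = {}"
  shows "E @ D \<approx> E' @ D"
  using expr_eq_context[OF assms(1), of id D id] assms einstein_labels
  by (auto simp: fits_def ren_id type_pres_def einstein_append)

text \<open>
  Replacing the two factors in turn could produce a clash between \<open>E1\<close> and the bound labels of \<open>E'\<close>, so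
  the second factor is first replaced by a copy whose bound labels avoid both \<open>E\<close> and \<open>E1\<close>.
\<close>

lemma expr_eq_product:
  assumes "E1 \<approx> E" "E1' \<approx> E'" "lbl E1 \<inter> lbl E1' = {}" "lbl E \<inter> lbl E' = {}"
  shows "E1 @ E1' \<approx> E @ E'"
proof -
  have ein: "ein E" "ein E'" "ein E1" "ein E1'" using assms expr_eq_einstein by auto
  have "fits id E' []" using ein einstein_labels by (auto simp: fits_def ren_id type_pres_def)
  from ex_fits[OF this HOL.refl HOL.refl, of "lbl E \<union> lbl E1"] ein
  obtain r where r: "fits r E' []" "\<forall>a\<in>free E'. r a = id a" 
     "r ` bound E' \<inter> (lbl E \<union> lbl E1) = {}" by auto
  let ?E = "ren r E'"
  have E'E: "E' \<approx> ?E" using r by (intro rename_bound) (auto simp: fits_def ein)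
  have "free E' = free E1'" using expr_eq_free assms by (auto simp: free_alt)
  then have dis: "lbl ?E \<inter> (lbl E \<union> lbl E1) = {}" 
    using r assms(3,4) by (fastforce simp: labels_free_bound[of E'] labels_free_bound[of E1'] expr_labels_ren)
  have comm: "A @ B \<approx> B @ A" if "ein A" "ein B" "lbl A \<inter> lbl B = {}" for A B
    using that by (intro expr_eq.permute) (auto simp: einstein_append expr_labels_def)
  have app: "A @ D \<approx> B @ D" if "A \<approx> B" "ein D" "lbl A \<inter> lbl D = {}" 
    "lbl B \<inter> lbl D = {}" for A B D
    using that expr_eq_einstein[OF that(1)] 
    by (intro expr_eq_append) (auto simp: einstein_append expr_labels_def bound_def)
  have einE: "ein ?E" using E'E expr_eq_einstein by blast
  have "E1 @ E1' \<approx> E1' @ E1" using assms ein by (intro comm) auto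
  also have "E1' @ E1 \<approx> ?E @ E1" using assms ein dis by (intro app expr_eq.trans[OF assms(2) E'E]) auto
  also have "?E @ E1 \<approx> E1 @ ?E" using ein dis einE by (intro comm) auto
  also have "E1 @ ?E \<approx> E @ ?E" using ein dis einE by (intro app assms) auto
  also have "E @ ?E \<approx> ?E @ E" using ein dis einE by (intro comm) auto
  also have "?E @ E \<approx> E' @ E" using assms ein dis by (intro app expr_eq.sym[OF E'E]) auto
  also have "E' @ E \<approx> E @ E'" using assms ein dis by (intro comm) auto
  finally show ?thesis .
qed

abbreviation "S \<equiv> Free \<Lambda> \<A>"
abbreviation "homK \<equiv> thom \<Lambda> S"
abbreviation "domK \<equiv> tdom \<Lambda> S"
abbreviation "codK \<equiv> tcod \<Lambda> S"
abbreviation "compK \<equiv> tcomp \<Lambda> S"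
abbreviation "tensK \<equiv> ttens \<Lambda> S"
abbreviation "symmK \<equiv> tsymm \<Lambda> S"
abbreviation "trK \<equiv> ttrace \<Lambda> S"

lemma self_mem_class: "ein E \<Longrightarrow> E \<in> cl E"
  by (simp add: expr_class_def expr_eq.refl)

text \<open>
  This lemma and the next ones compute the operations of the tensor system on any suitable representative;
  the unions over all representatives collapse to one class.
\<close>

lemma product_class:
  assumes "ein E" "ein E'" "lbl E \<inter> lbl E' = {}"
  shows "product S (cl E) (cl E') = cl (E @ E')"
proof -
  have *: "cl (E1 @ E1') = cl (E @ E')" 
    if "E1 \<in> cl E" "E1' \<in> cl E'" "lbl E1 \<inter> lbl E1' = {}" for E1 E1'
    using that assms by (intro class_eqI expr_eq_product mem_class)
  have "x \<in> product S (cl E) (cl E') \<longleftrightarrow> (\<exists>E1 E1'. E1 \<in> cl E \<and> E1' \<in> cl E' \<and>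
      lbl E1 \<inter> lbl E1' = {} \<and> x \<in> cl (E1 @ E1'))" for x
    unfolding Free_def tensor_system.simps by blast
  then show ?thesis
    using * self_mem_class[OF assms(1)] self_mem_class[OF assms(2)] assms(3) by (intro set_eqI) metis
qed

text \<open>
  Contracting \<open>b\<close> with \<open>a\<close> amounts to appending the delta with lower label \<open>b\<close> and upper label \<open>a\<close>, so
  congruence in the context of this delta applies.
\<close>

lemma contract_class:
  assumes "ein E" "a \<in> free_lower E" "b \<in> free_upper E" "ty a = ty b"
  shows "contract S a b (cl E) = cl (repl_upper b a E)"
proof -
  have *: "repl_upper b a E1 \<approx> E1 @ [Delta b a]" "ein (E1 @ [Delta b a])" 
      "bound E1 \<inter> lbl [Delta b a] = {}"
    if "E1 \<approx> E" for E1
  proof -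
    have "ein E1" "a \<in> free_lower E1" "b \<in> free_upper E1" 
      using that assms expr_eq_einstein[OF that] expr_eq_free[OF that] by auto
    then show "ein (E1 @ [Delta b a])" "bound E1 \<inter> lbl [Delta b a] = {}"
      using einstein_labels[of E1] \<open>ty a = ty b\<close> 
      by (auto simp: einstein_append einstein_delta free_lower_alt free_upper_alt expr_labels_def bound_def)
    then show "repl_upper b a E1 \<approx> E1 @ [Delta b a]"
      using \<open>b \<in> free_upper E1\<close> by (intro expr_eq.sym[OF expr_eq.delta_upper]) (auto simp: free_upper_alt)
  qed
  have "cl (repl_upper b a E1) = cl (repl_upper b a E)" if "E1 \<in> cl E" for E1
  proof (rule class_eqI)
    have eq: "E1 \<approx> E" using that by (intro mem_class)
    have EE: "E \<approx> E" using assms by (auto intro: expr_eq.refl)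
    have "E1 @ [Delta b a] \<approx> E @ [Delta b a]"
      using *(2,3)[OF eq] *(2,3)[OF EE] eq by (intro expr_eq_append)
    with *(1)[OF eq] *(1)[OF EE] show "repl_upper b a E1 \<approx> repl_upper b a E"
      using expr_eq.sym expr_eq.trans by blast
  qed
  then have "\<Union> ((\<lambda>E1. cl (repl_upper b a E1)) ` cl E) = cl (repl_upper b a E)"
    by (intro Union_const[OF self_mem_class] assms)
  then show ?thesis by (simp add: Free_def)
qed

lemma expr_eq_ren:
  assumes "E \<approx> E'" "inj_on r (lbl E)" "type_pres r (lbl E)"
   "inj_on r' (lbl E')" "type_pres r' (lbl E')" "\<And>a. a \<in> free E \<Longrightarrow> r a = r' a"
  shows "ren r E \<approx> ren r' E'"
  using expr_eq_context[OF assms(1), of r "[]" r'] assms expr_eq_einstein[OF assms(1)]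
  by (auto simp: fits_def intro!: einstein_ren)

lemma relabel_class:
  assumes "ein E" "inj_on r (lbl E)" "type_pres r (lbl E)" 
    "\<And>a. a \<in> free E \<Longrightarrow> f a = r a"
  shows "relabel S f (cl E) = cl (ren r E)"
proof -
  let ?g = "\<lambda>E a. if a \<in> bound E then a else f a"
  have "cl (map (elem_map (?g E1) (?g E1)) E1) = cl (ren r E)" 
     if "E1 \<in> cl E" "bound E1 \<inter> f ` free E1 = {}" for E1
    unfolding emap_def[symmetric]
  proof (intro class_eqI expr_eq_ren assms)
    show eq: "E1 \<approx> E" using that by (intro mem_class)
    have E1: "ein E1" "free E1 = free E" 
      using expr_eq_einstein[OF eq] expr_eq_free[OF eq] by (auto simp: free_alt)
    have "inj_on f (free E1)" "type_pres f (free E1)"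
      using assms E1 by (auto simp: inj_on_def type_pres_def labels_free_bound)
    then show "inj_on (?g E1) (lbl E1)" "type_pres (?g E1) (lbl E1)"
      using that(2) einstein_labels[OF E1(1)] free_bound_disjoint[of E1]
      by (auto simp: inj_on_def type_pres_def labels_free_bound)
    show "(if a \<in> bound E1 then a else f a) = r a" if "a \<in> free E1" for a
      using that free_bound_disjoint[of E1] assms E1 by auto
  qed
  moreover 
  have "fits id E []" using assms(1) einstein_labels by (auto simp: fits_def ren_id type_pres_def)
  from ex_fits[OF this HOL.refl HOL.refl, of "f ` free E"] assms(1)
  obtain s where s: "fits s E []" "\<forall>a\<in>free E. s a = id a" "s ` bound E \<inter> f ` free E = {}" by auto
  then have E1: "E \<approx> ren s E" by (intro rename_bound assms(1)) (auto simp: fits_def)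
  then have "bound (ren s E) \<inter> f ` free (ren s E) = {}" 
    using s expr_eq_free[OF E1] by (simp add: bound_ren fits_def free_alt)
  then have "ren s E \<in> {E1 \<in> cl E. bound E1 \<inter> f ` free E1 = {}}" using E1 by (simp add: expr_class_def)
  ultimately have "\<Union> ((\<lambda>E1. cl (map (elem_map (?g E1) (?g E1)) E1)) ` {E1 \<in> cl E. bound E1 \<inter> f ` free E1 = {}}) 
     = cl (ren r E)"
    by (intro Union_const) auto
  then show ?thesis by (simp add: Free_def Let_def)
qed

end

section \<open>Arrows as expressions with ordered ends\<close>

lemma map_lmap: "length as = length bs \<Longrightarrow> distinct as \<Longrightarrow> map (lmap as bs) as = bs"
  by (auto simp: lmap_def list_eq_iff_nth_eq map_of_zip_nth)

lemma lmap_other: "a \<notin> set as \<Longrightarrow> lmap as bs a = a"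
  by (auto simp: lmap_def dest!: map_of_SomeD set_zip_leftD split: option.split)

abbreviation dels :: "'l list \<Rightarrow> 'l list \<Rightarrow> ('s, 'l) expr" where
  "dels as bs \<equiv> map2 Delta as bs"

lemma lower_dels [simp]: "length as = length bs \<Longrightarrow> lower (dels as bs) = as"
  and upper_dels [simp]: "length as = length bs \<Longrightarrow> upper (dels as bs) = bs"
  by (induction as bs rule: list_induct2) auto

lemma emap_dels: "emap f g (dels as bs) = dels (map f as) (map g bs)"
  by (simp add: emap_def map_zip_map map_zip_map2 zip_map1 zip_map2 case_prod_unfold o_def comp_def split_def)

context free_tensor_system begin

lemma length_canons [simp]: "length (can \<epsilon> s X) = length X"
  by (simp add: canons_def del: upt_Suc)

lemma nth_canons [simp]: "i < length X \<Longrightarrow> can \<epsilon> s X ! i = canon \<Lambda> (X ! i) (s + 1 + i) \<epsilon>"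
  by (simp add: canons_def del: upt_Suc)

lemma canons_append: "can \<epsilon> s (X @ Y) = can \<epsilon> s X @ can \<epsilon> (s + length X) Y"
  by (rule nth_equalityI) (auto simp: nth_append)

lemma canon_eq_iff:
  assumes "X \<in> types \<Lambda>" "Y \<in> types \<Lambda>"
  shows "canon \<Lambda> X i \<epsilon> = canon \<Lambda> Y j \<delta> \<longleftrightarrow> X = Y \<and> i = j \<and> \<epsilon> = \<delta>"
proof
  have inj: "inj_on (\<lambda>(X, i, \<epsilon>). canon \<Lambda> X i \<epsilon>) (types \<Lambda> \<times> UNIV \<times> UNIV)"
    using labelling by (simp add: labelling_def)
  assume "canon \<Lambda> X i \<epsilon> = canon \<Lambda> Y j \<delta>"
  then show "X = Y \<and> i = j \<and> \<epsilon> = \<delta>"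
    using inj_onD[OF inj, of "(X, i, \<epsilon>)" "(Y, j, \<delta>)"] assms by auto
qed auto

lemma set_canons: "set (can \<epsilon> s X) = {canon \<Lambda> (X ! i) (s + 1 + i) \<epsilon> | i. i < length X}"
  unfolding set_conv_nth by (rule Collect_cong, rule ex_cong1) auto

lemma canons_props:
  assumes "X \<in> tylists"
  shows "distinct (can \<epsilon> s X)" "set (can \<epsilon> s X) \<subseteq> labels \<Lambda>"
    "map ty (can \<epsilon> s X) = X"
proof -
  have X: "X ! i \<in> types \<Lambda>" if "i < length X" for i using assms that by (auto simp: in_lists_conv_set)
  then show "distinct (can \<epsilon> s X)" by (auto simp: distinct_conv_nth canon_eq_iff)
  have *: "canon \<Lambda> (X ! i) j \<epsilon> \<in> labels \<Lambda> \<and> ty (canon \<Lambda> (X ! i) j \<epsilon>) = X ! i" if "i < length X" for i j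
    using X[OF that] labelling by (auto simp: labelling_def)
  then show "set (can \<epsilon> s X) \<subseteq> labels \<Lambda>" by (auto simp: set_canons)
  show "map ty (can \<epsilon> s X) = X" using * by (intro nth_equalityI) auto
qed

lemma canons_disjoint:
  assumes "X \<in> tylists" "Y \<in> tylists" "\<epsilon> \<noteq> \<delta> \<or> s + length X \<le> t"
  shows "set (can \<epsilon> s X) \<inter> set (can \<delta> t Y) = {}"
proof -
  have "X ! i \<in> types \<Lambda>" if "i < length X" for i using assms that by (auto simp: in_lists_conv_set)
  moreover have "Y ! i \<in> types \<Lambda>" if "i < length Y" for i using assms that by (auto simp: in_lists_conv_set)
  ultimately show ?thesis using assms(3) by (auto simp: set_canons canon_eq_iff)
qed

lemma canons_inject:
  assumes "X \<in> tylists" "Y \<in> tylists" "set (can \<epsilon> 0 X) = set (can \<epsilon> 0 Y)"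
  shows "X = Y"
proof (rule nth_equalityI)
  show len: "length X = length Y"
    using assms distinct_card[OF canons_props(1)[OF assms(1)]] distinct_card[OF canons_props(1)[OF assms(2)]]
    by (metis length_canons)
  fix i assume i: "i < length X"
  have X: "X ! i \<in> types \<Lambda>" if "i < length X" for i using assms that by (auto simp: in_lists_conv_set)
  have Y: "Y ! i \<in> types \<Lambda>" if "i < length Y" for i using assms that by (auto simp: in_lists_conv_set)
  have "canon \<Lambda> (X ! i) (0 + 1 + i) \<epsilon> \<in> set (can \<epsilon> 0 Y)"
    using i assms(3) by (auto simp: set_canons)
  then show "X ! i = Y ! i" using X[OF i] Y by (auto simp: set_canons canon_eq_iff)
qed

definition label_list :: "'l list \<Rightarrow> bool" where
  "label_list as \<longleftrightarrow> distinct as \<and> set as \<subseteq> labels \<Lambda>"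

lemma label_list_canons: "X \<in> tylists \<Longrightarrow> label_list (can \<epsilon> s X)"
  by (simp add: label_list_def canons_props)

lemma label_list_types: "label_list as \<Longrightarrow> map ty as \<in> tylists"
  using labelling by (auto simp: label_list_def labelling_def in_lists_conv_set)

lemma label_list_append: "label_list (as @ bs) \<longleftrightarrow> label_list as \<and> label_list bs \<and> set as \<inter> set bs = {}"
  by (auto simp: label_list_def)

lemma ex_label_list:
  assumes "X \<in> tylists" "finite N"
  shows "\<exists>as. label_list as \<and> set as \<inter> N = {} \<and> map ty as = X"
proof -
  let ?c = "can False 0 X"
  obtain s where "inj_on s (set ?c)" "type_pres s (set ?c)" "s ` set ?c \<inter> N = {}"
    using ex_fresh_renaming[of "set ?c" N] canons_props[OF assms(1)] assms(2) by auto
  moreover from this have "map ty (map s ?c) = map ty ?c" by (auto simp: type_pres_def)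
  ultimately show ?thesis
    using canons_props[OF assms(1), of False 0]
    by (intro exI[of _ "map s ?c"]) (auto simp: label_list_def distinct_map type_pres_def)
qed

lemma fresh_props:
  assumes "X \<in> tylists" "finite N"
  shows "label_list (fresh \<Lambda> N X)" "set (fresh \<Lambda> N X) \<inter> N = {}" "map ty (fresh \<Lambda> N X) = X"
proof -
  have "\<exists>as. distinct as \<and> set as \<subseteq> labels \<Lambda> - N \<and> map ty as = X"
    using ex_label_list[OF assms] by (auto simp: label_list_def)
  from someI_ex[OF this] show "label_list (fresh \<Lambda> N X)" "set (fresh \<Lambda> N X) \<inter> N = {}" "map ty (fresh \<Lambda> N X) = X"
    by (auto simp: label_list_def fresh_def)
qed

lemma ex_list_renaming:
  assumes "label_list L" "label_list L'" "map ty L = map ty L'" "finite B" "B \<subseteq> labels \<Lambda>" "finite N"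
  shows "\<exists>r. inj_on r (set L \<union> B) \<and> type_pres r (set L \<union> B) \<and> map r L = L' \<and> r ` (B - set L) \<inter> N = {}"
proof -
  let ?f = "lmap L L'"
  have len: "length L = length L'" using assms(3) map_eq_imp_length_eq by blast
  have f: "map ?f L = L'" using assms len by (intro map_lmap) (auto simp: label_list_def)
  have "inj_on ?f (set L)" using assms(1,2) f by (metis distinct_map label_list_def)
  moreover have "type_pres ?f (set L)"
  proof -
    have "set L' \<subseteq> labels \<Lambda>" using assms by (simp add: label_list_def)
    moreover have "?f ` set L = set L'" using f by (metis set_map)
    moreover have "map (ty \<circ> ?f) L = map ty L" using f assms(3) by (metis map_map)
    ultimately show ?thesis by (auto simp: type_pres_def)
  qed
  ultimately obtain r where r: "inj_on r (set L \<union> B)" "type_pres r (set L \<union> B)" 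
    "\<forall>a\<in>set L. r a = ?f a" "r ` (B - set L) \<inter> N = {}"
    using ex_extended_renaming[of B N "set L" ?f] assms by auto
  moreover have "map r L = L'" using f r(3) by (metis map_cong)
  ultimately show ?thesis by blast
qed

text \<open>
  An arrow of the category carries canonical labels, which order its inputs and outputs.  With the order given
  by explicit lists, an arrow can be represented by an expression with arbitrary labels.
\<close>

definition frame :: "('s, 'l) expr \<Rightarrow> 'l list \<Rightarrow> 'l list \<Rightarrow> bool" where
  "frame E as bs \<longleftrightarrow> ein E \<and> distinct as \<and> distinct bs \<and> set as = free_lower E \<and> set bs = free_upper E"

lemma frameD:
  assumes "frame E as bs"
  shows "ein E" "set as \<inter> set bs = {}" "set as \<inter> bound E = {}" "set bs \<inter> bound E = {}"
    "lbl E = set as \<union> set bs \<union> bound E" "label_list as" "label_list bs" "free E = set as \<union> set bs"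
  using assms einstein_labels[of E]
  by (auto simp: frame_def free_lower_def free_upper_def bound_def expr_labels_def label_list_def free_def)

lemma frame_equiv: "frame E as bs \<Longrightarrow> E \<approx> E' \<Longrightarrow> frame E' as bs"
  using expr_eq_einstein expr_eq_free by (auto simp: frame_def)

lemma frame_ren:
  assumes "frame E as bs" "inj_on s (lbl E)" "type_pres s (lbl E)"
  shows "frame (ren s E) (map s as) (map s bs)"
proof -
  have "inj_on s (set as)" "inj_on s (set bs)"
    using frameD(5)[OF assms(1)] assms(2) by (auto intro: inj_on_subset)
  then show ?thesis
    using assms by (auto simp: frame_def einstein_ren distinct_map free_lower_ren free_upper_ren)
qed

lemma map_ty_pres: "type_pres s A \<Longrightarrow> set as \<subseteq> A \<Longrightarrow> map ty (map s as) = map ty as"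
  by (auto simp: type_pres_def)

text \<open>
  A renaming of this kind turns a framed expression into a representative of the arrow that it names.
\<close>

definition canonizes :: "('l \<Rightarrow> 'l) \<Rightarrow> ('s, 'l) expr \<Rightarrow> 'l list \<Rightarrow> 'l list \<Rightarrow> bool" where
  "canonizes r E as bs \<longleftrightarrow> inj_on r (lbl E) \<and> type_pres r (lbl E) \<and>
     map r as = can False 0 (map ty as) \<and> map r bs = can True 0 (map ty bs)"

lemma ex_frame_renaming:
  assumes "frame E as bs" "label_list (as' @ bs')" "map ty as = map ty as'" "map ty bs = map ty bs'" "finite N"
  shows "\<exists>r. inj_on r (lbl E) \<and> type_pres r (lbl E) \<and> map r as = as' \<and> map r bs = bs' \<and>
    r ` bound E \<inter> N = {}"
proof -
  note f = frameD[OF assms(1)]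
  have "label_list (as @ bs)" "bound E \<subseteq> labels \<Lambda>" using f einstein_labels[OF f(1)] by (auto simp: label_list_append)
  then obtain r where r: "inj_on r (set (as @ bs) \<union> bound E)" "type_pres r (set (as @ bs) \<union> bound E)"
     "map r (as @ bs) = as' @ bs'" "r ` (bound E - set (as @ bs)) \<inter> N = {}"
    using ex_list_renaming[of "as @ bs" "as' @ bs'" "bound E" N] assms by auto
  have "length as = length as'" using assms(3) map_eq_imp_length_eq by blast
  then have "map r as = as'" "map r bs = bs'" using r(3) by auto
  moreover have "bound E - set (as @ bs) = bound E" using f by auto
  ultimately show ?thesis using r f(5) by (auto intro!: exI[of _ r])
qed

lemma ex_canonizes:
  assumes "frame E as bs"
  shows "\<exists>r. canonizes r E as bs"
proof -
  note f = frameD[OF assms]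
  have t: "map ty as \<in> tylists" "map ty bs \<in> tylists" using f label_list_types by auto
  then have "label_list (can False 0 (map ty as) @ can True 0 (map ty bs))"
    by (auto simp: label_list_append label_list_canons canons_disjoint)
  from ex_frame_renaming[OF assms this, of "{}"] show ?thesis
    using canons_props(3)[OF t(1)] canons_props(3)[OF t(2)] by (auto simp: canonizes_def)
qed

definition cls :: "('s, 'l) expr \<Rightarrow> 'l list \<Rightarrow> 'l list \<Rightarrow> ('s, 'l) expr set" where
  "cls E as bs = cl (ren (SOME r. canonizes r E as bs) E)"

lemma cls_eq:
  assumes "frame E as bs" "canonizes r E as bs"
  shows "cls E as bs = cl (ren r E)"
proof -
  define s where "s = (SOME r. canonizes r E as bs)"
  have s: "canonizes s E as bs" unfolding s_def by (rule someI_ex[OF ex_canonizes[OF assms(1)]])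
  have "ren s E \<approx> ren r E"
  proof (rule expr_eq_ren)
    show "E \<approx> E" using frameD[OF assms(1)] by (simp add: expr_eq.refl)
    fix a assume "a \<in> free E"
    then have "a \<in> set as \<or> a \<in> set bs" using frameD(8)[OF assms(1)] by blast
    moreover have "map s as = map r as" "map s bs = map r bs" using s assms(2) by (auto simp: canonizes_def)
    ultimately show "s a = r a" by auto
  qed (use s assms(2) in \<open>auto simp: canonizes_def\<close>)
  then show ?thesis unfolding cls_def s_def[symmetric] by (rule class_eqI)
qed

lemma cls_equiv:
  assumes "frame E as bs" "E \<approx> E'"
  shows "cls E as bs = cls E' as bs"
proof -
  note f = frame_equiv[OF assms]
  obtain r where r: "canonizes r E as bs" using ex_canonizes[OF assms(1)] by blast
  obtain s where s: "canonizes s E' as bs" using ex_canonizes[OF f] by blast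
  have "ren r E \<approx> ren s E'"
  proof (rule expr_eq_ren[OF assms(2)])
    fix a assume "a \<in> free E"
    then have "a \<in> set as \<or> a \<in> set bs" using frameD(8)[OF assms(1)] by blast
    moreover have "map s as = map r as" "map s bs = map r bs" using s r by (auto simp: canonizes_def)
    ultimately show "r a = s a" by auto
  qed (use s r in \<open>auto simp: canonizes_def\<close>)
  then show ?thesis by (simp add: cls_eq[OF assms(1) r] cls_eq[OF f s] class_eqI)
qed

lemma cls_ren:
  assumes "frame E as bs" "inj_on s (lbl E)" "type_pres s (lbl E)"
  shows "cls (ren s E) (map s as) (map s bs) = cls E as bs"
proof -
  note f = frame_ren[OF assms]
  obtain r where r: "canonizes r (ren s E) (map s as) (map s bs)" using ex_canonizes[OF f] by blast
  have "map ty (map s as) = map ty as" "map ty (map s bs) = map ty bs"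
    using frameD(5)[OF assms(1)] assms(3) by (intro map_ty_pres[OF assms(3)]; auto)+
  note r' = r[unfolded canonizes_def, unfolded this]
  have "canonizes (r \<circ> s) E as bs"
    using r' assms by (auto simp: canonizes_def expr_labels_ren type_pres_def comp_inj_on)
  then show ?thesis by (simp add: cls_eq[OF f r] cls_eq[OF assms(1)])
qed

lemma cls_permute: "frame E as bs \<Longrightarrow> mset E = mset E' \<Longrightarrow> cls E as bs = cls E' as bs"
  by (rule cls_equiv) (auto intro: expr_eq.permute frameD(1))

lemma thom_class:
  "t \<in> homK X Y \<longleftrightarrow> (\<exists>E. t = cl E \<and> ein E \<and> free_lower E = set (can False 0 X) \<and>
     free_upper E = set (can True 0 Y))"
  by (auto simp: thom_def Free_def)

lemma thom_unique:
  assumes "X \<in> tylists" "Y \<in> tylists" "X' \<in> tylists" "Y' \<in> tylists"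
    "t \<in> homK X Y" "t \<in> homK X' Y'"
  shows "X = X' \<and> Y = Y'"
proof -
  obtain E where E: "t = cl E" "ein E" "free_lower E = set (can False 0 X)"
     "free_upper E = set (can True 0 Y)" using assms(5) by (auto simp: thom_class)
  obtain E' where E': "t = cl E'" "ein E'" "free_lower E' = set (can False 0 X')"
     "free_upper E' = set (can True 0 Y')" using assms(6) by (auto simp: thom_class)
  have "E \<approx> E'" using self_mem_class[OF E(2)] E(1) E'(1) by (intro mem_class) auto
  from expr_eq_free[OF this] E E' canons_inject assms show ?thesis by metis
qed

lemma tdom_eq:
  assumes "X \<in> tylists" "Y \<in> tylists" "t \<in> homK X Y"
  shows "domK t = X" "codK t = Y"
  unfolding tdom_def tcod_def using thom_unique assms by (intro the_equality; blast)+

lemma cls_thom: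
  assumes "frame E as bs"
  shows "cls E as bs \<in> homK (map ty as) (map ty bs)"
proof -
  obtain r where r: "canonizes r E as bs" using ex_canonizes[OF assms] by blast
  then have "frame (ren r E) (map r as) (map r bs)" using assms by (intro frame_ren) (auto simp: canonizes_def)
  then show ?thesis
    unfolding thom_class cls_eq[OF assms r] using r by (auto simp: frame_def canonizes_def simp del: set_map)
qed

lemma tdom_cls [simp]: "frame E as bs \<Longrightarrow> domK (cls E as bs) = map ty as"
  by (rule tdom_eq(1)[OF label_list_types label_list_types cls_thom]) (auto dest: frameD)

lemma tcod_cls [simp]: "frame E as bs \<Longrightarrow> codK (cls E as bs) = map ty bs"
  by (rule tdom_eq(2)[OF label_list_types label_list_types cls_thom]) (auto dest: frameD)

text \<open>
  The ends of an arrow can be given any labels, and its bound labels can be kept away from any finite set.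
  All proofs about several arrows start by choosing representatives in this way.
\<close>

lemma thom_cls:
  assumes "t \<in> homK X Y" "X \<in> tylists" "Y \<in> tylists"
    and "label_list (as @ bs)" "map ty as = X" "map ty bs = Y" "finite N"
  shows "\<exists>E. frame E as bs \<and> bound E \<inter> N = {} \<and> t = cls E as bs"
proof -
  let ?x = "can False 0 X" and ?y = "can True 0 Y"
  obtain E where E: "t = cl E" "ein E" "free_lower E = set ?x" "free_upper E = set ?y"
    using assms(1) by (auto simp: thom_class)
  note p = canons_props[OF assms(2)] canons_props[OF assms(3)]
  have f: "frame E ?x ?y" using E p by (simp add: frame_def)
  have "canonizes id E ?x ?y"
    using einstein_labels[OF E(2)] p by (auto simp: canonizes_def type_pres_def)
  then have t: "t = cls E ?x ?y" using cls_eq[OF f] E(1) by (simp add: emap_id)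
  have "map ty ?x = map ty as" "map ty ?y = map ty bs" using assms p by simp_all
  then obtain r where r: "inj_on r (lbl E)" "type_pres r (lbl E)" "map r ?x = as" "map r ?y = bs"
     "r ` bound E \<inter> N = {}" using ex_frame_renaming[OF f assms(4) _ _ assms(7)] by blast
  show ?thesis
    using frame_ren[OF f r(1,2)] cls_ren[OF f r(1,2)] r t by (intro exI[of _ "ren r E"]) (auto simp: bound_ren)
qed

lemma at_labels_cls:
  assumes f: "frame E as bs" and r: "inj_on r (lbl E)" "type_pres r (lbl E)"
  shows "at_labels \<Lambda> S (map ty as) (map ty bs) (cls E as bs) (map r as) (map r bs) = cl (ren r E)"
proof -
  let ?L = "lbl E"
  obtain s where s: "canonizes s E as bs" using ex_canonizes[OF f] by blast
  then have inj: "inj_on s ?L" "type_pres s ?L" by (auto simp: canonizes_def)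
  define q where "q = inv_into ?L s"
  have q: "q (s a) = a" if "a \<in> ?L" for a using inj that by (simp add: q_def)
  let ?f = "lmap (map s as @ map s bs) (map r as @ map r bs)"
  have "relabel S ?f (cl (ren s E)) = cl (ren (r \<circ> q) (ren s E))"
  proof (rule relabel_class)
    show "ein (ren s E)" by (intro einstein_ren inj frameD[OF f])
    show "inj_on (r \<circ> q) (lbl (ren s E))"
      using r(1) q by (auto simp: expr_labels_ren inj_on_def)
    show "type_pres (r \<circ> q) (lbl (ren s E))"
      using r(2) q inj by (auto simp: expr_labels_ren type_pres_def)
    fix a assume "a \<in> free (ren s E)"
    then obtain c where c: "c \<in> set (as @ bs)" "a = s c"
      using frameD(8)[OF frame_ren[OF f inj]] by auto
    have d: "distinct (map s (as @ bs))"
    proof -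
      have "set (as @ bs) \<subseteq> ?L" using frameD(5)[OF f] by auto
      then have "inj_on s (set (as @ bs))" by (rule inj_on_subset[OF inj(1)])
      moreover have "distinct (as @ bs)" using frameD(2,6,7)[OF f] by (auto simp: label_list_def)
      ultimately show ?thesis by (simp only: distinct_map)
    qed
    have "map ?f (map s (as @ bs)) = map r (as @ bs)"
      using map_lmap[of "map s (as @ bs)" "map r (as @ bs)"] d by simp
    then have "?f (s c) = r c" using c(1) by (metis (mono_tags, lifting) comp_apply map_eq_conv map_map)
    then show "?f a = (r \<circ> q) a" using c q frameD(5)[OF f] by auto
  qed
  moreover have "ren (r \<circ> q) (ren s E) = ren r E"
    unfolding emap_emap using q by (intro emap_cong) (auto simp: expr_labels_def)
  ultimately show ?thesis
    using s by (simp add: at_labels_def cls_eq[OF f s] canonizes_def)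
qed

text \<open>
  The contractions are done one after the other.  After the first one \<open>q\<close> is also an upper label of the
  remaining expression, so the function that describes the rest has to fix it.
\<close>

lemma contracts_class:
  assumes "length qs = length ps" "ein E" "distinct ps" "distinct qs" "set qs \<subseteq> free_lower E" "set ps \<subseteq> free_upper E"
    "map ty qs = map ty ps" "map g ps = qs" "\<And>a. a \<in> set (upper E) - set ps \<Longrightarrow> g a = a"
  shows "contracts S qs ps (cl E) = cl (emap id g E)"
  using assms
proof (induction qs ps arbitrary: E g rule: list_induct2)
  case Nil
  then show ?case by (simp add: contracts_def emap_idI)
next
  case (Cons q qs p ps)
  let ?E = "repl_upper p q E"
  let ?g = "g(q := q)"
  have qp: "q \<notin> set (upper E)" "p \<in> set (upper E)" "p \<notin> set (lower E)" "q \<in> set (lower E)" "ty q = ty p"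
    using Cons.prems by (auto simp: free_lower_alt free_upper_alt)
  have lab: "q \<in> labels \<Lambda>" using Cons.prems einstein_labels[of E] qp by (auto simp: expr_labels_def)
  have low: "lower ?E = lower E" by (simp add: repl_upper_emap)
  have up: "set (upper ?E) = insert q (set (upper E) - {p})" using qp by (auto simp: repl_upper_emap)
  have "contracts S (q # qs) (p # ps) (cl E) = contracts S qs ps (contract S q p (cl E))"
    by (simp add: contracts_def)
  also have "contract S q p (cl E) = cl ?E"
    using Cons.prems by (intro contract_class) auto
  also have "contracts S qs ps (cl ?E) = cl (emap id ?g ?E)"
  proof (rule Cons.IH)
    show "ein ?E" unfolding repl_upper_emap
      using Cons.prems lab qp einstein_labels[of E]
      by (intro einstein_emap) (auto simp: type_pres_def expr_labels_def inj_on_def)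
    show "set qs \<subseteq> free_lower ?E" "set ps \<subseteq> free_upper ?E"
      using Cons.prems qp by (auto simp: free_lower_alt free_upper_alt low up)
    show "map ?g ps = qs" using Cons.prems qp by (auto simp: free_upper_alt)
    show "?g a = a" if "a \<in> set (upper ?E) - set ps" for a using that Cons.prems up by auto
  qed (use Cons.prems in auto)
  also have "emap id ?g ?E = emap id g E"
    unfolding repl_upper_emap emap_emap using qp Cons.prems by (intro emap_cong) auto
  finally show ?case .
qed

abbreviation "K \<equiv> Cat \<Lambda> S"
abbreviation "idK \<equiv> Ide K"

lemma K_simps [simp]:
  "Obj K = tylists" "Dom K = domK" "Cod K = codK" "OTens K = (@)" "Unit K = []"
  "Comp K = compK" "ATens K = tensK" "Symm K = symmK" "Tr K = trK"
  by (auto simp: Cat_def)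

lemma Hom_K: "f \<in> Hom K X Y \<longleftrightarrow> X \<in> tylists \<and> Y \<in> tylists \<and> f \<in> homK X Y"
proof
  assume f: "f \<in> Hom K X Y"
  then obtain X' Y' where XY: "X' \<in> tylists" "Y' \<in> tylists" "f \<in> homK X' Y'"
    unfolding Hom_def Cat_def moncat.simps by blast
  with tdom_eq[OF XY] f show "X \<in> tylists \<and> Y \<in> tylists \<and> f \<in> homK X Y"
    by (simp add: Hom_def)
next
  assume XY: "X \<in> tylists \<and> Y \<in> tylists \<and> f \<in> homK X Y"
  then have "f \<in> Arr K" unfolding Cat_def moncat.simps by blast
  with tdom_eq[of X Y f] XY show "f \<in> Hom K X Y" by (simp add: Hom_def)
qed

lemma Arr_K: "f \<in> Arr K \<longleftrightarrow> f \<in> Hom K (domK f) (codK f)"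
  by (simp add: Hom_def)

lemma cls_Hom: "frame E as bs \<Longrightarrow> cls E as bs \<in> Hom K (map ty as) (map ty bs)"
  unfolding Hom_K by (intro conjI cls_thom label_list_types[OF frameD(6)] label_list_types[OF frameD(7)])

lemma Hom_cls:
  assumes "f \<in> Hom K X Y" "label_list (as @ bs)" "map ty as = X" "map ty bs = Y" "finite N"
  shows "\<exists>E. frame E as bs \<and> bound E \<inter> N = {} \<and> f = cls E as bs"
  using thom_cls assms unfolding Hom_K by blast

lemma renamed_disjoint:
  assumes "frame E as bs" "frame E' as' bs'" "map r as = x" "map r bs = y" "map r' as' = u" "map r' bs' = v"
    and "set x \<inter> set u = {}" "set x \<inter> set v = {}" "set y \<inter> set u = {}" "set y \<inter> set v = {}"
    and "r ` bound E \<inter> set u = {}" "r ` bound E \<inter> set v = {}" "r' ` bound E' \<inter> r ` lbl E = {}"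
  shows "lbl (ren r E) \<inter> lbl (ren r' E') = {}"
proof -
  have "r ` set as = set x" "r ` set bs = set y" "r' ` set as' = set u" "r' ` set bs' = set v"
    using assms(3-6) by (metis set_map)+
  then have L: "r ` lbl E = set x \<union> set y \<union> r ` bound E"
    "r' ` lbl E' = set u \<union> set v \<union> r' ` bound E'"
    by (simp_all add: frameD(5)[OF assms(1)] frameD(5)[OF assms(2)] image_Un)
  have "r ` lbl E \<inter> r' ` bound E' = {}" using assms(13) by blast
  moreover have "(set x \<union> set y \<union> r ` bound E) \<inter> (set u \<union> set v) = {}" using assms(7-12) by blast
  ultimately have "r ` lbl E \<inter> ((set u \<union> set v) \<union> r' ` bound E') = {}"
    unfolding L(1) Int_Un_distrib by blast
  then show ?thesis by (simp add: expr_labels_ren L(2))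
qed

lemma frame_comp:
  assumes "frame E as bs" "frame E' bs cs" "lbl E \<inter> lbl E' = set bs"
  shows "frame (E @ E') as cs"
  using assms unfolding frame_def
  by (auto simp: einstein_append free_lower_alt free_upper_alt expr_labels_def)

text \<open>
  The definition of composition gives the shared labels two fresh names, \<open>p\<close> as outputs of the first and \<open>q\<close> as inputs
  of the second arrow, and then identifies these by contraction.  The result is a renamed copy of \<open>E @ E'\<close>.
\<close>

lemma comp_cls:
  assumes f: "frame E as bs" and f': "frame E' bs cs" and int: "lbl E \<inter> lbl E' = set bs"
  shows "compK (cls E' bs cs) (cls E as bs) = cls (E @ E') as cs"
proof -
  let ?X = "map ty as" and ?Y = "map ty bs" and ?Z = "map ty cs"
  let ?x = "can False 0 ?X" and ?z = "can True 0 ?Z"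
  define w where "w = fresh \<Lambda> (set ?x \<union> set ?z) (?Y @ ?Y)"
  define p where "p = take (length ?Y) w"
  define q where "q = drop (length ?Y) w"
  note F = frameD[OF f] frameD[OF f']
  have t: "?X \<in> tylists" "?Y \<in> tylists" "?Z \<in> tylists"
    using F label_list_types by auto
  have w: "label_list w" "set w \<inter> (set ?x \<union> set ?z) = {}" "map ty w = ?Y @ ?Y"
    using fresh_props[of "?Y @ ?Y" "set ?x \<union> set ?z"] t unfolding w_def by auto
  have pq: "w = p @ q" "map ty p = ?Y" "map ty q = ?Y" using w(3)
    by (auto simp: p_def q_def take_map[symmetric] drop_map[symmetric])
  have lpq: "label_list p" "label_list q" "set p \<inter> set q = {}" "set p \<inter> set ?x = {}" "set p \<inter> set ?z = {}"
      "set q \<inter> set ?x = {}" "set q \<inter> set ?z = {}"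
    using w(1,2) unfolding pq(1) label_list_append by auto
  note cp = canons_props[OF t(1)] canons_props[OF t(3)]
  have xz: "set ?x \<inter> set ?z = {}" using t by (intro canons_disjoint) auto
  have "label_list (?x @ p)" using lpq t by (auto simp: label_list_append label_list_canons)
  then obtain r where r: "inj_on r (lbl E)" "type_pres r (lbl E)" "map r as = ?x" "map r bs = p"
      "r ` bound E \<inter> (set ?x \<union> set ?z \<union> set p \<union> set q) = {}"
    using ex_frame_renaming[OF f, of ?x p "set ?x \<union> set ?z \<union> set p \<union> set q"] cp pq by auto
  have "label_list (q @ ?z)" using lpq t by (auto simp: label_list_append label_list_canons)
  then obtain r' where r': "inj_on r' (lbl E')" "type_pres r' (lbl E')" "map r' bs = q" "map r' cs = ?z"
      "r' ` bound E' \<inter> (set ?x \<union> set ?z \<union> set p \<union> set q \<union> r ` lbl E) = {}"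
    using ex_frame_renaming[OF f', of q ?z "set ?x \<union> set ?z \<union> set p \<union> set q \<union> r ` lbl E"] cp pq by auto
  have img: "r ` set as = set ?x" "r ` set bs = set p" "r' ` set bs = set q" "r' ` set cs = set ?z"
    using r r' by (metis set_map)+
  have dis: "lbl (ren r E) \<inter> lbl (ren r' E') = {}"
    by (rule renamed_disjoint[OF f f' r(3,4) r'(3,4)]) (use r(5) r'(5) lpq xz in \<open>simp_all add: Int_Un_distrib Int_commute\<close>)
  let ?P = "ren r E @ ren r' E'"
  have einP: "ein (ren r E)" "ein (ren r' E')" using r r' F by (auto intro: einstein_ren)
  then have einP': "ein ?P" using dis by (auto simp: einstein_append expr_labels_def)
  have frr: "frame (ren r E) ?x p" "frame (ren r' E') q ?z"
    using frame_ren[OF f r(1,2)] frame_ren[OF f' r'(1,2)] r r' by auto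
  have lq: "length q = length p" "length p = length bs" using pq by (metis length_map)+
  have "compK (cls E' bs cs) (cls E as bs) = contracts S q p (product S (cl (ren r E)) (cl (ren r' E')))"
    using at_labels_cls[OF f r(1,2)] at_labels_cls[OF f' r'(1,2)] r r' f f'
    by (simp add: tcomp_def Let_def p_def q_def w_def)
  also have "product S (cl (ren r E)) (cl (ren r' E')) = cl ?P"
    by (intro product_class einP dis)
  also have "contracts S q p (cl ?P) = cl (emap id (lmap p q) ?P)"
  proof (rule contracts_class)
    show "set q \<subseteq> free_lower ?P" "set p \<subseteq> free_upper ?P"
      using frr dis by (auto simp: frame_def free_lower_alt free_upper_alt expr_labels_def)
    show "map (lmap p q) p = q" using lq lpq by (intro map_lmap) (auto simp: label_list_def)
    show "lmap p q a = a" if "a \<in> set (upper ?P) - set p" for a using that by (simp add: lmap_other)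
  qed (use lq einP' lpq pq in \<open>auto simp: label_list_def\<close>)
  also have "emap id (lmap p q) ?P = ren (\<lambda>a. if a \<in> lbl E - set bs then r a else r' a) (E @ E')"
  proof -
    let ?r = "\<lambda>a. if a \<in> lbl E - set bs then r a else r' a"
    have mp: "map (lmap p q) p = q" using lq lpq by (intro map_lmap) (auto simp: label_list_def)
    have "map (lmap p q) (map r bs) = map r' bs" using mp r r' by simp
    then have 1: "lmap p q (r a) = r' a" if "a \<in> set bs" for a using that by simp
    have 2: "lmap p q (r a) = r a" if "a \<in> lbl E" "a \<notin> set bs" for a
    proof -
      have "r a \<notin> set p"
        using inj_on_image_mem_iff[OF r(1) that(1), of "set bs"] that F(5) img(2) by auto
      then show ?thesis by (simp add: lmap_other)
    qed
    have 3: "lmap p q (r' a) = r' a" if "a \<in> lbl E'" for a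
    proof -
      have "set p \<subseteq> lbl (ren r E)" unfolding expr_labels_ren F(5) img(2)[symmetric] by blast
      moreover have "r' a \<in> lbl (ren r' E')" using that by (simp add: expr_labels_ren)
      ultimately have "r' a \<notin> set p" using dis by blast
      then show ?thesis by (simp add: lmap_other)
    qed
    \<comment> \<open>On \<open>E\<close> only the outputs \<open>bs\<close> change: \<open>r\<close> sends them to \<open>p\<close>, and the contraction sends \<open>p\<close> to \<open>q\<close>, the image under \<open>r'\<close>.\<close>
    have "emap (id \<circ> r) (lmap p q \<circ> r) E = ren ?r E"
    proof (rule emap_cong)
      fix a assume a: "a \<in> set (lower E)"
      then have "a \<notin> set bs" using f by (auto simp: frame_def free_upper_alt)
      then show "(id \<circ> r) a = ?r a" using a by (auto simp: expr_labels_def)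
    next
      fix a assume a: "a \<in> set (upper E)"
      then show "(lmap p q \<circ> r) a = ?r a" using 1 2 by (auto simp: expr_labels_def)
    qed
    moreover have "emap (id \<circ> r') (lmap p q \<circ> r') E' = ren ?r E'"
    proof (rule emap_cong)
      fix a assume a: "a \<in> set (lower E')"
      then show "(id \<circ> r') a = ?r a" using int by (auto simp: expr_labels_def)
    next
      fix a assume a: "a \<in> set (upper E')"
      then show "(lmap p q \<circ> r') a = ?r a" using 3 int by (auto simp: expr_labels_def)
    qed
    ultimately show ?thesis by simp
  qed
  also have "cl \<dots> = cls (E @ E') as cs"
  proof (rule cls_eq[symmetric, OF frame_comp[OF f f' int]])
    let ?r = "\<lambda>a. if a \<in> lbl E - set bs then r a else r' a"
    have "?r a = r' a" if "a \<in> lbl E'" for a using that int by auto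
    moreover have "?r a = r a" if "a \<in> lbl E - set bs" for a using that by auto
    moreover have "lbl (E @ E') = (lbl E - set bs) \<union> lbl E'" using int by auto
    moreover have "inj_on ?r ((lbl E - set bs) \<union> lbl E')"
      using dis inj_on_subset[OF r(1)]
      by (intro inj_on_disjoint_Un r'(1)) (auto simp: expr_labels_ren)
    moreover have "type_pres ?r ((lbl E - set bs) \<union> lbl E')"
      using r(2) r'(2) by (auto simp: type_pres_def)
    moreover have "map ?r as = ?x" using r(3) F by (auto simp flip: r(3))
    moreover have "map ?r cs = ?z" using r'(4) F int by (auto simp flip: r'(4))
    ultimately show "canonizes ?r (E @ E') as cs" unfolding canonizes_def by simp
  qed
  finally show ?thesis .
qed

lemma frame_tens:
  assumes "frame E as bs" "frame E' as' bs'" "lbl E \<inter> lbl E' = {}"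
  shows "frame (E @ E') (as @ as') (bs @ bs')"
  using assms unfolding frame_def
  by (auto simp: einstein_append free_lower_alt free_upper_alt expr_labels_def)

lemma tens_cls:
  assumes f: "frame E as bs" and f': "frame E' as' bs'" and int: "lbl E \<inter> lbl E' = {}"
  shows "tensK (cls E as bs) (cls E' as' bs') = cls (E @ E') (as @ as') (bs @ bs')"
proof -
  let ?X = "map ty as" and ?Y = "map ty bs" and ?U = "map ty as'" and ?V = "map ty bs'"
  let ?x = "can False 0 ?X" and ?y = "can True 0 ?Y"
  let ?u = "can False (length ?X) ?U" and ?v = "can True (length ?Y) ?V"
  let ?N = "set ?x \<union> set ?y \<union> set ?u \<union> set ?v"
  note F = frameD[OF f] frameD[OF f']
  have t: "?X \<in> tylists" "?Y \<in> tylists" "?U \<in> tylists" "?V \<in> tylists"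
    using F label_list_types by auto
  note cp = canons_props[OF t(1)] canons_props[OF t(2)] canons_props[OF t(3)] canons_props[OF t(4)]
  have d: "set ?x \<inter> set ?y = {}" "set ?x \<inter> set ?u = {}" "set ?x \<inter> set ?v = {}" "set ?y \<inter> set ?u = {}" 
    "set ?y \<inter> set ?v = {}" "set ?u \<inter> set ?v = {}"
    using t by (intro canons_disjoint; auto)+
  have "label_list (?x @ ?y)" using d t by (auto simp: label_list_append label_list_canons)
  then obtain r where r: "inj_on r (lbl E)" "type_pres r (lbl E)" "map r as = ?x" "map r bs = ?y"
      "r ` bound E \<inter> ?N = {}"
    using ex_frame_renaming[OF f, of ?x ?y ?N] cp by auto
  have "label_list (?u @ ?v)" using d t by (auto simp: label_list_append label_list_canons)
  then obtain r' where r': "inj_on r' (lbl E')" "type_pres r' (lbl E')" "map r' as' = ?u" "map r' bs' = ?v"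
      "r' ` bound E' \<inter> (?N \<union> r ` lbl E) = {}"
    using ex_frame_renaming[OF f', of ?u ?v "?N \<union> r ` lbl E"] cp by auto
  have img: "r ` set as = set ?x" "r ` set bs = set ?y" "r' ` set as' = set ?u" "r' ` set bs' = set ?v"
    using r r' by (metis set_map)+
  have dis: "lbl (ren r E) \<inter> lbl (ren r' E') = {}"
    by (rule renamed_disjoint[OF f f' r(3,4) r'(3,4)]) (use r(5) r'(5) d in \<open>simp_all add: Int_Un_distrib Int_commute\<close>)
  have einP: "ein (ren r E)" "ein (ren r' E')" using r r' F by (auto intro: einstein_ren)
  have "tensK (cls E as bs) (cls E' as' bs') = product S (cl (ren r E)) (cl (ren r' E'))"
    using at_labels_cls[OF f r(1,2)] at_labels_cls[OF f' r'(1,2)] r r' f f'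
    by (simp add: ttens_def Let_def)
  also have "\<dots> = cl (ren r E @ ren r' E')"
    by (intro product_class einP dis)
  also have "ren r E @ ren r' E' = ren (\<lambda>a. if a \<in> lbl E then r a else r' a) (E @ E')"
    unfolding emap_append using int by (intro arg_cong2[of _ _ _ _ append] emap_cong) (auto simp: expr_labels_def)
  also have "cl \<dots> = cls (E @ E') (as @ as') (bs @ bs')"
  proof (rule cls_eq[symmetric, OF frame_tens[OF f f' int]])
    let ?r = "\<lambda>a. if a \<in> lbl E then r a else r' a"
    have r'E: "?r a = r' a" if "a \<in> lbl E'" for a using that int by auto
    have "inj_on ?r (lbl E \<union> lbl E')"
      using dis by (intro inj_on_disjoint_Un r'(1) r(1)) (simp add: expr_labels_ren)
    moreover have "type_pres ?r (lbl E \<union> lbl E')"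
      using r(2) r'(2) by (auto simp: type_pres_def)
    moreover have "map ?r as = ?x" using r(3) F by (auto simp flip: r(3))
    moreover have "map ?r bs = ?y" using r(4) F by (auto simp flip: r(4))
    moreover have "map ?r as' = ?u" "map ?r bs' = ?v"
      unfolding r'(3)[symmetric] r'(4)[symmetric] using r'E F(13) by (intro map_cong; blast)+
    ultimately show "canonizes ?r (E @ E') (as @ as') (bs @ bs')" unfolding canonizes_def by (simp add: canons_append)
  qed
  finally show ?thesis .
qed

lemma frame_trace:
  assumes "frame E (as @ cs) (bs @ ds)" "map ty cs = map ty ds" "map g ds = cs"
    "\<And>a. a \<in> set (upper E) - set ds \<Longrightarrow> g a = a"
  shows "frame (emap id g E) as bs" "lbl (emap id g E) \<subseteq> lbl E"
    "bound (emap id g E) = bound E \<union> set cs"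
proof -
  note F = frameD[OF assms(1)]
  have ds: "set ds \<subseteq> set (upper E)" "set cs \<subseteq> set (lower E)" "set cs \<inter> set (upper E) = {}"
    "set ds \<inter> set (lower E) = {}"
    using assms(1) by (auto simp: frame_def free_upper_alt free_lower_alt)
  have gds: "g ` set ds = set cs" using assms(3) by (metis set_map)
  have "g ` (set (upper E) - set ds) = set (upper E) - set ds" using assms(4) by force
  then have up: "g ` set (upper E) = (set (upper E) - set ds) \<union> set cs"
    using gds ds(1) by (metis Un_Diff_cancel2 image_Un sup.absorb1 sup_commute)
  have "inj_on g (set ds)" using assms(1,3) by (metis distinct_append distinct_map frame_def)
  then have inj: "inj_on g (set (upper E))"
    using ds(3) gds assms(4) unfolding inj_on_def by (metis Diff_iff disjoint_iff imageI)
  have "map ty (map g ds) = map ty ds" using assms(2) unfolding assms(3) .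
  then have "ty (g a) = ty a" if "a \<in> set ds" for a using that by simp
  then have ty: "ty (g a) = ty a" if "a \<in> set (upper E)" for a using assms(4) that by (cases "a \<in> set ds") auto
  have "type_pres g (set (upper E))"
    using ty up ds einstein_labels[OF F(1)] unfolding type_pres_def expr_labels_def by blast
  then have "ein (emap id g E)" using F(1) inj einstein_labels[OF F(1)]
    by (intro einstein_emap) (auto simp: type_pres_def expr_labels_def)
  moreover have "set as = free_lower (emap id g E)" "set bs = free_upper (emap id g E)"
    using assms(1) ds unfolding frame_def by (auto simp: free_lower_alt free_upper_alt up)
  ultimately show "frame (emap id g E) as bs" using assms(1) by (simp add: frame_def)
  show "lbl (emap id g E) \<subseteq> lbl E" "bound (emap id g E) = bound E \<union> set cs"
    using up ds by (auto simp: expr_labels_def bound_def)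
qed

text \<open>
  As for composition, the fresh names \<open>p\<close> and \<open>q\<close> of the traced outputs and inputs are identified again by the
  contraction.  The function \<open>g\<close> describes the identification directly on \<open>E\<close>.
\<close>

lemma trace_cls:
  assumes f: "frame E (as @ cs) (bs @ ds)" and ty: "map ty cs = map ty ds" and g: "map g ds = cs"
    "\<And>a. a \<in> set (upper E) - set ds \<Longrightarrow> g a = a"
  shows "trK (map ty as) (map ty bs) (map ty cs) (cls E (as @ cs) (bs @ ds)) = cls (emap id g E) as bs"
proof -
  let ?X = "map ty as" and ?Y = "map ty bs" and ?Z = "map ty cs"
  let ?x = "can False 0 ?X" and ?y = "can True 0 ?Y"
  define w where "w = fresh \<Lambda> (set ?x \<union> set ?y) (?Z @ ?Z)"
  define p where "p = take (length ?Z) w"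
  define q where "q = drop (length ?Z) w"
  note F = frameD[OF f] 
  have t: "?X \<in> tylists" "?Y \<in> tylists" "?Z \<in> tylists"
    using F label_list_types unfolding label_list_append by auto
  have w: "label_list w" "set w \<inter> (set ?x \<union> set ?y) = {}" "map ty w = ?Z @ ?Z"
    using fresh_props[of "?Z @ ?Z" "set ?x \<union> set ?y"] t unfolding w_def by auto
  have pq: "w = p @ q" "map ty p = ?Z" "map ty q = ?Z" using w(3)
    by (auto simp: p_def q_def take_map[symmetric] drop_map[symmetric])
  have lpq: "label_list p" "label_list q" "set p \<inter> set q = {}" "set p \<inter> set ?x = {}" "set p \<inter> set ?y = {}"
      "set q \<inter> set ?x = {}" "set q \<inter> set ?y = {}"
    using w(1,2) unfolding pq(1) label_list_append by auto
  note cp = canons_props[OF t(1)] canons_props[OF t(2)]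
  have xy: "set ?x \<inter> set ?y = {}" using t by (intro canons_disjoint) auto
  have "label_list ((?x @ q) @ (?y @ p))" using lpq t xy by (auto simp: label_list_append label_list_canons)
  moreover have "map ty (as @ cs) = map ty (?x @ q)" "map ty (bs @ ds) = map ty (?y @ p)" using cp pq ty by auto
  ultimately obtain r where r: "inj_on r (lbl E)" "type_pres r (lbl E)" 
      "map r (as @ cs) = ?x @ q" "map r (bs @ ds) = ?y @ p"
    using ex_frame_renaming[OF f, of "?x @ q" "?y @ p" "{}"] by blast
  have rr: "map r as = ?x" "map r cs = q" "map r bs = ?y" "map r ds = p"
    using r(3,4) append_eq_append_conv[of "map r as" ?x "map r cs" q]
      append_eq_append_conv[of "map r bs" ?y "map r ds" p] by auto
  have frr: "frame (ren r E) (?x @ q) (?y @ p)" using frame_ren[OF f r(1,2)] r(3,4) by metis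
  have lq: "length q = length p" using pq by (metis length_map)
  have mp: "map (lmap p q) p = q" using lq lpq by (intro map_lmap) (auto simp: label_list_def)
  have "trK ?X ?Y ?Z (cls E (as @ cs) (bs @ ds)) = contracts S q p (cl (ren r E))"
    using at_labels_cls[OF f r(1,2)] ty by (simp add: rr ttrace_def Let_def p_def q_def w_def)
  also have "\<dots> = cl (emap id (lmap p q) (ren r E))"
  proof (rule contracts_class)
    show "ein (ren r E)" "set q \<subseteq> free_lower (ren r E)" "set p \<subseteq> free_upper (ren r E)"
      using frr by (auto simp: frame_def)
    show "lmap p q a = a" if "a \<in> set (upper (ren r E)) - set p" for a using that by (simp add: lmap_other)
  qed (use lq lpq pq mp in \<open>auto simp: label_list_def\<close>)
  also have "emap id (lmap p q) (ren r E) = ren r (emap id g E)"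
    unfolding emap_emap
  proof (rule emap_cong)
    fix a assume a: "a \<in> set (upper E)"
    show "(lmap p q \<circ> r) a = (r \<circ> g) a"
    proof (cases "a \<in> set ds")
      case True
      have "map (lmap p q) (map r ds) = map r (map g ds)" using mp rr g by metis
      then show ?thesis using True by simp
    next
      case False
      have "set p = r ` set ds" using rr by (metis set_map)
      moreover have "a \<in> lbl E" using a by (simp add: expr_labels_def)
      ultimately have "r a \<notin> set p"
        using inj_on_image_mem_iff[OF r(1), of a "set ds"] False F(5) by auto
      then show ?thesis using g a False by (simp add: lmap_other)
    qed
  qed simp
  also have "cl \<dots> = cls (emap id g E) as bs"
  proof (rule cls_eq[symmetric])
    show "frame (emap id g E) as bs" by (rule frame_trace[OF f ty g])
    show "canonizes r (emap id g E) as bs"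
      using frame_trace(2)[OF f ty g] r rr by (auto simp: canonizes_def intro: inj_on_subset type_pres_subset)
  qed
  finally show ?thesis .
qed

end

section \<open>Absorption of wires\<close>

text \<open>
  The usual shape of a renaming of some labels to fresh ones.
\<close>

lemma inj_on_replace:
  assumes "distinct ds'" "map g ds = ds'" "set ds' \<inter> L = {}" "\<And>a. a \<in> L - set ds \<Longrightarrow> g a = a"
  shows "inj_on g L"
proof (rule inj_onI)
  have inj: "inj_on g (set ds)" and img: "g ` set ds = set ds'"
    using assms(1,2) by (auto simp: distinct_map simp flip: set_map)
  fix a b assume ab: "a \<in> L" "b \<in> L" "g a = g b"
  have *: "g c \<in> set ds'" if "c \<in> set ds" for c using img that by blast
  show "a = b"
  proof (cases "a \<in> set ds"; cases "b \<in> set ds")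
    assume "a \<in> set ds" "b \<in> set ds" then show ?thesis using inj ab(3) by (auto dest: inj_onD)
  next
    assume "a \<in> set ds" "b \<notin> set ds" then show ?thesis using ab assms(3) assms(4)[of b] *[of a] by auto
  next
    assume "a \<notin> set ds" "b \<in> set ds" then show ?thesis using ab assms(3) assms(4)[of a] *[of b] by auto
  next
    assume "a \<notin> set ds" "b \<notin> set ds" then show ?thesis using ab assms(4)[of a] assms(4)[of b] by auto
  qed
qed

lemma lmap_image_other: "set as \<inter> A = {} \<Longrightarrow> lmap as bs ` A = A"
  by (force simp: disjoint_iff lmap_other)

lemma expr_labels_dels: "length as = length bs \<Longrightarrow> lbl (dels as bs) = set as \<union> set bs"
  by (simp add: expr_labels_def)

context free_tensor_system begin

lemma type_pres_replace:
  assumes "map ty ds = map ty ds'" "map g ds = ds'" "set ds' \<subseteq> labels \<Lambda>" "L \<subseteq> labels \<Lambda>" "\<And>a. a \<in> L - set ds \<Longrightarrow> g a = a"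
  shows "type_pres g L"
proof -
  have "map ty (map g ds) = map ty ds" using assms by simp
  then have "\<forall>a\<in>set ds. ty (g a) = ty a" by simp
  moreover have "\<forall>a\<in>set ds. g a \<in> labels \<Lambda>" using assms(2,3) by auto
  ultimately show ?thesis unfolding type_pres_def using assms(4,5) by (metis Diff_iff subsetD)
qed

lemma same_types_length: "map ty as = map ty bs \<Longrightarrow> length as = length bs"
  by (rule map_eq_imp_length_eq)

lemma frame_dels:
  assumes "label_list (as @ bs)" "map ty as = map ty bs"
  shows "frame (dels as bs) as bs"
proof -
  have len: "length as = length bs" using assms(2) by (rule same_types_length)
  have "ok e" if "e \<in> set (dels as bs)" for e
  proof -
    from \<open>e \<in> set (dels as bs)\<close> len
    obtain i where i: "i < length as" "e = Delta (as ! i) (bs ! i)"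
      by (auto simp: set_zip)
    have "ty (as ! i) = ty (bs ! i)" using i len arg_cong[OF assms(2), of "\<lambda>l. l ! i"] by simp
    then show ?thesis using i len assms(1) by (auto simp: label_list_def)
  qed
  then have "ein (dels as bs)" using len assms(1) by (auto simp: einstein_def label_list_def)
  then show ?thesis
    using len assms(1) by (auto simp: frame_def free_lower_alt free_upper_alt label_list_def)
qed

lemma deltas_class:
  assumes "label_list (as @ bs)" "map ty as = map ty bs"
  shows "deltas S as bs = cl (dels as bs)"
  using same_types_length[OF assms(2)] assms
proof (induction as bs rule: list_induct2)
  case Nil
  then show ?case by (simp add: deltas_def Free_def)
next
  case (Cons a as b bs)
  have len: "length as = length bs" using Cons by simp
  have l: "label_list (as @ bs)" using Cons.prems by (auto simp: label_list_def)
  have "deltas S (a # as) (b # bs) = product S (delta S a b) (deltas S as bs)"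
    by (simp add: deltas_def)
  also have "\<dots> = product S (cl [Delta a b]) (cl (dels as bs))"
    using Cons l by (simp add: Free_def)
  also have "\<dots> = cl ([Delta a b] @ dels as bs)"
  proof (rule product_class)
    show "ein [Delta a b]" using Cons.prems by (simp add: einstein_delta label_list_def)
    show "ein (dels as bs)" using frame_dels[OF l] Cons.prems by (simp add: frame_def)
    show "lbl [Delta a b] \<inter> lbl (dels as bs) = {}"
      using Cons.prems by (auto simp: expr_labels_dels[OF len] expr_labels_def[of "[Delta a b]"] label_list_def)
  qed
  finally show ?case by simp
qed

lemma Ide_cls:
  assumes "label_list (as @ bs)" "map ty as = map ty bs"
  shows "idK (map ty as) = cls (dels as bs) as bs"
proof -
  note f = frame_dels[OF assms]
  obtain r where r: "canonizes r (dels as bs) as bs" using ex_canonizes[OF f] by blast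
  have X: "map ty as \<in> tylists" using assms by (auto simp: label_list_append intro!: label_list_types)
  have "label_list (can False 0 (map ty as) @ can True 0 (map ty as))"
    unfolding label_list_append by (intro conjI label_list_canons canons_disjoint X) simp
  moreover have "map ty (can False 0 (map ty as)) = map ty (can True 0 (map ty as))"
    by (simp only: canons_props(3)[OF X])
  ultimately have "idK (map ty as) = cl (dels (can False 0 (map ty as)) (can True 0 (map ty as)))"
    using deltas_class by (simp add: Cat_def)
  also have "\<dots> = cl (ren r (dels as bs))" using r assms(2) by (simp add: emap_dels canonizes_def)
  finally show ?thesis using cls_eq[OF f r] by simp
qed

lemma frame_reorder:
  "frame E as bs \<Longrightarrow> distinct as' \<Longrightarrow> set as' = set as \<Longrightarrow> distinct bs' \<Longrightarrow> set bs' = set bs \<Longrightarrow> frame E as' bs'"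
  by (auto simp: frame_def)

lemma frame_symm:
  assumes "label_list ((a @ b) @ (a' @ b'))" "map ty a = map ty a'" "map ty b = map ty b'"
  shows "frame (dels (a @ b) (a' @ b')) (a @ b) (b' @ a')"
  using frame_dels[OF assms(1)] assms by (auto simp: label_list_def intro!: frame_reorder[of _ "a @ b" "a' @ b'"])

lemma symm_cls:
  assumes "label_list ((a @ b) @ (a' @ b'))" "map ty a = map ty a'" "map ty b = map ty b'"
  shows "symmK (map ty a) (map ty b) = cls (dels (a @ b) (a' @ b')) (a @ b) (b' @ a')"
proof -
  let ?X = "map ty a" and ?Y = "map ty b"
  let ?x = "can False 0 ?X" and ?x' = "can True (length ?Y) ?X"
  let ?y = "can False (length ?X) ?Y" and ?y' = "can True 0 ?Y"
  note f = frame_symm[OF assms]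
  obtain r where r: "canonizes r (dels (a @ b) (a' @ b')) (a @ b) (b' @ a')" using ex_canonizes[OF f] by blast
  have X: "?X \<in> tylists" "?Y \<in> tylists"
    using assms(1) unfolding label_list_append by (auto intro!: label_list_types)
  note len = same_types_length[OF assms(2)] same_types_length[OF assms(3)]
  have "map r a @ map r b = ?x @ ?y" "map r b' @ map r a' = ?y' @ ?x'"
    using r assms(2,3) by (simp_all add: canonizes_def canons_append)
  then have rr: "map r a = ?x" "map r b = ?y" "map r b' = ?y'" "map r a' = ?x'"
    using append_eq_append_conv[of "map r a" ?x "map r b" ?y] append_eq_append_conv[of "map r b'" ?y' "map r a'" ?x'] len
    by auto
  note p = canons_props[OF X(1)] canons_props[OF X(2)]
  have l: "label_list (?x @ ?x')" "label_list (?y @ ?y')"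
    unfolding label_list_append by (intro conjI label_list_canons canons_disjoint X; simp)+
  have t: "map ty ?x = map ty ?x'" "map ty ?y = map ty ?y'" by (simp_all only: p)
  have "symmK ?X ?Y = product S (cl (dels ?x ?x')) (cl (dels ?y ?y'))"
    using deltas_class[OF l(1) t(1)] deltas_class[OF l(2) t(2)] by (simp add: tsymm_def)
  also have "\<dots> = cl (dels ?x ?x' @ dels ?y ?y')"
  proof (rule product_class)
    show "ein (dels ?x ?x')" "ein (dels ?y ?y')" using frame_dels l t by (auto simp: frame_def)
    have "set ?x \<inter> set ?y = {}" "set ?x \<inter> set ?y' = {}" "set ?y' \<inter> set ?x' = {}" "set ?y \<inter> set ?x' = {}"
      by (intro canons_disjoint X; simp)+
    then show "lbl (dels ?x ?x') \<inter> lbl (dels ?y ?y') = {}"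
      by (auto simp: expr_labels_dels)
  qed
  also have "dels ?x ?x' @ dels ?y ?y' = ren r (dels (a @ b) (a' @ b'))"
    using rr len by (simp add: emap_dels)
  finally show ?thesis using cls_eq[OF f r] by simp
qed

text \<open>
  Each delta is eliminated against the upper label to which its lower end is attached.  As \<open>ds\<close> and \<open>ds'\<close> are disjoint,
  eliminating one delta does not change the others.
\<close>

lemma absorb_upper:
  assumes "length ds = length ds'" "ein (E @ dels ds ds')" "set ds \<subseteq> set (upper E)" "set ds \<inter> set ds' = {}"
    "map g ds = ds'" "\<And>a. a \<in> set (upper E) - set ds \<Longrightarrow> g a = a"
  shows "E @ dels ds ds' \<approx> emap id g E"
  using assms
proof (induction ds ds' arbitrary: E g rule: list_induct2)
  case Nil
  then show ?case by (simp add: emap_idI expr_eq.refl)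
next
  case (Cons d ds d' ds')
  let ?E = "repl_upper d d' E" and ?g = "g(d' := d')"
  have d: "d \<in> set (upper E)" "d \<notin> set ds'" "d' \<notin> set ds" "d' \<notin> set (upper E)" "d \<notin> set ds" "g d = d'"
    using Cons.prems Cons.hyps by (auto simp: einstein_def)
  have up: "set (upper ?E) = insert d' (set (upper E) - {d})" using d by (auto simp: repl_upper_emap)
  have "E @ dels (d # ds) (d' # ds') \<approx> (E @ dels ds ds') @ [Delta d d']"
    using Cons.prems by (intro expr_eq.permute) auto
  also from expr_eq_einstein[OF this] have "\<dots> \<approx> repl_upper d d' (E @ dels ds ds')"
    using d by (intro expr_eq.delta_upper) auto
  also have "repl_upper d d' (E @ dels ds ds') = ?E @ dels ds ds'"
    using d Cons.hyps by (simp add: repl_upper_emap) (intro emap_idI; auto)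
  finally have *: "E @ dels (d # ds) (d' # ds') \<approx> ?E @ dels ds ds'" .
  also have "?E @ dels ds ds' \<approx> emap id ?g ?E"
  proof (rule Cons.IH)
    show "ein (?E @ dels ds ds')" using expr_eq_einstein[OF *] by simp
    show "set ds \<subseteq> set (upper ?E)" "set ds \<inter> set ds' = {}" using Cons.prems d by (auto simp: up)
    show "map ?g ds = ds'" using Cons.prems d by auto
    show "?g a = a" if "a \<in> set (upper ?E) - set ds" for a using that up Cons.prems by auto
  qed
  also have "emap id ?g ?E = emap id g E"
    unfolding repl_upper_emap emap_emap using d by (intro emap_cong) auto
  finally show ?case .
qed

lemma absorb_lower:
  assumes "length ds' = length ds" "ein (E @ dels ds' ds)" "set ds \<subseteq> set (lower E)" "set ds \<inter> set ds' = {}"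
    "map g ds = ds'" "\<And>a. a \<in> set (lower E) - set ds \<Longrightarrow> g a = a"
  shows "E @ dels ds' ds \<approx> emap g id E"
  using assms
proof (induction ds' ds arbitrary: E g rule: list_induct2)
  case Nil
  then show ?case by (simp add: emap_idI expr_eq.refl)
next
  case (Cons d' ds' d ds)
  let ?E = "repl_lower d d' E" and ?g = "g(d' := d')"
  have d: "d \<in> set (lower E)" "d \<notin> set ds'" "d' \<notin> set ds" "d' \<notin> set (lower E)" "d \<notin> set ds" "g d = d'"
    using Cons.prems Cons.hyps by (auto simp: einstein_def)
  have low: "set (lower ?E) = insert d' (set (lower E) - {d})" using d by (auto simp: repl_lower_emap)
  have "E @ dels (d' # ds') (d # ds) \<approx> (E @ dels ds' ds) @ [Delta d' d]"
    using Cons.prems by (intro expr_eq.permute) auto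
  also from expr_eq_einstein[OF this] have "\<dots> \<approx> repl_lower d d' (E @ dels ds' ds)"
    using d by (intro expr_eq.delta_lower) auto
  also have "repl_lower d d' (E @ dels ds' ds) = ?E @ dels ds' ds"
    using d Cons.hyps by (simp add: repl_lower_emap) (intro emap_idI; auto)
  finally have *: "E @ dels (d' # ds') (d # ds) \<approx> ?E @ dels ds' ds" .
  also have "?E @ dels ds' ds \<approx> emap ?g id ?E"
  proof (rule Cons.IH)
    show "ein (?E @ dels ds' ds)" using expr_eq_einstein[OF *] by simp
    show "set ds \<subseteq> set (lower ?E)" "set ds \<inter> set ds' = {}" using Cons.prems d by (auto simp: low)
    show "map ?g ds = ds'" using Cons.prems d by auto
    show "?g a = a" if "a \<in> set (lower ?E) - set ds" for a using that low Cons.prems by auto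
  qed
  also have "emap ?g id ?E = emap g id E"
    unfolding repl_lower_emap emap_emap using d by (intro emap_cong) auto
  finally show ?case .
qed

text \<open>
  Prolonging outputs by wires only changes their names.
\<close>

lemma cls_absorb_upper:
  assumes f: "frame E as bs" and ds: "distinct ds" "set ds \<subseteq> set bs"
    and ds': "label_list ds'" "set ds' \<inter> lbl E = {}" "map ty ds = map ty ds'"
    and g: "map g ds = ds'" "\<And>a. a \<in> lbl E - set ds \<Longrightarrow> g a = a"
  shows "cls (E @ dels ds ds') as (map g bs) = cls E as bs"
proof -
  note F = frameD[OF f]
  have len: "length ds = length ds'" using ds'(3) by (rule same_types_length)
  have sub: "set ds \<subseteq> set (upper E)" "set ds \<inter> set (lower E) = {}" "set ds \<inter> set ds' = {}"
    using f ds(2) ds'(2) F(5) by (auto simp: frame_def free_upper_alt)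
  have "label_list (ds @ ds')" using ds ds' F sub by (auto simp: label_list_def)
  then have "frame (dels ds ds') ds ds'" using ds'(3) by (rule frame_dels)
  then have ein: "ein (E @ dels ds ds')"
    using F(1) sub ds'(2) len by (auto simp: einstein_append frame_def expr_labels_def)
  have inj: "inj_on g (lbl E)" using ds' g by (intro inj_on_replace[of ds' g ds]) (auto simp: label_list_def)
  have tp: "type_pres g (lbl E)"
    using ds' g einstein_labels[OF F(1)] by (intro type_pres_replace[of ds ds']) (auto simp: label_list_def)
  have "E @ dels ds ds' \<approx> emap id g E"
    using g(2) by (intro absorb_upper len ein sub g(1)) (auto simp: expr_labels_def)
  also have "emap id g E = ren g E"
  proof (rule emap_cong)
    fix a assume a: "a \<in> set (lower E)"
    then have "a \<notin> set ds" using sub by blast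
    then show "id a = g a" using g(2)[of a] a by (simp add: expr_labels_def)
  qed simp
  finally have eq: "ren g E \<approx> E @ dels ds ds'" by (rule expr_eq.sym)
  have "map g as = as"
  proof (rule map_idI)
    fix a assume "a \<in> set as"
    then have "a \<in> lbl E - set ds" using F(2,5) ds(2) by blast
    then show "g a = a" by (rule g(2))
  qed
  then have "frame (ren g E) as (map g bs)" "cls (ren g E) as (map g bs) = cls E as bs"
    using frame_ren[OF f inj tp] cls_ren[OF f inj tp] by simp_all
  then show ?thesis using cls_equiv[OF _ eq] by simp
qed

lemma cls_absorb_lower:
  assumes f: "frame E as bs" and ds: "distinct ds" "set ds \<subseteq> set as"
    and ds': "label_list ds'" "set ds' \<inter> lbl E = {}" "map ty ds = map ty ds'"
    and g: "map g ds = ds'" "\<And>a. a \<in> lbl E - set ds \<Longrightarrow> g a = a"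
  shows "cls (E @ dels ds' ds) (map g as) bs = cls E as bs"
proof -
  note F = frameD[OF f]
  have len: "length ds' = length ds" using ds'(3)[symmetric] by (rule same_types_length)
  have sub: "set ds \<subseteq> set (lower E)" "set ds \<inter> set (upper E) = {}" "set ds \<inter> set ds' = {}"
    using f ds(2) ds'(2) F(5) by (auto simp: frame_def free_lower_alt)
  have "label_list (ds' @ ds)" using ds ds' F sub by (auto simp: label_list_def)
  then have "frame (dels ds' ds) ds' ds" using ds'(3)[symmetric] by (rule frame_dels)
  then have ein: "ein (E @ dels ds' ds)"
    using F(1) sub ds'(2) len by (auto simp: einstein_append frame_def expr_labels_def)
  have inj: "inj_on g (lbl E)" using ds' g by (intro inj_on_replace[of ds' g ds]) (auto simp: label_list_def)
  have tp: "type_pres g (lbl E)"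
    using ds' g einstein_labels[OF F(1)] by (intro type_pres_replace[of ds ds']) (auto simp: label_list_def)
  have "E @ dels ds' ds \<approx> emap g id E"
    using g(2) by (intro absorb_lower len ein sub g(1)) (auto simp: expr_labels_def)
  also have "emap g id E = ren g E"
  proof (rule emap_cong)
    fix a assume a: "a \<in> set (upper E)"
    then have "a \<notin> set ds" using sub by blast
    then show "id a = g a" using g(2)[of a] a by (simp add: expr_labels_def)
  qed simp
  finally have eq: "ren g E \<approx> E @ dels ds' ds" by (rule expr_eq.sym)
  have "map g bs = bs"
  proof (rule map_idI)
    fix a assume "a \<in> set bs"
    then have "a \<in> lbl E - set ds" using F(2,5) ds(2) by blast
    then show "g a = a" by (rule g(2))
  qed
  then have "frame (ren g E) (map g as) bs" "cls (ren g E) (map g as) bs = cls E as bs"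
    using frame_ren[OF f inj tp] cls_ren[OF f inj tp] by simp_all
  then show ?thesis using cls_equiv[OF _ eq] by simp
qed

lemma frame_sub: "frame F as bs \<Longrightarrow> set as \<subseteq> lbl F \<and> set bs \<subseteq> lbl F"
  using frameD(5) by blast

text \<open>
  Composition with an arrow that acts as \<open>G\<close> on the outputs \<open>b\<close> and as plain wires on the remaining outputs \<open>ds\<close>.
  The order of inputs and outputs of that arrow is arbitrary, so with empty \<open>G\<close> it may be any permutation
  of wires.
\<close>

lemma extend_upper:
  assumes F: "frame F as bs" and G: "frame G b b'" and int: "lbl F \<inter> lbl G = set b"
    and b: "set b \<subseteq> set bs" and ds: "distinct ds" "set ds = set bs - set b"
    and ds': "label_list ds'" "set ds' \<inter> (lbl F \<union> lbl G) = {}" "map ty ds = map ty ds'"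
    and out: "distinct out" "set out = set ds \<union> set b'" and out': "out' = map (lmap ds ds') out"
  shows "frame (F @ G) as out" "frame (G @ dels ds ds') bs out'"
    "compK (cls (G @ dels ds ds') bs out') (cls F as bs) = cls (F @ G) as out"
proof -
  note fF = frameD[OF F] and fG = frameD[OF G]
  let ?g = "lmap ds ds'"
  have len: "length ds = length ds'" using ds'(3) by (rule same_types_length)
  show fr: "frame (F @ G) as out"
    using F G int b ds out unfolding frame_def
    by (auto simp: einstein_append free_lower_alt free_upper_alt expr_labels_def)
  have dsG: "set ds \<inter> lbl G = {}" "set ds \<subseteq> lbl F" using int ds fF(5) by auto
  have "label_list (ds @ ds')" using ds ds' fF dsG by (auto simp: label_list_def)
  then have "frame (dels ds ds') ds ds'" using ds'(3) by (rule frame_dels)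
  then have fr1: "frame (G @ dels ds ds') (b @ ds) (b' @ ds')"
    using dsG ds' by (intro frame_tens G) (auto simp: expr_labels_dels[OF len])
  have mg: "map ?g ds = ds'" by (rule map_lmap[OF len ds(1)])
  have inj: "inj_on ?g (set out)"
    using ds' mg out fG(5) dsG by (intro inj_on_replace[of ds' ?g ds]) (auto simp: label_list_def lmap_other)
  have set: "set out' = set (b' @ ds')"
  proof -
    have "?g ` set ds = set ds'" using mg by (metis set_map)
    moreover have "?g ` set b' = set b'" using dsG(1) fG(5) by (intro lmap_image_other) blast
    ultimately show ?thesis by (simp add: out out' image_Un Un_commute)
  qed
  have "distinct out'" unfolding out' using inj out(1) by (simp add: distinct_map)
  moreover have "distinct bs" using F by (simp add: frame_def)
  moreover have "set bs = set (b @ ds)" using ds(2) b by auto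
  ultimately show frG: "frame (G @ dels ds ds') bs out'" using set by (intro frame_reorder[OF fr1])
  have "lbl F \<inter> lbl (G @ dels ds ds') = set bs"
    using int ds b ds' dsG by (auto simp: expr_labels_dels[OF len])
  then have "compK (cls (G @ dels ds ds') bs out') (cls F as bs) = cls ((F @ G) @ dels ds ds') as out'"
    using comp_cls[OF F frG] by simp
  also have "\<dots> = cls (F @ G) as out"
    unfolding out' using ds ds' out mg by (intro cls_absorb_upper[OF fr]) (auto simp: lmap_other)
  finally show "compK (cls (G @ dels ds ds') bs out') (cls F as bs) = cls (F @ G) as out" .
qed

text \<open>
  The mirror image of the previous lemma: composition with an arrow that acts as \<open>H\<close> on the inputs \<open>a\<close>
  and as plain wires on the remaining inputs \<open>ds\<close>.
\<close>

lemma extend_lower: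
  assumes F: "frame F as cs" and H: "frame H a' a" and int: "lbl H \<inter> lbl F = set a"
    and a: "set a \<subseteq> set as" and ds: "distinct ds" "set ds = set as - set a"
    and ds': "label_list ds'" "set ds' \<inter> (lbl F \<union> lbl H) = {}" "map ty ds = map ty ds'"
    and inn: "distinct inn" "set inn = set ds \<union> set a'" and inn': "inn' = map (lmap ds ds') inn"
  shows "frame (H @ F) inn cs" "frame (H @ dels ds' ds) inn' as"
    "compK (cls F as cs) (cls (H @ dels ds' ds) inn' as) = cls (H @ F) inn cs"
proof -
  note fF = frameD[OF F] and fH = frameD[OF H]
  let ?g = "lmap ds ds'"
  have len: "length ds = length ds'" using ds'(3) by (rule same_types_length)
  show fr: "frame (H @ F) inn cs"
    using F H int a ds inn unfolding frame_def
    by (auto simp: einstein_append free_lower_alt free_upper_alt expr_labels_def)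
  have dsH: "set ds \<inter> lbl H = {}" "set ds \<subseteq> lbl F" using int ds fF(5) by auto
  have "label_list (ds' @ ds)" using ds ds' fF dsH by (auto simp: label_list_def)
  then have "frame (dels ds' ds) ds' ds" using ds'(3)[symmetric] by (rule frame_dels)
  then have fr1: "frame (H @ dels ds' ds) (a' @ ds') (a @ ds)"
    using dsH ds' by (intro frame_tens H) (auto simp: expr_labels_dels[OF len[symmetric]])
  have mg: "map ?g ds = ds'" by (rule map_lmap[OF len ds(1)])
  have inj: "inj_on ?g (set inn)"
    using ds' mg inn fH(5) dsH by (intro inj_on_replace[of ds' ?g ds]) (auto simp: label_list_def lmap_other)
  have set: "set inn' = set (a' @ ds')"
  proof -
    have "?g ` set ds = set ds'" using mg by (metis set_map)
    moreover have "?g ` set a' = set a'" using dsH(1) fH(5) by (intro lmap_image_other) blast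
    ultimately show ?thesis by (simp add: inn inn' image_Un Un_commute)
  qed
  have "distinct inn'" unfolding inn' using inj inn(1) by (simp add: distinct_map)
  moreover have "distinct as" using F by (simp add: frame_def)
  moreover have "set as = set (a @ ds)" using ds(2) a by auto
  ultimately show frH: "frame (H @ dels ds' ds) inn' as" using set by (intro frame_reorder[OF fr1])
  have int': "lbl (H @ dels ds' ds) \<inter> lbl F = set as"
    using int ds a ds' dsH by (auto simp: expr_labels_dels[OF len[symmetric]])
  have "compK (cls F as cs) (cls (H @ dels ds' ds) inn' as) = cls ((H @ dels ds' ds) @ F) inn' cs"
    using comp_cls[OF frH F int'] by simp
  also have "\<dots> = cls ((H @ F) @ dels ds' ds) inn' cs"
    by (intro cls_permute frame_comp[OF frH F int']) simp
  also have "\<dots> = cls (H @ F) inn cs"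
    unfolding inn' using ds ds' inn mg by (intro cls_absorb_lower[OF fr]) (auto simp: lmap_other)
  finally show "compK (cls F as cs) (cls (H @ dels ds' ds) inn' as) = cls (H @ F) inn cs" .
qed

lemma frame_Nil: "frame [] [] []"
  by (simp add: frame_def einstein_def free_lower_def free_upper_def)

lemma ex_copy:
  assumes "label_list d" "finite N"
  shows "\<exists>d'. label_list d' \<and> set d' \<inter> N = {} \<and> map ty d' = map ty d"
  using ex_label_list[OF label_list_types assms(2)] assms(1) by blast

lemma id_after:
  assumes F: "frame F as b"
  shows "compK (idK (map ty b)) (cls F as b) = cls F as b"
proof -
  obtain d' where d': "label_list d'" "set d' \<inter> lbl F = {}" "map ty d' = map ty b"
    using ex_copy[OF frameD(7)[OF F], of "lbl F"] by auto
  have len: "length b = length d'" using d' by (metis length_map)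
  have "label_list (b @ d')" using frameD(7)[OF F] d' frame_sub[OF F] by (auto simp: label_list_append)
  then have "idK (map ty b) = cls (dels b d') b d'" using d' by (intro Ide_cls) auto
  then show ?thesis
    using extend_upper(3)[OF F frame_Nil, of b d' b d'] F d' frameD(7)[OF F] map_lmap[OF len]
    by (auto simp: label_list_def)
qed

lemma id_before:
  assumes F: "frame F a cs"
  shows "compK (cls F a cs) (idK (map ty a)) = cls F a cs"
proof -
  obtain d' where d': "label_list d'" "set d' \<inter> lbl F = {}" "map ty d' = map ty a"
    using ex_copy[OF frameD(6)[OF F], of "lbl F"] by auto
  have len: "length a = length d'" using d' by (metis length_map)
  have "label_list (d' @ a)" using frameD(6)[OF F] d' frame_sub[OF F] by (auto simp: label_list_append)
  then have "idK (map ty d') = cls (dels d' a) d' a" using d' by (intro Ide_cls) auto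
  then show ?thesis
    using extend_lower(3)[OF F frame_Nil, of a d' a d'] F d' frameD(6)[OF F] map_lmap[OF len]
    by (auto simp: label_list_def)
qed

lemma tens_unit_cls:
  assumes "frame F a b"
  shows "tensK (idK []) (cls F a b) = cls F a b" "tensK (cls F a b) (idK []) = cls F a b"
proof -
  have "label_list ([] @ [])" by (simp add: label_list_def)
  from Ide_cls[OF this] have i: "idK [] = cls [] [] []" by simp
  show "tensK (idK []) (cls F a b) = cls F a b" "tensK (cls F a b) (idK []) = cls F a b"
    unfolding i using tens_cls[OF frame_Nil assms] tens_cls[OF assms frame_Nil] by simp_all
qed

lemma ex_copy2:
  assumes "label_list c" "label_list d" "set c \<inter> set d = {}" "finite N"
  shows "\<exists>c' d'. label_list (c' @ d') \<and> set (c' @ d') \<inter> N = {} \<and> map ty c' = map ty c \<and> map ty d' = map ty d"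
proof -
  have "label_list (c @ d)" using assms by (simp add: label_list_append)
  from ex_copy[OF this assms(4)] obtain w where w: "label_list w" "set w \<inter> N = {}" "map ty w = map ty c @ map ty d"
    by auto
  then obtain c' d' where "w = c' @ d'" "map ty c' = map ty c" "map ty d' = map ty d"
    by (auto simp: map_eq_append_conv)
  with w show ?thesis by blast
qed

text \<open>
  Composition with \<open>id \<otimes> g \<otimes> id\<close> is concatenation, as if the identities were absent.
\<close>

lemma whisker_after:
  assumes F: "frame F as (c @ b @ d)" and G: "frame G b b'" and int: "lbl F \<inter> lbl G = set b"
  shows "compK (tensK (idK (map ty c)) (tensK (cls G b b') (idK (map ty d)))) (cls F as (c @ b @ d)) =
      cls (F @ G) as (c @ b' @ d)"
    "frame (F @ G) as (c @ b' @ d)"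
proof -
  have l: "label_list c" "label_list b" "label_list d" "set c \<inter> set b = {}" "set c \<inter> set d = {}" "set b \<inter> set d = {}"
    using frameD(7)[OF F] unfolding label_list_append by auto
  obtain c' d' where *: "label_list (c' @ d')" "set (c' @ d') \<inter> (lbl F \<union> lbl G) = {}"
      "map ty c' = map ty c" "map ty d' = map ty d"
    using ex_copy2[OF l(1,3,5), of "lbl F \<union> lbl G"] by auto
  have len: "length c = length c'" "length d = length d'" using * by (metis length_map)+
  have sub: "set (c @ d) \<subseteq> lbl F" "set (c @ d) \<inter> lbl G = {}" "set b' \<inter> set (c @ d) = {}"
    using frame_sub[OF F] frame_sub[OF G] int l(4,6) by auto
  have cd': "set c' \<inter> set d' = {}" "set (c @ d) \<inter> set (c' @ d') = {}" "label_list c'" "label_list d'"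
    using * sub(1) by (auto simp: label_list_append)
  then have ll: "label_list (c @ c')" "label_list (d @ d')" using l by (auto simp: label_list_append)
  note fc = frame_dels[OF ll(1) *(3)[symmetric]] and fd = frame_dels[OF ll(2) *(4)[symmetric]]
  have d1: "lbl G \<inter> lbl (dels d d') = {}"
    using * sub(2) by (auto simp: expr_labels_dels len)
  note fGd = frame_tens[OF G fd d1]
  have d2: "lbl (dels c c') \<inter> lbl (G @ dels d d') = {}"
    using *(2) sub(2) cd' l(5) by (auto simp: expr_labels_dels len)
  have "tensK (idK (map ty c)) (tensK (cls G b b') (idK (map ty d))) =
      cls (dels c c' @ (G @ dels d d')) (c @ b @ d) (c' @ b' @ d')"
    unfolding Ide_cls[OF ll(1) *(3)[symmetric]] Ide_cls[OF ll(2) *(4)[symmetric]] tens_cls[OF G fd d1]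
    by (rule tens_cls[OF fc fGd d2])
  also have "\<dots> = cls (G @ dels (c @ d) (c' @ d')) (c @ b @ d) (c' @ b' @ d')"
    using len by (intro cls_permute frame_tens[OF fc fGd d2]) simp
  finally have M: "tensK (idK (map ty c)) (tensK (cls G b b') (idK (map ty d))) =
      cls (G @ dels (c @ d) (c' @ d')) (c @ b @ d) (c' @ b' @ d')" .
  have p: "set b \<subseteq> set (c @ b @ d)" "distinct (c @ d)" "set (c @ d) = set (c @ b @ d) - set b"
      "map ty (c @ d) = map ty (c' @ d')" "distinct (c @ b' @ d)" "set (c @ b' @ d) = set (c @ d) \<union> set b'"
    using l sub(3) frameD(7)[OF G] *(3,4) by (auto simp: label_list_def)
  have "map (lmap (c @ d) (c' @ d')) (c @ d) = c' @ d'" using len p(2) by (intro map_lmap) auto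
  moreover have "map (lmap (c @ d) (c' @ d')) b' = b'" using sub(3) by (intro map_idI lmap_other) auto
  ultimately have m: "c' @ b' @ d' = map (lmap (c @ d) (c' @ d')) (c @ b' @ d)" using len by simp
  show "compK (tensK (idK (map ty c)) (tensK (cls G b b') (idK (map ty d)))) (cls F as (c @ b @ d)) =
      cls (F @ G) as (c @ b' @ d)"
    "frame (F @ G) as (c @ b' @ d)"
    unfolding M by (rule extend_upper[OF F G int p(1-3) *(1,2) p(4-6) m])+
qed

lemma whisker_before:
  assumes F: "frame F (c @ a @ d) cs" and H: "frame H a' a" and int: "lbl H \<inter> lbl F = set a"
  shows "compK (cls F (c @ a @ d) cs) (tensK (idK (map ty c)) (tensK (cls H a' a) (idK (map ty d)))) =
      cls (H @ F) (c @ a' @ d) cs"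
    "frame (H @ F) (c @ a' @ d) cs"
proof -
  have l: "label_list c" "label_list a" "label_list d" "set c \<inter> set a = {}" "set c \<inter> set d = {}" "set a \<inter> set d = {}"
    using frameD(6)[OF F] unfolding label_list_append by auto
  obtain c' d' where *: "label_list (c' @ d')" "set (c' @ d') \<inter> (lbl F \<union> lbl H) = {}"
      "map ty c' = map ty c" "map ty d' = map ty d"
    using ex_copy2[OF l(1,3,5), of "lbl F \<union> lbl H"] by auto
  have len: "length c' = length c" "length d' = length d" using * by (metis length_map)+
  have sub: "set (c @ d) \<subseteq> lbl F" "set (c @ d) \<inter> lbl H = {}" "set a' \<inter> set (c @ d) = {}"
    using frame_sub[OF F] frame_sub[OF H] int l(4,6) by auto
  have cd': "set c' \<inter> set d' = {}" "set (c' @ d') \<inter> set (c @ d) = {}" "label_list c'" "label_list d'"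
    using * sub(1) by (auto simp: label_list_append)
  then have ll: "label_list (c' @ c)" "label_list (d' @ d)" using l by (auto simp: label_list_append)
  note fc = frame_dels[OF ll(1) *(3)] and fd = frame_dels[OF ll(2) *(4)]
  have d1: "lbl H \<inter> lbl (dels d' d) = {}"
    using * sub(2) by (auto simp: expr_labels_dels len)
  note fHd = frame_tens[OF H fd d1]
  have d2: "lbl (dels c' c) \<inter> lbl (H @ dels d' d) = {}"
    using *(2) sub(2) cd' l(5) by (auto simp: expr_labels_dels len)
  have "tensK (idK (map ty c')) (tensK (cls H a' a) (idK (map ty d'))) =
      cls (dels c' c @ (H @ dels d' d)) (c' @ a' @ d') (c @ a @ d)"
    unfolding Ide_cls[OF ll(1) *(3)] Ide_cls[OF ll(2) *(4)] tens_cls[OF H fd d1]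
    by (rule tens_cls[OF fc fHd d2])
  also have "\<dots> = cls (H @ dels (c' @ d') (c @ d)) (c' @ a' @ d') (c @ a @ d)"
    using len by (intro cls_permute frame_tens[OF fc fHd d2]) simp
  finally have M: "tensK (idK (map ty c)) (tensK (cls H a' a) (idK (map ty d))) =
      cls (H @ dels (c' @ d') (c @ d)) (c' @ a' @ d') (c @ a @ d)" unfolding *(3,4) .
  have p: "set a \<subseteq> set (c @ a @ d)" "distinct (c @ d)" "set (c @ d) = set (c @ a @ d) - set a"
      "map ty (c @ d) = map ty (c' @ d')" "distinct (c @ a' @ d)" "set (c @ a' @ d) = set (c @ d) \<union> set a'"
    using l sub(3) frameD(6)[OF H] *(3,4) by (auto simp: label_list_def)
  have "map (lmap (c @ d) (c' @ d')) (c @ d) = c' @ d'" using len p(2) by (intro map_lmap) auto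
  moreover have "map (lmap (c @ d) (c' @ d')) a' = a'" using sub(3) by (intro map_idI lmap_other) auto
  ultimately have m: "c' @ a' @ d' = map (lmap (c @ d) (c' @ d')) (c @ a' @ d)" using len by simp
  show "compK (cls F (c @ a @ d) cs) (tensK (idK (map ty c)) (tensK (cls H a' a) (idK (map ty d)))) =
      cls (H @ F) (c @ a' @ d) cs"
    "frame (H @ F) (c @ a' @ d) cs"
    unfolding M by (rule extend_lower[OF F H int p(1-3) *(1,2) p(4-6) m])+
qed

definition block_swap :: "'u list \<Rightarrow> 'u list \<Rightarrow> 'u list \<Rightarrow> 'u list \<Rightarrow> ('s, 'l) expr set" where
  "block_swap R A B Q = tensK (idK R) (tensK (symmK A B) (idK Q))"

text \<open>
  Composition with a symmetry in the middle of the outputs permutes the list of outputs and leaves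
  the expression alone.
\<close>

lemma swap_after:
  assumes F: "frame F as (r @ a @ b @ q)"
  shows "compK (block_swap (map ty r) (map ty a) (map ty b) (map ty q)) (cls F as (r @ a @ b @ q)) =
      cls F as (r @ b @ a @ q)"
    "frame F as (r @ b @ a @ q)"
proof -
  have l: "label_list (a @ b)" "label_list a" "label_list b" "set a \<inter> set b = {}"
      "(set a \<union> set b) \<inter> (set r \<union> set q) = {}"
    using frameD(7)[OF F] unfolding label_list_append by auto
  show f': "frame F as (r @ b @ a @ q)"
    using frameD(7)[OF F] by (intro frame_reorder[OF F]) (auto simp: label_list_def frameD(6)[OF F, unfolded label_list_def])
  obtain a' b' where *: "label_list (a' @ b')" "set (a' @ b') \<inter> lbl F = {}" "map ty a' = map ty a" "map ty b' = map ty b"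
    using ex_copy2[OF l(2,3,4), of "lbl F"] by auto
  have len: "length a = length a'" "length b = length b'" using * by (metis length_map)+
  let ?G = "dels (a @ b) (a' @ b')" and ?g = "lmap (a @ b) (a' @ b')"
  have m: "map ?g (a @ b) = a' @ b'" using l(1) len by (intro map_lmap) (auto simp: label_list_def)
  have abF: "set (a @ b) \<subseteq> lbl F" using frame_sub[OF F] by auto
  have ll: "label_list ((a @ b) @ (a' @ b'))"
    unfolding label_list_append[of "a @ b" "a' @ b'"] using l(1) *(1,2) abF by blast
  have "lbl ?G = set (a @ b) \<union> set (a' @ b')" using len by (intro expr_labels_dels) simp
  then have int: "lbl F \<inter> lbl ?G = set (a @ b)" using *(2) abF by blast
  have "compK (block_swap (map ty r) (map ty a) (map ty b) (map ty q)) (cls F as (r @ (a @ b) @ q)) =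
      cls (F @ ?G) as (r @ (b' @ a') @ q)"
    unfolding block_swap_def symm_cls[OF ll *(3,4)[symmetric]]
    using F by (intro whisker_after(1) frame_symm[OF ll *(3,4)[symmetric]] int) simp
  also have "r @ (b' @ a') @ q = map ?g (r @ b @ a @ q)"
  proof -
    have "map ?g a = a'" "map ?g b = b'" using m len by auto
    moreover have "map ?g r = r" "map ?g q = q" using l(5) by (auto intro!: map_idI lmap_other)
    ultimately show ?thesis by simp
  qed
  also have "cls (F @ ?G) as \<dots> = cls F as (r @ b @ a @ q)"
    using l(1) *(3,4) by (intro cls_absorb_upper[OF f' _ _ *(1,2) _ m]) (auto simp: label_list_def lmap_other)
  finally show "compK (block_swap (map ty r) (map ty a) (map ty b) (map ty q)) (cls F as (r @ a @ b @ q)) =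
      cls F as (r @ b @ a @ q)" by simp
qed

lemma swap_before:
  assumes F: "frame F (r @ b @ a @ q) cs"
  shows "compK (cls F (r @ b @ a @ q) cs) (block_swap (map ty r) (map ty a) (map ty b) (map ty q)) =
      cls F (r @ a @ b @ q) cs"
    "frame F (r @ a @ b @ q) cs"
proof -
  have l: "label_list (a @ b)" "label_list a" "label_list b" "set a \<inter> set b = {}"
      "(set a \<union> set b) \<inter> (set r \<union> set q) = {}"
    using frameD(6)[OF F] unfolding label_list_append by auto
  show f': "frame F (r @ a @ b @ q) cs"
    using frameD(6)[OF F] by (intro frame_reorder[OF F]) (auto simp: label_list_def frameD(7)[OF F, unfolded label_list_def])
  obtain a' b' where *: "label_list (a' @ b')" "set (a' @ b') \<inter> lbl F = {}" "map ty a' = map ty a" "map ty b' = map ty b"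
    using ex_copy2[OF l(2,3,4), of "lbl F"] by auto
  have len: "length a = length a'" "length b = length b'" using * by (metis length_map)+
  let ?H = "dels (a' @ b') (a @ b)" and ?g = "lmap (a @ b) (a' @ b')"
  have m: "map ?g (a @ b) = a' @ b'" using l(1) len by (intro map_lmap) (auto simp: label_list_def)
  have abF: "set (a @ b) \<subseteq> lbl F" using frame_sub[OF F] by auto
  have ll: "label_list ((a' @ b') @ (a @ b))"
    unfolding label_list_append[of "a' @ b'" "a @ b"] using l(1) *(1,2) abF by blast
  note fH = frame_symm[OF ll *(3,4)]
  have "lbl ?H = set (a' @ b') \<union> set (a @ b)" using len by (intro expr_labels_dels) simp
  then have int: "lbl ?H \<inter> lbl F = set (b @ a)" using *(2) abF by auto
  have F': "frame F (r @ (b @ a) @ q) cs" using F by simp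
  note w = whisker_before[OF F' fH int]
  have "compK (cls F (r @ (b @ a) @ q) cs) (block_swap (map ty r) (map ty a') (map ty b') (map ty q)) =
      cls (?H @ F) (r @ (a' @ b') @ q) cs"
    unfolding block_swap_def symm_cls[OF ll *(3,4)] by (rule w(1))
  also have "\<dots> = cls (F @ ?H) (r @ (a' @ b') @ q) cs" by (intro cls_permute w(2)) simp
  also have "r @ (a' @ b') @ q = map ?g (r @ a @ b @ q)"
  proof -
    have "map ?g r = r" "map ?g q = q" using l(5) by (auto intro!: map_idI lmap_other)
    then show ?thesis using m by simp
  qed
  also have "cls (F @ ?H) \<dots> cs = cls F (r @ a @ b @ q) cs"
    using l(1) *(3,4) by (intro cls_absorb_lower[OF f' _ _ *(1,2) _ m]) (auto simp: label_list_def lmap_other)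
  finally show "compK (cls F (r @ b @ a @ q) cs) (block_swap (map ty r) (map ty a) (map ty b) (map ty q)) =
      cls F (r @ a @ b @ q) cs" using * by simp
qed

lemma block_swap_symm:
  assumes "A \<in> tylists" "B \<in> tylists"
  shows "block_swap [] A B [] = symmK A B"
proof -
  have AB: "A @ B \<in> tylists" using assms by simp
  from ex_label_list[OF AB, of "{}"] obtain w where w: "label_list w" "map ty w = A @ B" by auto
  then obtain a b where ab: "w = a @ b" "map ty a = A" "map ty b = B" by (auto simp: map_eq_append_conv)
  have l: "label_list a" "label_list b" "set a \<inter> set b = {}" using w ab by (auto simp: label_list_append)
  from ex_copy2[OF l, of "set w"] obtain a' b' where *: "label_list (a' @ b')" "set (a' @ b') \<inter> set w = {}"
    "map ty a' = map ty a" "map ty b' = map ty b" by auto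
  have ll: "label_list ((a @ b) @ (a' @ b'))"
    unfolding label_list_append[of "a @ b" "a' @ b'"] using w(1) ab(1) *(1,2) by blast
  note s = symm_cls[OF ll *(3,4)[symmetric]] and f = frame_symm[OF ll *(3,4)[symmetric]]
  show ?thesis unfolding block_swap_def ab(2,3)[symmetric] s by (simp only: tens_unit_cls[OF f])
qed

lemma symm_after:
  assumes F: "frame F as (a @ b)"
  shows "compK (symmK (map ty a) (map ty b)) (cls F as (a @ b)) = cls F as (b @ a)"
    "frame F as (b @ a)"
proof -
  have "label_list a" "label_list b" using frameD(7)[OF F] unfolding label_list_append by blast+
  note t = this[THEN label_list_types]
  show "compK (symmK (map ty a) (map ty b)) (cls F as (a @ b)) = cls F as (b @ a)"
    "frame F as (b @ a)"
    using swap_after[of F as "[]" a b "[]"] F t by (simp_all add: block_swap_symm)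
qed

lemma symm_before:
  assumes F: "frame F (b @ a) cs"
  shows "compK (cls F (b @ a) cs) (symmK (map ty a) (map ty b)) = cls F (a @ b) cs"
proof -
  have "label_list a" "label_list b" using frameD(6)[OF F] unfolding label_list_append by blast+
  note t = this[THEN label_list_types]
  show ?thesis using swap_before(1)[of F "[]" b a "[]" cs] F t by (simp add: block_swap_symm)
qed

end

section \<open>The axioms of a strict traced symmetric monoidal category\<close>

context free_tensor_system begin

lemma Hom_types: "f \<in> Hom K X Y \<Longrightarrow> X \<in> tylists \<and> Y \<in> tylists"
  by (simp add: Hom_K)

lemma represent:
  assumes "f \<in> Hom K X Y" "finite N"
  shows "\<exists>F a b. frame F a b \<and> f = cls F a b \<and> map ty a = X \<and> map ty b = Y \<and> lbl F \<inter> N = {}"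
proof -
  obtain a where a: "label_list a" "set a \<inter> N = {}" "map ty a = X"
    using ex_label_list[OF _ assms(2)] Hom_types[OF assms(1)] by blast
  obtain b where b: "label_list b" "set b \<inter> (N \<union> set a) = {}" "map ty b = Y"
    using ex_label_list[of Y "N \<union> set a"] Hom_types[OF assms(1)] assms(2) by auto
  have "label_list (a @ b)" using a b by (auto simp: label_list_append)
  then obtain F where F: "frame F a b" "bound F \<inter> N = {}" "f = cls F a b"
    using Hom_cls[OF assms(1) _ a(3) b(3) assms(2)] by blast
  have "lbl F \<inter> N = {}" using F(2) a(2) b(2) unfolding frameD(5)[OF F(1)] by blast
  with F a b show ?thesis by blast
qed

text \<open>
  An arrow to be composed after one that is already represented takes its lower labels from there;
  all other labels avoid \<open>N\<close>, the labels in use.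
\<close>

lemma represent_after:
  assumes "f \<in> Hom K (map ty a) Y" "label_list a" "finite N"
  shows "\<exists>F b. frame F a b \<and> f = cls F a b \<and> map ty b = Y \<and> lbl F \<inter> N \<subseteq> set a \<and> set b \<inter> N = {}"
proof -
  obtain b where b: "label_list b" "set b \<inter> (N \<union> set a) = {}" "map ty b = Y"
    using ex_label_list[of Y "N \<union> set a"] Hom_types[OF assms(1)] assms(3) by auto
  have "label_list (a @ b)" using assms b by (auto simp: label_list_append)
  then obtain F where F: "frame F a b" "bound F \<inter> N = {}" "f = cls F a b"
    using Hom_cls[OF assms(1) _ HOL.refl b(3) assms(3)] by blast
  have "lbl F \<inter> N \<subseteq> set a" using F(2) b(2) unfolding frameD(5)[OF F(1)] by blast
  with F b show ?thesis by blast
qed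

lemma represent_before:
  assumes "f \<in> Hom K X (map ty b)" "label_list b" "finite N"
  shows "\<exists>F a. frame F a b \<and> f = cls F a b \<and> map ty a = X \<and> lbl F \<inter> N \<subseteq> set b \<and> set a \<inter> N = {}"
proof -
  obtain a where a: "label_list a" "set a \<inter> (N \<union> set b) = {}" "map ty a = X"
    using ex_label_list[of X "N \<union> set b"] Hom_types[OF assms(1)] assms(3) by auto
  have "label_list (a @ b)" using assms a by (auto simp: label_list_append)
  then obtain F where F: "frame F a b" "bound F \<inter> N = {}" "f = cls F a b"
    using Hom_cls[OF assms(1) _ a(3) HOL.refl assms(3)] by blast
  have "lbl F \<inter> N \<subseteq> set b" using F(2) a(2) unfolding frameD(5)[OF F(1)] by blast
  with F a show ?thesis by blast
qed

lemma joint: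
  assumes "frame F a b" "frame G b d" "lbl G \<inter> lbl F \<subseteq> set b"
  shows "lbl F \<inter> lbl G = set b"
  using assms frame_sub[OF assms(1)] frame_sub[OF assms(2)] by blast

lemma Comp_Hom_K:
  assumes "f \<in> Hom K A B" "g \<in> Hom K B D"
  shows "compK g f \<in> Hom K A D"
proof -
  obtain F a b where F: "frame F a b" "f = cls F a b" "map ty a = A" "map ty b = B"
    using represent[OF assms(1), of "{}"] by auto
  have g: "g \<in> Hom K (map ty b) D" using assms(2) F by simp
  obtain G d where G: "frame G b d" "g = cls G b d" "map ty d = D" "lbl G \<inter> lbl F \<subseteq> set b"
    using represent_after[OF g frameD(7)[OF F(1)], of "lbl F"] by auto
  note j = joint[OF F(1) G(1,4)]
  show ?thesis
    using comp_cls[OF F(1) G(1) j] cls_Hom[OF frame_comp[OF F(1) G(1) j]] F G by simp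
qed

lemma Comp_assoc_K:
  assumes "f \<in> Hom K A B" "g \<in> Hom K B D" "h \<in> Hom K D E"
  shows "compK h (compK g f) = compK (compK h g) f"
proof -
  obtain F a b where F: "frame F a b" "f = cls F a b" "map ty a = A" "map ty b = B"
    using represent[OF assms(1), of "{}"] by auto
  have g: "g \<in> Hom K (map ty b) D" using assms(2) F by simp
  obtain G d where G: "frame G b d" "g = cls G b d" "map ty d = D" "lbl G \<inter> lbl F \<subseteq> set b"
      "set d \<inter> lbl F = {}"
    using represent_after[OF g frameD(7)[OF F(1)], of "lbl F"] by auto
  have h: "h \<in> Hom K (map ty d) E" using assms(3) G by simp
  obtain H e where H: "frame H d e" "h = cls H d e" "map ty e = E" 
     "lbl H \<inter> (lbl F \<union> lbl G) \<subseteq> set d"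
    using represent_after[OF h frameD(7)[OF G(1)], of "lbl F \<union> lbl G"] by auto
  have j1: "lbl F \<inter> lbl G = set b" by (rule joint[OF F(1) G(1,4)])
  have j2: "lbl G \<inter> lbl H = set d" using H(4) by (intro joint[OF G(1) H(1)]) blast
  note f1 = frame_comp[OF F(1) G(1) j1] and f2 = frame_comp[OF G(1) H(1) j2]
  have j3: "lbl (F @ G) \<inter> lbl H = set d" using H(4) by (intro joint[OF f1 H(1)]) auto
  have "lbl (G @ H) \<inter> lbl F \<subseteq> set b" using H(4) G(4,5) by auto
  then have j4: "lbl F \<inter> lbl (G @ H) = set b" by (intro joint[OF F(1) f2])
  show ?thesis
    unfolding F(2) G(2) H(2) comp_cls[OF F(1) G(1) j1] comp_cls[OF G(1) H(1) j2]
      comp_cls[OF f1 H(1) j3] comp_cls[OF F(1) f2 j4] by simp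
qed

lemma Ide_Hom_K: "A \<in> tylists \<Longrightarrow> idK A \<in> Hom K A A"
proof -
  assume A: "A \<in> tylists"
  obtain a where a: "label_list a" "map ty a = A" using ex_label_list[OF A, of "{}"] by auto
  obtain b where b: "label_list b" "map ty b = A" "set b \<inter> set a = {}" using ex_label_list[OF A, of "set a"] by auto
  have "label_list (a @ b)" using a b by (auto simp: label_list_append)
  then show ?thesis using Ide_cls[of a b] cls_Hom[OF frame_dels[of a b]] a b by simp
qed

lemma Comp_Ide_K:
  assumes "f \<in> Hom K A B"
  shows "compK f (idK A) = f" "compK (idK B) f = f"
proof -
  obtain F a b where F: "frame F a b" "f = cls F a b" "map ty a = A" "map ty b = B"
    using represent[OF assms(1), of "{}"] by auto
  then show "compK f (idK A) = f" "compK (idK B) f = f"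
    using id_before[OF F(1)] id_after[OF F(1)] by auto
qed

lemma represent_disjoint:
  assumes "f \<in> Hom K A B" "g \<in> Hom K A' B'"
  shows "\<exists>F a b G a' b'. frame F a b \<and> f = cls F a b \<and> map ty a = A \<and> map ty b = B \<and> 
    frame G a' b' \<and> g = cls G a' b' \<and> map ty a' = A' \<and> map ty b' = B' \<and> lbl F \<inter> lbl G = {}"
proof -
  obtain F a b where F: "frame F a b" "f = cls F a b" "map ty a = A" "map ty b = B"
    using represent[OF assms(1), of "{}"] by auto
  obtain G a' b' where G: "frame G a' b'" "g = cls G a' b'" "map ty a' = A'" "map ty b' = B'" 
     "lbl G \<inter> lbl F = {}"
    using represent[OF assms(2), of "lbl F"] by auto
  from F G show ?thesis by blast
qed

lemma ATens_Hom_K: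
  assumes "f \<in> Hom K A B" "g \<in> Hom K A' B'"
  shows "tensK f g \<in> Hom K (A @ A') (B @ B')"
proof -
  from represent_disjoint[OF assms] obtain F a b G a' b' where *: "frame F a b" "f = cls F a b" 
    "map ty a = A" "map ty b = B" "frame G a' b'" "g = cls G a' b'" "map ty a' = A'" "map ty b' = B'" 
    "lbl F \<inter> lbl G = {}" by blast
  then show ?thesis
    using tens_cls[OF *(1,5,9)] cls_Hom[OF frame_tens[OF *(1,5,9)]] by simp
qed

lemma ATens_Ide_K:
  assumes "A \<in> tylists" "B \<in> tylists"
  shows "tensK (idK A) (idK B) = idK (A @ B)"
proof -
  obtain a where a: "label_list a" "map ty a = A" using ex_label_list[OF assms(1), of "{}"] by auto
  obtain a' where a': "label_list a'" "map ty a' = A" "set a' \<inter> set a = {}" 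
    using ex_label_list[OF assms(1), of "set a"] by auto
  obtain b where b: "label_list b" "map ty b = B" "set b \<inter> (set a \<union> set a') = {}"
    using ex_label_list[OF assms(2), of "set a \<union> set a'"] by auto
  obtain b' where b': "label_list b'" "map ty b' = B" "set b' \<inter> (set a \<union> set a' \<union> set b) = {}" 
    using ex_label_list[OF assms(2), of "set a \<union> set a' \<union> set b"] by auto
  have len: "length a = length a'" "length b = length b'" using a a' b b' by (metis length_map)+
  have l: "label_list (a @ a')" "label_list (b @ b')" "label_list ((a @ b) @ (a' @ b'))"
    using a a' b b' by (auto simp: label_list_append)
  have "tensK (cls (dels a a') a a') (cls (dels b b') b b') = cls (dels a a' @ dels b b') (a @ b) (a' @ b')"
    using a a' b b' l by (intro tens_cls frame_dels) (auto simp: expr_labels_dels len)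
  then show ?thesis
    using Ide_cls[OF l(1)] Ide_cls[OF l(2)] Ide_cls[OF l(3)] a a' b b' len by simp
qed

lemma ATens_Comp_K:
  assumes "f \<in> Hom K A B" "g \<in> Hom K B D" "f' \<in> Hom K A' B'" "g' \<in> Hom K B' D'"
  shows "tensK (compK g f) (compK g' f') = compK (tensK g g') (tensK f f')"
proof -
  obtain F a b where F: "frame F a b" "f = cls F a b" "map ty a = A" "map ty b = B"
    using represent[OF assms(1), of "{}"] by auto
  have g: "g \<in> Hom K (map ty b) D" using assms(2) F by simp
  obtain G d where G: "frame G b d" "g = cls G b d" "map ty d = D" "lbl G \<inter> lbl F \<subseteq> set b"
    using represent_after[OF g frameD(7)[OF F(1)], of "lbl F"] by auto
  obtain F' a' b' where F': "frame F' a' b'" "f' = cls F' a' b'" "map ty a' = A'" "map ty b' = B'" 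
     "lbl F' \<inter> (lbl F \<union> lbl G) = {}"
    using represent[OF assms(3), of "lbl F \<union> lbl G"] by auto
  have g': "g' \<in> Hom K (map ty b') D'" using assms(4) F' by simp
  obtain G' d' where G': "frame G' b' d'" "g' = cls G' b' d'" "map ty d' = D'" 
     "lbl G' \<inter> (lbl F \<union> lbl G \<union> lbl F') \<subseteq> set b'"
    using represent_after[OF g' frameD(7)[OF F'(1)], of "lbl F \<union> lbl G \<union> lbl F'"] by auto
  have b': "set b' \<subseteq> lbl F'" using frame_sub[OF F'(1)] by blast
  have dG': "lbl G' \<inter> (lbl F \<union> lbl G) = {}" using G'(4) b' F'(5) by blast
  have j: "lbl F \<inter> lbl G = set b" by (rule joint[OF F(1) G(1,4)])
  have j': "lbl F' \<inter> lbl G' = set b'" using G'(4) by (intro joint[OF F'(1) G'(1)]) blast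
  note fr = frame_comp[OF F(1) G(1) j] and fr' = frame_comp[OF F'(1) G'(1) j']
  have d: "lbl F \<inter> lbl F' = {}" "lbl G \<inter> lbl G' = {}" 
    "lbl (F @ G) \<inter> lbl (F' @ G') = {}" 
    unfolding expr_labels_append using F'(5) dG' by blast+
  have t1: "frame (F @ F') (a @ a') (b @ b')" "frame (G @ G') (b @ b') (d @ d')"
    using frame_tens[OF F(1) F'(1) d(1)] frame_tens[OF G(1) G'(1) d(2)] .
  have jj: "lbl (F @ F') \<inter> lbl (G @ G') = set (b @ b')"
    unfolding expr_labels_append set_append using F'(5) dG' j j' by blast
  have "tensK (compK g f) (compK g' f') = cls ((F @ G) @ (F' @ G')) (a @ a') (d @ d')"
    unfolding F(2) G(2) F'(2) G'(2) comp_cls[OF F(1) G(1) j] comp_cls[OF F'(1) G'(1) j'] 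
    by (rule tens_cls[OF fr fr' d(3)])
  also have "\<dots> = cls ((F @ F') @ (G @ G')) (a @ a') (d @ d')"
    by (intro cls_permute frame_tens[OF fr fr' d(3)]) simp
  also have "\<dots> = compK (tensK g g') (tensK f f')"
    unfolding F(2) G(2) F'(2) G'(2) tens_cls[OF F(1) F'(1) d(1)] tens_cls[OF G(1) G'(1) d(2)]
    by (rule comp_cls[OF t1 jj, symmetric])
  finally show ?thesis .
qed

lemma ATens_assoc_K:
  assumes "f \<in> Hom K A B" "g \<in> Hom K A' B'" "h \<in> Hom K A'' B''"
  shows "tensK (tensK f g) h = tensK f (tensK g h)"
proof -
  obtain F a b where F: "frame F a b" "f = cls F a b" 
    using represent[OF assms(1), of "{}"] by auto
  obtain G a' b' where G: "frame G a' b'" "g = cls G a' b'" "lbl G \<inter> lbl F = {}"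
    using represent[OF assms(2), of "lbl F"] by auto
  obtain H a'' b'' where H: "frame H a'' b''" "h = cls H a'' b''" "lbl H \<inter> (lbl F \<union> lbl G) = {}"
    using represent[OF assms(3), of "lbl F \<union> lbl G"] by auto
  have d: "lbl F \<inter> lbl G = {}" "lbl G \<inter> lbl H = {}"
     "lbl (F @ G) \<inter> lbl H = {}" "lbl F \<inter> lbl (G @ H) = {}"
    unfolding expr_labels_append using G(3) H(3) by blast+
  show ?thesis
    unfolding F(2) G(2) H(2) tens_cls[OF F(1) G(1) d(1)] tens_cls[OF G(1) H(1) d(2)] 
     tens_cls[OF frame_tens[OF F(1) G(1) d(1)] H(1) d(3)] tens_cls[OF F(1) frame_tens[OF G(1) H(1) d(2)] d(4)] by simp
qed

lemma ATens_Unit_K: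
  assumes "f \<in> Hom K A B"
  shows "tensK (idK []) f = f" "tensK f (idK []) = f"
  using represent[OF assms, of "{}"] tens_unit_cls by auto

lemma map_eq_append4:
  "map f w = A @ B @ C @ D \<Longrightarrow> \<exists>a b c d. w = a @ b @ c @ d \<and> map f a = A \<and> map f b = B \<and> map f c = C \<and> map f d = D"
proof -
  have split: "\<exists>us vs. w = us @ vs \<and> map f us = A \<and> map f vs = B" if "map f w = A @ B" for w A B
    using that by (auto simp: map_eq_append_conv)
  assume "map f w = A @ B @ C @ D"
  from split[OF this] obtain a w1 where 1: "w = a @ w1" "map f a = A" "map f w1 = B @ C @ D" by blast
  from split[OF 1(3)] obtain b w2 where 2: "w1 = b @ w2" "map f b = B" "map f w2 = C @ D" by blast
  from split[OF 2(3)] obtain c d where 3: "w2 = c @ d" "map f c = C" "map f d = D" by blast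
  show ?thesis using 1 2 3 by blast
qed

lemma symm_represent:
  assumes "A \<in> tylists" "B \<in> tylists" "finite N"
  shows "\<exists>a b a' b'. label_list ((a @ b) @ (a' @ b')) \<and> map ty a = A \<and> map ty b = B \<and> map ty a' = A \<and> map ty b' = B \<and>
    symmK A B = cls (dels (a @ b) (a' @ b')) (a @ b) (b' @ a') \<and> set (a @ b @ a' @ b') \<inter> N = {}"
proof -
  have "A @ B @ A @ B \<in> tylists" using assms by simp
  from ex_label_list[OF this assms(3)] obtain w where w: "label_list w" "set w \<inter> N = {}" "map ty w = A @ B @ A @ B" by blast
  then obtain a b a' b' where ab: "w = a @ b @ a' @ b'" "map ty a = A" "map ty b = B" "map ty a' = A" "map ty b' = B"
    using map_eq_append4[OF w(3)] by blast
  have l: "label_list ((a @ b) @ (a' @ b'))" using w(1) ab(1) by simp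
  then show ?thesis using symm_cls[OF l] ab w(2) by (intro exI[of _ a] exI[of _ b] exI[of _ a'] exI[of _ b']) simp
qed

lemma Symm_Hom_K:
  assumes "A \<in> tylists" "B \<in> tylists"
  shows "symmK A B \<in> Hom K (A @ B) (B @ A)"
proof -
  from symm_represent[OF assms, of "{}"] obtain a b a' b' where
    l: "label_list ((a @ b) @ (a' @ b'))" and t: "map ty a = A" "map ty b = B" "map ty a' = A" "map ty b' = B" and
    s: "symmK A B = cls (dels (a @ b) (a' @ b')) (a @ b) (b' @ a')" by auto
  show ?thesis using cls_Hom[OF frame_symm[OF l]] t unfolding s by simp
qed

lemma Symm_natural_K:
  assumes "f \<in> Hom K A A'" "g \<in> Hom K B B'"
  shows "compK (symmK A' B') (tensK f g) = compK (tensK g f) (symmK A B)"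
proof -
  from represent_disjoint[OF assms] obtain F a a' G b b' where F: "frame F a a'" "f = cls F a a'" 
    "map ty a = A" "map ty a' = A'" and G: "frame G b b'" "g = cls G b b'" "map ty b = B" "map ty b' = B'" 
    and d: "lbl F \<inter> lbl G = {}" by blast
  have d': "lbl G \<inter> lbl F = {}" using d by blast
  note fg = frame_tens[OF F(1) G(1) d] and gf = frame_tens[OF G(1) F(1) d']
  have "compK (symmK A' B') (tensK f g) = cls (F @ G) (a @ b) (b' @ a')"
    using symm_after(1)[OF fg] tens_cls[OF F(1) G(1) d] F G by simp
  also have "\<dots> = cls (G @ F) (a @ b) (b' @ a')"
    by (intro cls_permute symm_after(2)[OF fg]) simp
  also have "\<dots> = compK (tensK g f) (symmK A B)"
    using symm_before(1)[OF gf] tens_cls[OF G(1) F(1) d'] F G by simp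
  finally show ?thesis .
qed

lemma Symm_Symm_K:
  assumes "A \<in> tylists" "B \<in> tylists"
  shows "compK (symmK B A) (symmK A B) = idK (A @ B)"
proof -
  from symm_represent[OF assms, of "{}"] obtain a b a' b' where
    l: "label_list ((a @ b) @ (a' @ b'))" and t: "map ty a = A" "map ty b = B" "map ty a' = A" "map ty b' = B" and
    s: "symmK A B = cls (dels (a @ b) (a' @ b')) (a @ b) (b' @ a')" by auto
  show ?thesis using symm_after(1)[OF frame_symm[OF l]] Ide_cls[OF l] t unfolding s by simp
qed

text \<open>
  Both sides are obtained from a list of plain wires: composing with the two symmetries reorders its outputs twice, and
  the result is the list of outputs of the left-hand side.
\<close>

lemma Symm_OTens_K:
  assumes "A \<in> tylists" "B \<in> tylists" "D \<in> tylists"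
  shows "symmK A (B @ D) = compK (tensK (idK B) (symmK A D)) (tensK (symmK A B) (idK D))"
proof -
  have BD: "B @ D \<in> tylists" using assms by simp
  from symm_represent[OF assms(1) BD, of "{}"] obtain a bd a' bd' where
    l: "label_list ((a @ bd) @ (a' @ bd'))" and t: "map ty a = A" "map ty bd = B @ D" "map ty a' = A" "map ty bd' = B @ D" and
    s: "symmK A (B @ D) = cls (dels (a @ bd) (a' @ bd')) (a @ bd) (bd' @ a')" by auto
  obtain b' d' where bd': "bd' = b' @ d'" "map ty b' = B" "map ty d' = D"
    using t(4) by (auto simp: map_eq_append_conv)
  let ?E = "dels (a @ bd) (a' @ bd')" and ?T = "tensK (symmK A B) (idK D)"
  have tt: "map ty (a @ bd) = map ty (a' @ bd')" using t by simp
  have f: "frame ?E (a @ bd) ([] @ a' @ b' @ d')" using frame_dels[OF l tt] bd' by simp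
  have i: "idK (A @ B @ D) = cls ?E (a @ bd) ([] @ a' @ b' @ d')" using Ide_cls[OF l tt] t bd' by simp
  have T: "?T \<in> Hom K (A @ B @ D) (B @ A @ D)"
    using ATens_Hom_K[OF Symm_Hom_K[OF assms(1,2)] Ide_Hom_K[OF assms(3)]] by simp
  have "?T = compK (block_swap [] A B D) (idK (A @ B @ D))"
    unfolding block_swap_def ATens_Unit_K(1)[OF T] by (rule Comp_Ide_K(1)[OF T, symmetric])
  also have "\<dots> = cls ?E (a @ bd) ([] @ b' @ a' @ d')"
    unfolding i using swap_after(1)[OF f] t bd' by simp
  finally have T': "?T = cls ?E (a @ bd) (b' @ a' @ d' @ [])" by simp
  have f2: "frame ?E (a @ bd) (b' @ a' @ d' @ [])" using swap_after(2)[OF f] by simp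
  have "tensK (idK B) (symmK A D) = block_swap B A D []"
    unfolding block_swap_def using ATens_Unit_K(2)[OF Symm_Hom_K[OF assms(1,3)]] by simp
  then have "compK (tensK (idK B) (symmK A D)) ?T = cls ?E (a @ bd) (b' @ d' @ a' @ [])"
    unfolding T' using swap_after(1)[OF f2] t bd' by simp
  then show ?thesis using s bd' by simp
qed

lemma whisker_right_after:
  assumes "frame F as (b @ d)" "frame G b b'" "lbl F \<inter> lbl G = set b"
  shows "compK (tensK (cls G b b') (idK (map ty d))) (cls F as (b @ d)) = cls (F @ G) as (b' @ d)"
    "frame (F @ G) as (b' @ d)"
  using whisker_after[of F as "[]" b d G b'] assms ATens_Unit_K(1)[OF ATens_Hom_K[OF cls_Hom Ide_Hom_K]]
    label_list_types frameD(7)[OF assms(1)] by (simp_all add: label_list_append)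

lemma whisker_left_after:
  assumes "frame F as (d @ b)" "frame G b b'" "lbl F \<inter> lbl G = set b"
  shows "compK (tensK (idK (map ty d)) (cls G b b')) (cls F as (d @ b)) = cls (F @ G) as (d @ b')"
    "frame (F @ G) as (d @ b')"
  using whisker_after[of F as d b "[]" G b'] assms tens_unit_cls(2)[OF assms(2)] by simp_all

lemma whisker_right_before:
  assumes "frame F (a @ d) cs" "frame H a' a" "lbl H \<inter> lbl F = set a"
  shows "compK (cls F (a @ d) cs) (tensK (cls H a' a) (idK (map ty d))) = cls (H @ F) (a' @ d) cs"
    "frame (H @ F) (a' @ d) cs"
  using whisker_before[of F "[]" a d cs H a'] assms ATens_Unit_K(1)[OF ATens_Hom_K[OF cls_Hom Ide_Hom_K]]
    label_list_types frameD(6)[OF assms(1)] by (simp_all add: label_list_append)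

lemma whisker_left_before:
  assumes "frame F (d @ a) cs" "frame H a' a" "lbl H \<inter> lbl F = set a"
  shows "compK (cls F (d @ a) cs) (tensK (idK (map ty d)) (cls H a' a)) = cls (H @ F) (d @ a') cs"
    "frame (H @ F) (d @ a') cs"
  using whisker_before[of F d a "[]" cs H a'] assms tens_unit_cls(2)[OF assms(2)] by simp_all

lemma trace_represent:
  assumes "f \<in> Hom K (A @ X) (B @ Y)" "finite N"
  shows "\<exists>F a x b y. frame F (a @ x) (b @ y) \<and> f = cls F (a @ x) (b @ y) \<and> map ty a = A \<and> map ty x = X \<and>
    map ty b = B \<and> map ty y = Y \<and> lbl F \<inter> N = {}"
proof -
  obtain F ax bx where F: "frame F ax bx" "f = cls F ax bx" "map ty ax = A @ X" "map ty bx = B @ Y" "lbl F \<inter> N = {}"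
    using represent[OF assms] by auto
  then obtain a x b y where "ax = a @ x" "map ty a = A" "map ty x = X" "bx = b @ y" "map ty b = B" "map ty y = Y"
    by (auto simp: map_eq_append_conv)
  with F show ?thesis by blast
qed

lemma trace_lmap:
  assumes f: "frame F (a @ x) (b @ y)" and ty: "map ty x = map ty y"
  shows "trK (map ty a) (map ty b) (map ty x) (cls F (a @ x) (b @ y)) = cls (emap id (lmap y x) F) a b"
    "frame (emap id (lmap y x) F) a b" "lbl (emap id (lmap y x) F) \<subseteq> lbl F"
proof -
  have "distinct y" using frameD(7)[OF f] by (simp add: label_list_def)
  then have g: "map (lmap y x) y = x" using same_types_length[OF ty] by (intro map_lmap) auto
  have o: "lmap y x c = c" if "c \<in> set (upper F) - set y" for c using that by (simp add: lmap_other)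
  show "trK (map ty a) (map ty b) (map ty x) (cls F (a @ x) (b @ y)) = cls (emap id (lmap y x) F) a b"
    "frame (emap id (lmap y x) F) a b" "lbl (emap id (lmap y x) F) \<subseteq> lbl F"
    using trace_cls[OF f ty g o] frame_trace[OF f ty g o] by auto
qed

lemma emap_lmap_other: "set y \<inter> lbl E = {} \<Longrightarrow> emap id (lmap y x) E = E"
  by (intro emap_idI lmap_other) (auto simp: expr_labels_def)

lemma Tr_Hom_K:
  assumes "f \<in> Hom K (A @ X) (B @ X)"
  shows "trK A B X f \<in> Hom K A B"
proof -
  from trace_represent[OF assms, of "{}"] obtain F a x b y where F: "frame F (a @ x) (b @ y)" "f = cls F (a @ x) (b @ y)"
    and t: "map ty a = A" "map ty x = X" "map ty b = B" "map ty y = X" by auto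
  then show ?thesis using trace_lmap(1,2)[OF F(1)] cls_Hom by auto
qed

lemma Tr_natural_K:
  assumes f: "f \<in> Hom K (A @ X) (B @ X)" and h: "h \<in> Hom K A' A" and g: "g \<in> Hom K B B'"
  shows "trK A' B' X (compK (compK (tensK g (idK X)) f) (tensK h (idK X))) =
     compK (compK g (trK A B X f)) h"
proof -
  from trace_represent[OF f, of "{}"] obtain F a x b y where F: "frame F (a @ x) (b @ y)" "f = cls F (a @ x) (b @ y)"
    and t: "map ty a = A" "map ty x = X" "map ty b = B" "map ty y = X" by auto
  have l: "label_list a" "label_list b" "label_list x" "label_list y" "set a \<inter> set x = {}" "set b \<inter> set y = {}"
    using frameD(6,7)[OF F(1)] by (auto simp: label_list_append)
  have ab: "set a \<inter> set y = {}" "set a \<inter> set b = {}" "set b \<inter> set x = {}" "set x \<inter> set y = {}" using frameD(2)[OF F(1)] by auto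
  have h': "h \<in> Hom K A' (map ty a)" and g': "g \<in> Hom K (map ty b) B'" using h g t by auto
  obtain H a' where H: "frame H a' a" "h = cls H a' a" "map ty a' = A'" "lbl H \<inter> lbl F \<subseteq> set a"
    using represent_before[OF h' l(1), of "lbl F"] by auto
  obtain G b' where G: "frame G b b'" "g = cls G b b'" "map ty b' = B'" 
     "lbl G \<inter> (lbl F \<union> lbl H) \<subseteq> set b"
    using represent_after[OF g' l(2), of "lbl F \<union> lbl H"] by auto
  have sub: "set (a @ x) \<subseteq> lbl F" "set (b @ y) \<subseteq> lbl F" "set a \<subseteq> lbl H" "set b \<subseteq> lbl G"
    using frame_sub[OF F(1)] frame_sub[OF H(1)] frame_sub[OF G(1)] by auto
  have jFG: "lbl F \<inter> lbl G = set b" using G(4) sub by auto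
  have bH: "set b \<inter> lbl H = {}" using H(4) sub(2) ab by auto
  have jH: "lbl H \<inter> lbl (F @ G) = set a" using H(4) sub G(4) bH by auto
  note w1 = whisker_right_after[OF F(1) G(1) jFG]
  note w2 = whisker_right_before[OF w1(2) H(1) jH]
  have yHG: "set y \<inter> lbl H = {}" "set y \<inter> lbl G = {}" 
  proof -
    show "set y \<inter> lbl H = {}" using H(4) sub(2) ab(1) by auto
    show "set y \<inter> lbl G = {}" using G(4) sub(2) l(6) by auto
  qed
  let ?k = "lmap y x"
  have ty: "map ty x = map ty y" using t by simp
  have "trK A' B' X (compK (compK (tensK g (idK X)) f) (tensK h (idK X))) =
     cls (emap id ?k (H @ F @ G)) a' b'"
    using trace_lmap(1)[OF w2(2) ty] w1(1) w2(1) t F(2) G(2,3) H(2,3) by simp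
  also have "emap id ?k (H @ F @ G) = H @ (emap id ?k F @ G)" using yHG by (simp add: emap_lmap_other)
  also have "cls \<dots> a' b' = compK (compK g (trK A B X f)) h"
  proof -
    have F': "frame (emap id ?k F) a b" "lbl (emap id ?k F) \<subseteq> lbl F" 
       "trK A B X f = cls (emap id ?k F) a b"
      using trace_lmap[OF F(1) ty] t F(2) by auto
    have j1: "lbl (emap id ?k F) \<inter> lbl G = set b" using G(4) F'(2) by (intro joint[OF F'(1) G(1)]) blast
    note f1 = frame_comp[OF F'(1) G(1) j1]
    have "lbl (emap id ?k F @ G) \<inter> lbl H \<subseteq> set a" using jH F'(2) by auto
    then have j2: "lbl H \<inter> lbl (emap id ?k F @ G) = set a" by (rule joint[OF H(1) f1])
    show ?thesis
      unfolding F'(3) G(2) H(2) comp_cls[OF F'(1) G(1) j1] comp_cls[OF H(1) f1 j2] ..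
  qed
  finally show ?thesis .
qed

text \<open>
  Both sides close the same two diagrams \<open>F\<close> and \<open>G\<close> to a loop.  They differ only in the name of the wire from \<open>F\<close>
  to \<open>G\<close>, which is \<open>y\<close> on the left and \<open>y'\<close> on the right.
\<close>

lemma Tr_slide_K:
  assumes f: "f \<in> Hom K (A @ X) (B @ Y)" and g: "g \<in> Hom K Y X"
  shows "trK A B Y (compK f (tensK (idK A) g)) =
     trK A B X (compK (tensK (idK B) g) f)"
proof -
  from trace_represent[OF f, of "{}"] obtain F a x b y' where F: "frame F (a @ x) (b @ y')" "f = cls F (a @ x) (b @ y')"
    and t: "map ty a = A" "map ty x = X" "map ty b = B" "map ty y' = Y" by auto
  have l: "label_list a" "label_list b" "label_list x" "label_list y'" "set a \<inter> set x = {}" "set b \<inter> set y' = {}"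
    using frameD(6,7)[OF F(1)] by (auto simp: label_list_append)
  have ab: "set a \<inter> set y' = {}" "set a \<inter> set b = {}" "set b \<inter> set x = {}" "set x \<inter> set y' = {}" using frameD(2)[OF F(1)] by auto
  have g': "g \<in> Hom K Y (map ty x)" using g t by auto
  obtain G y where G: "frame G y x" "g = cls G y x" "map ty y = Y" "lbl G \<inter> lbl F \<subseteq> set x"
       "set y \<inter> lbl F = {}"
    using represent_before[OF g' l(3), of "lbl F"] by auto
  have sub: "set (a @ x) \<subseteq> lbl F" "set (b @ y') \<subseteq> lbl F" "set x \<subseteq> lbl G" "set y \<subseteq> lbl G"
    using frame_sub[OF F(1)] frame_sub[OF G(1)] by auto
  have ly: "label_list y" using frameD(6)[OF G(1)] .
  have lenY: "length y = length y'" using t G by (metis length_map)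
  have xy: "set x \<inter> set y = {}" using frameD(2)[OF G(1)] by blast
  obtain x'' where x'': "label_list x''" "set x'' \<inter> (lbl F \<union> lbl G) = {}" "map ty x'' = map ty x"
    using ex_copy[OF l(3), of "lbl F \<union> lbl G"] by auto
  have lenX: "length x = length x''" using x''(3) by (metis length_map)
  have y'G: "set y' \<inter> lbl G = {}" using G(4) sub(2) ab(4) by auto
  \<comment> \<open>The left-hand side: \<open>G\<close> feeds \<open>F\<close> through \<open>x\<close>, and the trace identifies the output \<open>y'\<close> of \<open>F\<close> with \<open>y\<close>.\<close>
  have jGF: "lbl G \<inter> lbl F = set x" using G(4) sub by auto
  note w1 = whisker_left_before[OF F(1) G(1) jGF]
  have tyY: "map ty y = map ty y'" using t G by simp
  let ?k = "lmap y' y"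
  have "trK A B Y (compK f (tensK (idK A) g)) = cls (emap id ?k (G @ F)) a b"
    using trace_lmap(1)[OF w1(2) tyY] w1(1) t F(2) G(2,3) by simp
  also have eG: "emap id ?k (G @ F) = G @ emap id ?k F" using y'G by (simp add: emap_lmap_other)
  finally have L: "trK A B Y (compK f (tensK (idK A) g)) = cls (G @ emap id ?k F) a b" .
  have fL: "frame (G @ emap id ?k F) a b" using trace_lmap(2)[OF w1(2) tyY] eG by simp
  \<comment> \<open>The right-hand side: a copy of \<open>G\<close> has the outputs \<open>y'\<close> of \<open>F\<close> as inputs and fresh outputs \<open>x''\<close>, which
    the trace identifies with \<open>x\<close>.\<close>
  let ?s = "lmap (y @ x) (y' @ x'')"
  have d: "distinct (y @ x)" using ly l(3) xy by (auto simp: label_list_def)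
  have s: "map ?s (y @ x) = y' @ x''" using d lenX lenY by (intro map_lmap) auto
  then have s1: "map ?s y = y'" "map ?s x = x''" using lenY by auto
  have so: "?s c = c" if "c \<notin> set y" "c \<notin> set x" for c using that by (intro lmap_other) auto
  have y'x'': "label_list (y' @ x'')" using l(4) x''(1,2) sub by (auto simp: label_list_append)
  have injs: "inj_on ?s (lbl G)"
    using y'x'' s x''(2) y'G by (intro inj_on_replace[of "y' @ x''" ?s "y @ x"]) (auto simp: label_list_def so)
  have tps: "type_pres ?s (lbl G)"
    using y'x'' s t G x''(3) einstein_labels[OF frameD(1)[OF G(1)]]
    by (intro type_pres_replace[of "y @ x" "y' @ x''"]) (auto simp: label_list_def so)
  let ?G = "ren ?s G"
  have fG: "frame ?G y' x''" "g = cls ?G y' x''"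
    using frame_ren[OF G(1) injs tps] cls_ren[OF G(1) injs tps] s1 G(2) by simp_all
  have lG: "lbl ?G = set y' \<union> set x'' \<union> bound G"
  proof -
    have "?s ` set y = set y'" "?s ` set x = set x''" using s1 by (metis set_map)+
    moreover have "?s ` bound G = bound G" using frameD(3,4)[OF G(1)] by (intro lmap_image_other) auto
    ultimately show ?thesis unfolding expr_labels_ren frameD(5)[OF G(1)] image_Un by simp
  qed
  have bG: "bound G \<inter> lbl F = {}" using G(4) frameD(4,5)[OF G(1)] by auto
  have jFG: "lbl F \<inter> lbl ?G = set y'" unfolding lG using bG x''(2) sub(2) by auto
  note w2 = whisker_left_after[OF F(1) fG(1) jFG]
  have tyX: "map ty x = map ty x''" using x'' by simp
  let ?m = "lmap x'' x"
  have x''F: "set x'' \<inter> lbl F = {}" using x''(2) by auto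
  have "trK A B X (compK (tensK (idK B) g) f) = cls (emap id ?m (F @ ?G)) a b"
    using trace_lmap(1)[OF w2(2) tyX] w2(1) t F(2) fG(2) by simp
  also have "emap id ?m (F @ ?G) = F @ emap id ?m ?G" using x''F by (simp add: emap_lmap_other)
  also have "cls (F @ emap id ?m ?G) a b = cls (emap id ?m ?G @ F) a b"
    using trace_lmap(2)[OF w2(2) tyX] x''F by (intro cls_permute) (auto simp: emap_lmap_other)
  also have "emap id ?m ?G @ F = ren (lmap y y') (G @ emap id ?k F)"
  proof -
    have t1: "map (lmap y y') y = y'" "map ?k y' = y" "map ?m x'' = x"
      using lenY lenX ly l(4) x''(1) by (auto intro!: map_lmap simp: label_list_def)
    have "emap (id \<circ> ?s) (?m \<circ> ?s) G = ren (lmap y y') G"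
    proof (rule emap_cong)
      fix c assume c: "c \<in> set (lower G)"
      have cx: "c \<notin> set x" using G(1) c by (auto simp: frame_def free_upper_alt)
      have "map ?s y = map (lmap y y') y" using s1 t1 by simp
      then show "(id \<circ> ?s) c = lmap y y' c"
        using cx so[of c] lmap_other[of c y y'] by (cases "c \<in> set y") auto
    next
      fix c assume c: "c \<in> set (upper G)"
      have cy: "c \<notin> set y" using G(1) c by (auto simp: frame_def free_lower_alt)
      have "map (?m \<circ> ?s) x = map id x" unfolding map_map[symmetric] s1(2) t1(3) by simp
      then have in_x: "(?m \<circ> ?s) c = c" if "c \<in> set x" using that unfolding map_eq_conv by simp
      have "(?m \<circ> ?s) c = c"
      proof (cases "c \<in> set x")
        case False
        have "c \<in> lbl G" using c by (simp add: expr_labels_def)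
        then have "c \<notin> set x''" using x''(2) by blast
        then show ?thesis using so[OF cy False] by (simp add: lmap_other)
      qed (rule in_x)
      also have "c = lmap y y' c" using cy by (simp add: lmap_other)
      finally show "(?m \<circ> ?s) c = lmap y y' c" .
    qed
    moreover have "emap (lmap y y' \<circ> id) (lmap y y' \<circ> ?k) F = F"
    proof (rule emap_idI)
      fix c assume c: "c \<in> set (lower F)"
      then have "c \<notin> set y" using G(5) by (auto simp: expr_labels_def)
      then show "(lmap y y' \<circ> id) c = c" by (simp add: lmap_other)
    next
      fix c assume c: "c \<in> set (upper F)"
      then have cy: "c \<notin> set y" using G(5) by (auto simp: expr_labels_def)
      have "map (lmap y y' \<circ> ?k) y' = map id y'" unfolding map_map[symmetric] t1(1,2) by simp
      then have "lmap y y' (?k c) = c" if "c \<in> set y'" using that unfolding map_eq_conv by simp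
      then show "(lmap y y' \<circ> ?k) c = c" using cy by (cases "c \<in> set y'") (auto simp: lmap_other)
    qed
    ultimately show ?thesis by simp
  qed
  also have "cls \<dots> a b = cls (G @ emap id ?k F) a b"
  proof -
    let ?E = "G @ emap id ?k F" and ?r = "lmap y y'"
    have m: "map ?r y = y'" using lenY ly by (intro map_lmap) (auto simp: label_list_def)
    have "set y' \<inter> lbl ?E = {}"
    proof -
      have "set y' \<inter> set (lower F) = {}" using F(1) by (auto simp: frame_def free_upper_alt)
      moreover have "set y' \<inter> ?k ` set (upper F) = {}"
      proof -
        have "?k ` set y' = set y" using lenY l(4) map_lmap[of y' y] by (metis label_list_def set_map)
        moreover have "set y \<inter> set y' = {}" using G(5) sub(2) by auto
        ultimately have "?k c \<notin> set y'" for c 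
          by (cases "c \<in> set y'") (auto simp: lmap_other)
        then show ?thesis by auto
      qed
      ultimately show ?thesis using y'G by (auto simp: expr_labels_def)
    qed
    then have "inj_on ?r (lbl ?E)" "type_pres ?r (lbl ?E)"
      using l(4) m tyY einstein_labels[OF frameD(1)[OF fL]]
      by (auto intro!: inj_on_replace[of y' ?r y] type_pres_replace[of y y'] simp: label_list_def lmap_other)
    from cls_ren[OF fL this] moreover have "map ?r a = a" "map ?r b = b"
      using sub G(5) by (auto intro!: map_idI lmap_other)
    ultimately show ?thesis by simp
  qed
  finally show ?thesis using L by simp
qed

lemma Tr_Unit_K:
  assumes "f \<in> Hom K A B"
  shows "trK A B [] f = f"
proof -
  have "f \<in> Hom K (A @ []) (B @ [])" using assms by simp
  from trace_represent[OF this, of "{}"] obtain F a x b y where F: "frame F (a @ x) (b @ y)" "f = cls F (a @ x) (b @ y)"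
    and t: "map ty a = A" "map ty x = []" "map ty b = B" "map ty y = []" by auto
  have xy: "x = []" "y = []" using t by auto
  have "emap id (lmap [] []) F = F" by (intro emap_lmap_other) simp
  then show ?thesis using trace_lmap(1)[OF F(1)] F t xy by auto
qed

lemma Tr_OTens_K:
  assumes "f \<in> Hom K (A @ X @ Y) (B @ X @ Y)"
  shows "trK A B (X @ Y) f = trK A B X (trK (A @ X) (B @ X) Y f)"
proof -
  have "f \<in> Hom K ((A @ X) @ Y) ((B @ X) @ Y)" using assms by simp
  from trace_represent[OF this, of "{}"] obtain F ax y bx y' where F0: "frame F (ax @ y) (bx @ y')" "f = cls F (ax @ y) (bx @ y')"
    and t0: "map ty ax = A @ X" "map ty y = Y" "map ty bx = B @ X" "map ty y' = Y" by auto
  then obtain a x b x' where ab: "ax = a @ x" "bx = b @ x'" and t: "map ty a = A" "map ty x = X" "map ty b = B" "map ty x' = X"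
    by (auto simp: map_eq_append_conv)
  let ?k1 = "lmap y' y" and ?k2 = "lmap x' x"
  have tyy: "map ty y = map ty y'" "map ty x = map ty x'" using t t0 by auto
  note T1 = trace_lmap[OF F0(1) tyy(1)]
  have f1: "frame (emap id ?k1 F) (a @ x) (b @ x')" using T1(2) ab by simp
  note T2 = trace_lmap[OF f1 tyy(2)]
  have R: "trK A B X (trK (A @ X) (B @ X) Y f) = cls (emap id ?k2 (emap id ?k1 F)) a b"
    using T1(1) T2(1) F0(2) t t0 ab by simp
  have F: "frame F (a @ (x @ y)) (b @ (x' @ y'))" using F0(1) ab by simp
  have d: "distinct x'" "distinct y'" "set x' \<inter> set y' = {}" "set x' \<inter> set y = {}"
    using frameD(2,7)[OF F] by (auto simp: label_list_def)
  have "map (?k2 \<circ> ?k1) (x' @ y') = x @ y"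
  proof -
    have "map ?k1 x' = x'" using d by (intro map_idI lmap_other) auto
    moreover have "map ?k2 y = y" using d by (intro map_idI lmap_other) auto
    moreover have "map ?k1 y' = y" "map ?k2 x' = x" using d same_types_length[OF tyy(1)] same_types_length[OF tyy(2)]
      by (auto intro: map_lmap)
    ultimately show ?thesis by (metis map_append map_map)
  qed
  moreover have "(?k2 \<circ> ?k1) c = c" if "c \<in> set (upper F) - set (x' @ y')" for c
    using that by (simp add: lmap_other)
  moreover have "map ty (x @ y) = map ty (x' @ y')" using tyy by simp
  ultimately have "trK (map ty a) (map ty b) (map ty (x @ y)) (cls F (a @ (x @ y)) (b @ (x' @ y'))) = cls (emap id (?k2 \<circ> ?k1) F) a b"
    by (intro trace_cls[OF F])
  then show ?thesis using R F0 t t0 ab by simp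
qed

lemma Tr_ATens_K:
  assumes f: "f \<in> Hom K (A @ X) (B @ X)" and g: "g \<in> Hom K D E"
  shows "trK (D @ A) (E @ B) X (tensK g f) = tensK g (trK A B X f)"
proof -
  from trace_represent[OF f, of "{}"] obtain F a x b y where F: "frame F (a @ x) (b @ y)" "f = cls F (a @ x) (b @ y)"
    and t: "map ty a = A" "map ty x = X" "map ty b = B" "map ty y = X" by auto
  obtain G d e where G: "frame G d e" "g = cls G d e" "map ty d = D" "map ty e = E" "lbl G \<inter> lbl F = {}"
    using represent[OF g, of "lbl F"] by auto
  have ty: "map ty x = map ty y" using t by simp
  have GF: "frame (G @ F) ((d @ a) @ x) ((e @ b) @ y)" "tensK g f = cls (G @ F) ((d @ a) @ x) ((e @ b) @ y)"
    using frame_tens[OF G(1) F(1) G(5)] tens_cls[OF G(1) F(1) G(5)] F G by simp_all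
  have y: "set y \<inter> lbl G = {}" using frame_sub[OF F(1)] G(5) by auto
  have "trK (D @ A) (E @ B) X (tensK g f) = cls (G @ emap id (lmap y x) F) (d @ a) (e @ b)"
    using trace_lmap(1)[OF GF(1) ty] GF(2) G t y by (simp add: emap_lmap_other)
  also have "\<dots> = tensK g (trK A B X f)"
  proof -
    note T = trace_lmap[OF F(1) ty]
    have "lbl G \<inter> lbl (emap id (lmap y x) F) = {}" using T(3) G(5) by auto
    then show ?thesis using tens_cls[OF G(1) T(2)] T(1) F G t by simp
  qed
  finally show ?thesis .
qed

lemma Tr_Symm_K:
  assumes "X \<in> tylists"
  shows "trK X X X (symmK X X) = idK X"
proof -
  from symm_represent[OF assms assms, of "{}"] obtain a b a' b' where
    l: "label_list ((a @ b) @ (a' @ b'))" and t: "map ty a = X" "map ty b = X" "map ty a' = X" "map ty b' = X" and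
    s: "symmK X X = cls (dels (a @ b) (a' @ b')) (a @ b) (b' @ a')" by auto
  have fr: "frame (dels (a @ b) (a' @ b')) (a @ b) (b' @ a')" using frame_symm[OF l] t by simp
  have len: "length a = length a'" "length b = length b'" "length a' = length b" using t by (metis length_map)+
  have ll: "label_list (a @ b)" "label_list (b @ b')" "label_list a'" "set a' \<inter> set b' = {}" 
    using l by (auto simp: label_list_append)
  have "trK X X X (symmK X X) = cls (emap id (lmap a' b) (dels (a @ b) (a' @ b'))) a b'"
    using trace_lmap(1)[OF fr] s t by simp
  also have "emap id (lmap a' b) (dels (a @ b) (a' @ b')) = dels a b @ dels b b'"
  proof -
    have "map (lmap a' b) a' = b" using len ll by (intro map_lmap) (auto simp: label_list_def)
    moreover have "map (lmap a' b) b' = b'" using ll by (intro map_idI lmap_other) auto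
    ultimately show ?thesis using len by (simp add: emap_dels)
  qed
  also have "cls (dels a b @ dels b b') a b' = compK (cls (dels b b') b b') (cls (dels a b) a b)"
  proof (rule comp_cls[symmetric])
    show "frame (dels a b) a b" "frame (dels b b') b b'" using ll t by (auto intro: frame_dels)
    show "lbl (dels a b) \<inter> lbl (dels b b') = set b"
      using l len by (auto simp: expr_labels_dels label_list_def)
  qed
  also have "\<dots> = compK (idK X) (idK X)"
    using Ide_cls[OF ll(1)] Ide_cls[OF ll(2)] t by simp
  also have "\<dots> = idK X" by (rule Comp_Ide_K[OF Ide_Hom_K[OF assms]])
  finally show ?thesis .
qed

lemma Arr_HomE: "f \<in> Arr K \<Longrightarrow> \<exists>X Y. f \<in> Hom K X Y"
  using Arr_K by blast

theorem strict_traced_category_K: "strict_traced_category K"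
proof (unfold_locales, unfold K_simps)
  show "domK f \<in> tylists" "codK f \<in> tylists" if "f \<in> Arr K" for f
    using that Hom_types by (auto simp: Arr_K)
  show "tensK (tensK f g) h = tensK f (tensK g h)"
    if "f \<in> Arr K" "g \<in> Arr K" "h \<in> Arr K" for f g h
    using that Arr_HomE ATens_assoc_K by metis
  show "tensK (idK []) f = f" "tensK f (idK []) = f" if "f \<in> Arr K" for f
    using that Arr_HomE ATens_Unit_K by metis+
qed ((rule Ide_Hom_K Comp_Hom_K Comp_Ide_K Comp_assoc_K ATens_Hom_K ATens_Ide_K ATens_Comp_K
   Symm_Hom_K Symm_natural_K Symm_Symm_K Symm_OTens_K Tr_Hom_K Tr_natural_K Tr_slide_K Tr_Unit_K Tr_OTens_K
   Tr_ATens_K Tr_Symm_K, assumption+) | simp)+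

end

section \<open>Coherence of symmetries\<close>

text \<open>
  An object is assigned to each label.  Working with lists of labels instead of objects makes the tensor
  product of objects a concatenation, which is associative without side conditions, and lists of distinct labels
  can tell apart wires that carry the same object.
\<close>

locale labelled_traced_category = strict_traced_category C for C :: "('o, 'c) moncat" (structure) +
  fixes obj :: "'l \<Rightarrow> 'o"
  assumes obj_Obj: "obj a \<in> Obj C"
begin

definition ob :: "'l list \<Rightarrow> 'o" where "ob L = OTens_list C (map obj L)"
definition hm :: "'l list \<Rightarrow> 'l list \<Rightarrow> 'c set" where "hm L M = Hom C (ob L) (ob M)"
definition idl :: "'l list \<Rightarrow> 'c" where "idl L = Ide C (ob L)"
definition sy :: "'l list \<Rightarrow> 'l list \<Rightarrow> 'c" where "sy L M = Symm C (ob L) (ob M)"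
definition tr :: "'l list \<Rightarrow> 'l list \<Rightarrow> 'l list \<Rightarrow> 'c \<Rightarrow> 'c" where
  "tr L M X f = Tr C (ob L) (ob M) (ob X) f"

lemma ob_Obj [simp]: "ob L \<in> Obj C"
  by (induction L) (auto simp: ob_def OTens_list_def Unit_Obj OTens_Obj obj_Obj)

lemma ob_Nil: "ob [] = \<one>"
  by (simp add: ob_def OTens_list_def)

lemma ob_append: "ob (L @ M) = ob L \<odot> ob M"
proof (induction L)
  case Nil
  then show ?case by (simp add: ob_Nil Unit_OTens)
next
  case (Cons a L)
  have "ob (a # L') = obj a \<odot> ob L'" for L' by (simp add: ob_def OTens_list_def)
  then show ?case by (simp add: Cons OTens_assoc obj_Obj)
qed

lemma hm_Arr: "f \<in> hm L M \<Longrightarrow> f \<in> Arr C"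
  by (simp add: hm_def Hom_def)

lemma comp_hm: "f \<in> hm L M \<Longrightarrow> g \<in> hm M N \<Longrightarrow> g \<cdot> f \<in> hm L N"
  unfolding hm_def by (rule Comp_Hom)

lemma idl_hm [simp]: "idl L \<in> hm L L"
  unfolding hm_def idl_def by (rule Ide_Hom) simp

lemma comp_idl: "f \<in> hm L M \<Longrightarrow> f \<cdot> idl L = f"
  and idl_comp: "f \<in> hm L M \<Longrightarrow> idl M \<cdot> f = f"
  unfolding hm_def idl_def using Comp_Ide Ide_Comp by auto

lemma comp_assoc: "f \<in> hm L M \<Longrightarrow> g \<in> hm M N \<Longrightarrow> h \<in> hm N P \<Longrightarrow> (h \<cdot> g) \<cdot> f = h \<cdot> (g \<cdot> f)"
  unfolding hm_def by (rule Comp_assoc[symmetric])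

lemma tens_hm: "f \<in> hm L M \<Longrightarrow> g \<in> hm L' M' \<Longrightarrow> f \<otimes> g \<in> hm (L @ L') (M @ M')"
  unfolding hm_def ob_append by (rule ATens_Hom)

lemma tens_hm': "f \<in> hm L M \<Longrightarrow> g \<in> hm L' M' \<Longrightarrow> A = L @ L' \<Longrightarrow> B = M @ M' \<Longrightarrow> f \<otimes> g \<in> hm A B"
  using tens_hm by blast

lemma tens_idl: "idl L \<otimes> idl M = idl (L @ M)"
  unfolding idl_def ob_append by (rule ATens_Ide) auto

lemma tens_comp:
  "f \<in> hm L M \<Longrightarrow> g \<in> hm M N \<Longrightarrow> f' \<in> hm L' M' \<Longrightarrow> g' \<in> hm M' N' \<Longrightarrow>
   (g \<otimes> g') \<cdot> (f \<otimes> f') = (g \<cdot> f) \<otimes> (g' \<cdot> f')"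
  unfolding hm_def by (rule ATens_Comp[symmetric])

lemma tens_assoc: "f \<in> hm L M \<Longrightarrow> g \<in> hm L' M' \<Longrightarrow> h \<in> hm L'' M'' \<Longrightarrow> (f \<otimes> g) \<otimes> h = f \<otimes> (g \<otimes> h)"
  by (intro ATens_assoc hm_Arr)

lemma tens_Nil: "f \<in> hm L M \<Longrightarrow> idl [] \<otimes> f = f" "f \<in> hm L M \<Longrightarrow> f \<otimes> idl [] = f"
  unfolding idl_def ob_Nil by (auto intro: Unit_ATens ATens_Unit hm_Arr)

lemma exchange:
  assumes "f \<in> hm L L'" "g \<in> hm M M'"
  shows "(f \<otimes> idl M') \<cdot> (idl L \<otimes> g) = f \<otimes> g" "(idl L' \<otimes> g) \<cdot> (f \<otimes> idl M) = f \<otimes> g"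
  using tens_comp[OF idl_hm assms(1) assms(2) idl_hm] tens_comp[OF assms(1) idl_hm idl_hm assms(2)]
    comp_idl idl_comp assms by auto

lemma tens_comp_idl:
  assumes "f \<in> hm L M" "g \<in> hm M N"
  shows "(g \<otimes> idl P) \<cdot> (f \<otimes> idl P) = (g \<cdot> f) \<otimes> idl P" "(idl P \<otimes> g) \<cdot> (idl P \<otimes> f) = idl P \<otimes> (g \<cdot> f)"
  using tens_comp[OF assms idl_hm idl_hm, of P] tens_comp[OF idl_hm idl_hm assms, of P] comp_idl[OF idl_hm]
  by auto

lemma sy_hm [simp]: "sy L M \<in> hm (L @ M) (M @ L)"
  unfolding hm_def sy_def ob_append by (rule Symm_Hom) auto

lemma sy_natural: "f \<in> hm L L' \<Longrightarrow> g \<in> hm M M' \<Longrightarrow> sy L' M' \<cdot> (f \<otimes> g) = (g \<otimes> f) \<cdot> sy L M"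
  unfolding hm_def sy_def by (rule Symm_natural)

lemma sy_sy: "sy M L \<cdot> sy L M = idl (L @ M)"
  unfolding idl_def sy_def ob_append by (rule Symm_Symm) auto

lemma sy_append: "sy L (M @ N) = (idl M \<otimes> sy L N) \<cdot> (sy L M \<otimes> idl N)"
  unfolding idl_def sy_def ob_append by (rule Symm_OTens) auto

text \<open>
  The other hexagon: both sides are inverse to the symmetry in the opposite direction, whose decomposition is
  an axiom.
\<close>

lemma sy_append_left: "sy (L @ M) N = (sy L N \<otimes> idl M) \<cdot> (idl L \<otimes> sy M N)"
proof -
  let ?f = "(sy L N \<otimes> idl M) \<cdot> (idl L \<otimes> sy M N)"
  have 1: "sy L N \<otimes> idl M \<in> hm (L @ N @ M) (N @ L @ M)" "idl L \<otimes> sy M N \<in> hm (L @ M @ N) (L @ N @ M)"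
     "sy N L \<otimes> idl M \<in> hm (N @ L @ M) (L @ N @ M)" "idl L \<otimes> sy N M \<in> hm (L @ N @ M) (L @ M @ N)"
    by (intro tens_hm'[OF sy_hm idl_hm] tens_hm'[OF idl_hm sy_hm]; simp)+
  have 2: "sy N (L @ M) \<in> hm (N @ L @ M) (L @ M @ N)" using sy_hm[of N "L @ M"] by simp
  have 3: "sy (L @ M) N \<in> hm (L @ M @ N) (N @ L @ M)" using sy_hm[of "L @ M" N] by simp
  have f: "?f \<in> hm (L @ M @ N) (N @ L @ M)" using 1 comp_hm by blast
  have "sy N (L @ M) \<cdot> ?f = (idl L \<otimes> sy N M) \<cdot> ((sy N L \<otimes> idl M) \<cdot> ((sy L N \<otimes> idl M) \<cdot> (idl L \<otimes> sy M N)))"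
    unfolding sy_append using comp_assoc[OF f 1(3) 1(4)] by simp
  also have "\<dots> = (idl L \<otimes> sy N M) \<cdot> ((sy N L \<otimes> idl M) \<cdot> (sy L N \<otimes> idl M) \<cdot> (idl L \<otimes> sy M N))"
    using comp_assoc[OF 1(2) 1(1) 1(3)] by simp
  also have "(sy N L \<otimes> idl M) \<cdot> (sy L N \<otimes> idl M) = idl (L @ N @ M)"
    by (subst tens_comp_idl(1)[OF sy_hm sy_hm]) (simp add: sy_sy tens_idl)
  also have "idl (L @ N @ M) \<cdot> (idl L \<otimes> sy M N) = idl L \<otimes> sy M N" by (rule idl_comp[OF 1(2)])
  also have "(idl L \<otimes> sy N M) \<cdot> (idl L \<otimes> sy M N) = idl (L @ M @ N)"
    by (subst tens_comp_idl(2)[OF sy_hm sy_hm]) (simp add: sy_sy tens_idl)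
  finally have *: "sy N (L @ M) \<cdot> ?f = idl (L @ M @ N)" .
  have "?f = idl (N @ L @ M) \<cdot> ?f" by (rule idl_comp[OF f, symmetric])
  also have "idl (N @ L @ M) = sy (L @ M) N \<cdot> sy N (L @ M)" by (simp add: sy_sy)
  also have "\<dots> \<cdot> ?f = sy (L @ M) N \<cdot> (sy N (L @ M) \<cdot> ?f)" by (rule comp_assoc[OF f 2 3])
  also have "\<dots> = sy (L @ M) N" unfolding * by (rule comp_idl[OF 3])
  finally show ?thesis ..
qed

text \<open>
  By the hexagon the symmetry with the unit is idempotent, and it is invertible.
\<close>

lemma sy_Nil: "sy L [] = idl L" "sy [] L = idl L"
proof -
  have h: "sy L [] \<in> hm L L" "sy [] L \<in> hm L L" using sy_hm[of L "[]"] sy_hm[of "[]" L] by auto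
  have i: "sy L [] = sy L [] \<cdot> sy L []" using sy_append[of L "[]" "[]"] tens_Nil h by simp
  have "idl L = sy [] L \<cdot> (sy L [] \<cdot> sy L [])" using i sy_sy[of "[]" L] by simp
  also have "\<dots> = (sy [] L \<cdot> sy L []) \<cdot> sy L []" using comp_assoc h by metis
  also have "\<dots> = sy L []" using sy_sy[of "[]" L] idl_comp h by simp
  finally show 1: "sy L [] = idl L" ..
  show "sy [] L = idl L" using sy_sy[of "[]" L] unfolding 1 using comp_idl h by simp
qed

lemma tr_hm: "f \<in> hm (L @ X) (M @ X) \<Longrightarrow> tr L M X f \<in> hm L M"
  unfolding hm_def tr_def ob_append by (rule Tr_Hom) auto

lemma tr_natural:
  "f \<in> hm (L @ X) (M @ X) \<Longrightarrow> h \<in> hm L' L \<Longrightarrow> g \<in> hm M M' \<Longrightarrow>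
   tr L' M' X (((g \<otimes> idl X) \<cdot> f) \<cdot> (h \<otimes> idl X)) = (g \<cdot> tr L M X f) \<cdot> h"
  unfolding hm_def tr_def idl_def ob_append by (rule Tr_natural) auto

lemma tr_slide:
  "f \<in> hm (L @ X) (M @ Y) \<Longrightarrow> g \<in> hm Y X \<Longrightarrow> tr L M Y (f \<cdot> (idl L \<otimes> g)) = tr L M X ((idl M \<otimes> g) \<cdot> f)"
  unfolding hm_def tr_def idl_def ob_append by (rule Tr_slide) auto

lemma tr_Nil: "f \<in> hm L M \<Longrightarrow> tr L M [] f = f"
  unfolding hm_def tr_def ob_Nil by (rule Tr_Unit) auto

lemma tr_append: "f \<in> hm (L @ X @ Y) (M @ X @ Y) \<Longrightarrow> tr L M (X @ Y) f = tr L M X (tr (L @ X) (M @ X) Y f)"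
  unfolding hm_def tr_def ob_append by (rule Tr_OTens) (auto simp: OTens_assoc)

lemma tr_tens: "f \<in> hm (L @ X) (M @ X) \<Longrightarrow> g \<in> hm P Q \<Longrightarrow> tr (P @ L) (Q @ M) X (g \<otimes> f) = g \<otimes> tr L M X f"
  unfolding hm_def tr_def ob_append by (rule Tr_ATens) auto

lemma tr_sy: "tr X X X (sy X X) = idl X"
  unfolding tr_def sy_def idl_def by (rule Tr_Symm) auto

lemma ob_cong: "map obj L = map obj L' \<Longrightarrow> ob L = ob L'"
  by (simp add: ob_def)

abbreviation swap :: "'l list \<Rightarrow> 'l \<Rightarrow> 'l \<Rightarrow> 'l list \<Rightarrow> 'c" where
  "swap P a b Q \<equiv> idl P \<otimes> (sy [a] [b] \<otimes> idl Q)"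

lemma swap_hm: "swap P a b Q \<in> hm (P @ a # b # Q) (P @ b # a # Q)"
  by (intro tens_hm'[OF idl_hm[of P] tens_hm[OF sy_hm idl_hm[of Q]]]) auto

text \<open>
  \<open>wperm L M f\<close> says that \<open>f\<close> is a composite of adjacent transpositions of wires, leading from the order \<open>L\<close> to the
  order \<open>M\<close>.
\<close>

inductive wperm :: "'l list \<Rightarrow> 'l list \<Rightarrow> 'c \<Rightarrow> bool" where
  wperm_idl: "wperm L L (idl L)"
| wperm_swap: "wperm L (P @ a # b # Q) f \<Longrightarrow> wperm L (P @ b # a # Q) (swap P a b Q \<cdot> f)"

lemma wperm_hm: "wperm L M f \<Longrightarrow> f \<in> hm L M"
  by (induction rule: wperm.induct) (auto intro: comp_hm swap_hm)

lemma wperm_mset: "wperm L M f \<Longrightarrow> mset L = mset M"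
  by (induction rule: wperm.induct) auto

lemma wperm_comp: "wperm M N g \<Longrightarrow> wperm L M f \<Longrightarrow> wperm L N (g \<cdot> f)"
proof (induction rule: wperm.induct)
  case (wperm_idl M)
  then show ?case using idl_comp[OF wperm_hm[OF wperm_idl]] by simp
next
  case (wperm_swap M P a b Q g)
  show ?case
    using wperm.wperm_swap[OF wperm_swap.IH[OF wperm_swap.prems]]
      comp_assoc[OF wperm_hm[OF wperm_swap.prems] wperm_hm[OF wperm_swap.hyps] swap_hm] by simp
qed

lemma wperm_left: "wperm L M f \<Longrightarrow> wperm (A @ L) (A @ M) (idl A \<otimes> f)"
proof (induction rule: wperm.induct)
  case (wperm_idl L)
  then show ?case using wperm.wperm_idl by (simp add: tens_idl)
next
  case (wperm_swap L P a b Q f)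
  have "wperm (A @ L) ((A @ P) @ b # a # Q) (swap (A @ P) a b Q \<cdot> (idl A \<otimes> f))"
    using wperm_swap.IH by (intro wperm.wperm_swap) simp
  moreover have "swap (A @ P) a b Q = idl A \<otimes> swap P a b Q"
    unfolding tens_idl[symmetric] using tens_assoc[OF idl_hm idl_hm tens_hm[OF sy_hm idl_hm]] by blast
  ultimately show ?case
    using tens_comp_idl(2)[OF wperm_hm[OF wperm_swap.hyps] swap_hm] by simp
qed

lemma wperm_right: "wperm L M f \<Longrightarrow> wperm (L @ A) (M @ A) (f \<otimes> idl A)"
proof (induction rule: wperm.induct)
  case (wperm_idl L)
  then show ?case using wperm.wperm_idl by (simp add: tens_idl)
next
  case (wperm_swap L P a b Q f)
  have "wperm (L @ A) (P @ b # a # (Q @ A)) (swap P a b (Q @ A) \<cdot> (f \<otimes> idl A))"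
    using wperm_swap.IH by (intro wperm.wperm_swap) simp
  moreover have "swap P a b (Q @ A) = swap P a b Q \<otimes> idl A"
    unfolding tens_idl[symmetric]
    using tens_assoc[OF idl_hm tens_hm[OF sy_hm idl_hm] idl_hm] tens_assoc[OF sy_hm idl_hm idl_hm] by metis
  ultimately show ?case
    using tens_comp_idl(1)[OF wperm_hm[OF wperm_swap.hyps] swap_hm] by simp
qed

lemma wperm_tens: "wperm L M f \<Longrightarrow> wperm L' M' g \<Longrightarrow> wperm (L @ L') (M @ M') (f \<otimes> g)"
  using wperm_comp[OF wperm_right[of L M f M'] wperm_left[of L' M' g L]] exchange(1)[OF wperm_hm wperm_hm, of L M f L' M' g]
  by simp

lemma wperm_sy: "wperm (L @ M) (M @ L) (sy L M)"
proof -
  have 1: "wperm ([a] @ M) (M @ [a]) (sy [a] M)" for a M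
  proof (induction M)
    case Nil
    then show ?case using wperm.wperm_idl by (simp add: sy_Nil)
  next
    case (Cons b M)
    have "wperm ([] @ a # b # M) ([] @ b # a # M) (swap [] a b M \<cdot> idl ([] @ a # b # M))"
      by (intro wperm.intros)
    moreover have "swap [] a b M = sy [a] [b] \<otimes> idl M" 
      using tens_Nil(1)[OF tens_hm[OF sy_hm idl_hm]] by blast
    ultimately have "wperm (a # b # M) (b # a # M) (sy [a] [b] \<otimes> idl M)"
      using comp_idl[OF swap_hm[of "[]" a b M]] by simp
    moreover have "wperm ([b] @ [a] @ M) ([b] @ M @ [a]) (idl [b] \<otimes> sy [a] M)"
      by (rule wperm_left[OF Cons])
    ultimately have "wperm (a # b # M) (b # M @ [a]) ((idl [b] \<otimes> sy [a] M) \<cdot> (sy [a] [b] \<otimes> idl M))"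
      using wperm_comp by fastforce
    then show ?case using sy_append[of "[a]" "[b]" M] by simp
  qed
  show ?thesis
  proof (induction L)
    case Nil
    then show ?case using wperm.wperm_idl by (simp add: sy_Nil)
  next
    case (Cons a L)
    have "wperm (([a] @ M) @ L) ((M @ [a]) @ L) (sy [a] M \<otimes> idl L)" by (rule wperm_right[OF 1])
    moreover have "wperm ([a] @ L @ M) ([a] @ M @ L) (idl [a] \<otimes> sy L M)" by (rule wperm_left[OF Cons])
    ultimately have "wperm (a # L @ M) (M @ a # L) ((sy [a] M \<otimes> idl L) \<cdot> (idl [a] \<otimes> sy L M))"
      using wperm_comp by fastforce
    then show ?case using sy_append_left[of "[a]" L M] by simp
  qed
qed

lemma wperm_exists: "mset L = mset M \<Longrightarrow> \<exists>f. wperm L M f"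
proof (induction M arbitrary: L)
  case Nil
  then show ?case using wperm_idl by auto
next
  case (Cons a M)
  then obtain P Q where L: "L = P @ a # Q" by (metis list.set_intros(1) mset_eq_setD split_list)
  with Cons obtain f where "wperm (P @ Q) M f" by fastforce
  then have "wperm ([a] @ P @ Q) ([a] @ M) (idl [a] \<otimes> f)" by (rule wperm_left)
  moreover have "wperm ((P @ [a]) @ Q) (([a] @ P) @ Q) (sy P [a] \<otimes> idl Q)" by (intro wperm_right wperm_sy)
  ultimately show ?case using wperm_comp L by fastforce
qed

lemma wperm_map:
  assumes "wperm L M f" "\<And>a. a \<in> set L \<Longrightarrow> obj (r a) = obj a"
  shows "wperm (map r L) (map r M) f"
  using assms
proof (induction rule: wperm.induct)
  case (wperm_idl L)
  then have "ob (map r L) = ob L" by (intro ob_cong) simp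
  then show ?case using wperm.wperm_idl[of "map r L"] by (simp add: idl_def)
next
  case (wperm_swap L P a b Q f)
  have "set L = set (P @ a # b # Q)" using wperm_mset[OF wperm_swap.hyps] by (rule mset_eq_setD)
  then have "ob (map r P) = ob P" "ob (map r Q) = ob Q" "ob [r a] = ob [a]" "ob [r b] = ob [b]"
    using wperm_swap.prems by (intro ob_cong; auto)+
  then have "swap (map r P) (r a) (r b) (map r Q) = swap P a b Q" by (simp add: idl_def sy_def)
  moreover have "wperm (map r L) (map r P @ r a # r b # map r Q) f" using wperm_swap by auto
  ultimately show ?case using wperm.wperm_swap by fastforce
qed

text \<open>
  A normal form for permutations of wires: the first wire of the target is moved to the front, and the
  others are permuted behind it.
\<close>

fun normal_perm :: "'l list \<Rightarrow> 'l list \<Rightarrow> 'c" where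
  "normal_perm L [] = idl []"
| "normal_perm L (a # M) = (idl [a] \<otimes> normal_perm (remove1 a L) M) \<cdot>
     (sy (takeWhile (\<lambda>b. b \<noteq> a) L) [a] \<otimes> idl (tl (dropWhile (\<lambda>b. b \<noteq> a) L)))"

lemma normal_perm_Cons: "a \<notin> set P \<Longrightarrow> normal_perm (P @ a # Q) (a # M) = (idl [a] \<otimes> normal_perm (P @ Q) M) \<cdot> (sy P [a] \<otimes> idl Q)"
proof -
  assume a: "a \<notin> set P"
  then have "takeWhile (\<lambda>b. b \<noteq> a) (P @ a # Q) = P" "dropWhile (\<lambda>b. b \<noteq> a) (P @ a # Q) = a # Q"
    by (auto simp: takeWhile_append dropWhile_append3 takeWhile_tail)
  then show ?thesis using a by (simp add: remove1_append)
qed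

declare normal_perm.simps(2) [simp del]

lemma normal_perm_hm: "mset L = mset M \<Longrightarrow> normal_perm L M \<in> hm L M"
proof (induction M arbitrary: L)
  case (Cons a M)
  then obtain P Q where L: "L = P @ a # Q" "a \<notin> set P"
    by (metis list.set_intros(1) mset_eq_setD split_list_first)
  with Cons have "normal_perm (P @ Q) M \<in> hm (P @ Q) M" by simp
  then have "idl [a] \<otimes> normal_perm (P @ Q) M \<in> hm (a # P @ Q) (a # M)" by (intro tens_hm'[OF idl_hm]) auto
  moreover have "sy P [a] \<otimes> idl Q \<in> hm (P @ a # Q) (a # P @ Q)" by (intro tens_hm'[OF sy_hm idl_hm]) auto
  ultimately show ?case unfolding L(1) normal_perm_Cons[OF L(2)] by (rule comp_hm[rotated])
qed simp

text \<open>
  The normal form absorbs a transposition of \<open>a\<close> and \<open>b\<close>.  Let \<open>c\<close> be the wire that the normal form moves first.  If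
  \<open>c\<close> is one of the two, this is the hexagon, after cancelling two inverse symmetries in the case
  \<open>c = a\<close>.  If \<open>c\<close> stands before them, the two movements concern disjoint wires.  If it stands after them, moving \<open>c\<close>
  past the transposition is naturality of the symmetry.
\<close>

lemma normal_perm_swap:
  assumes "distinct (P @ a # b # Q)" "mset (P @ a # b # Q) = mset M"
  shows "normal_perm (P @ b # a # Q) M \<cdot> swap P a b Q = normal_perm (P @ a # b # Q) M"
  using assms
proof (induction M arbitrary: P Q)
  case Nil
  then show ?case by simp
next
  case (Cons c M)
  let ?a = "[a]" and ?b = "[b]"
  have swapQ: "swap P a b Q = (idl P \<otimes> sy [a] [b]) \<otimes> idl Q" for P Q
    using tens_assoc[OF idl_hm sy_hm idl_hm] by metis
  have c: "c \<in> set (P @ a # b # Q)" using Cons.prems(2) by (metis list.set_intros(1) mset_eq_setD)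
  have Psab: "idl P \<otimes> sy [a] [b] \<in> hm (P @ [a] @ [b]) (P @ [b] @ [a])" by (intro tens_hm'[OF idl_hm sy_hm]) auto
  have Psba: "idl P \<otimes> sy [b] [a] \<in> hm (P @ [b] @ [a]) (P @ [a] @ [b])" by (intro tens_hm'[OF idl_hm sy_hm]) auto
  consider "c = a" | "c = b" | P1 P2 where "P = P1 @ c # P2" | Q1 Q2 where "Q = Q1 @ c # Q2"
    using c by (auto dest: split_list)
  then show ?case
  proof cases
    case 1
    have sP: "sy P [a] \<otimes> idl [b] \<in> hm (P @ [a] @ [b]) ([a] @ P @ [b])" by (intro tens_hm'[OF sy_hm idl_hm]) auto
    have h: "idl [a] \<otimes> normal_perm (P @ b # Q) M \<in> hm (a # P @ b # Q) (a # M)"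
      using Cons.prems 1 by (intro tens_hm'[OF idl_hm normal_perm_hm]) auto
    have sQ: "sy (P @ [b]) [a] \<otimes> idl Q \<in> hm (P @ b # a # Q) (a # P @ b # Q)"
      by (intro tens_hm'[OF sy_hm idl_hm]) auto
    have "normal_perm (P @ b # a # Q) (a # M) = (idl [a] \<otimes> normal_perm (P @ b # Q) M) \<cdot> (sy (P @ [b]) [a] \<otimes> idl Q)"
      using normal_perm_Cons[of a "P @ [b]" Q M] Cons.prems by simp
    then have "normal_perm (P @ b # a # Q) (a # M) \<cdot> swap P a b Q =
        (idl [a] \<otimes> normal_perm (P @ b # Q) M) \<cdot> ((sy (P @ [b]) [a] \<otimes> idl Q) \<cdot> swap P a b Q)"
      using comp_assoc[OF swap_hm sQ h] by simp
    also have "(sy (P @ [b]) [a] \<otimes> idl Q) \<cdot> swap P a b Q = (sy (P @ [b]) [a] \<cdot> (idl P \<otimes> sy [a] [b])) \<otimes> idl Q"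
      unfolding swapQ using tens_comp_idl(1)[OF Psab, of "sy (P @ [b]) [a]"] sy_hm[of "P @ [b]" "[a]"] by simp
    also have "sy (P @ [b]) [a] \<cdot> (idl P \<otimes> sy [a] [b]) =
        (sy P [a] \<otimes> idl [b]) \<cdot> ((idl P \<otimes> sy [b] [a]) \<cdot> (idl P \<otimes> sy [a] [b]))"
      unfolding sy_append_left by (rule comp_assoc[OF Psab Psba sP])
    also have "(idl P \<otimes> sy [b] [a]) \<cdot> (idl P \<otimes> sy [a] [b]) = idl (P @ [a] @ [b])"
      by (subst tens_comp_idl(2)[OF sy_hm sy_hm]) (simp add: sy_sy tens_idl)
    also have "(sy P [a] \<otimes> idl [b]) \<cdot> idl (P @ [a] @ [b]) = sy P [a] \<otimes> idl [b]" by (rule comp_idl[OF sP])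
    also have "(sy P [a] \<otimes> idl [b]) \<otimes> idl Q = sy P [a] \<otimes> idl (b # Q)"
      using tens_assoc[OF sy_hm idl_hm idl_hm] tens_idl[of "[b]" Q] by simp
    finally show ?thesis using normal_perm_Cons[of a P "b # Q" M] Cons.prems 1 by simp
  next
    case 2
    have sP: "sy P [b] \<otimes> idl [a] \<in> hm (P @ [b] @ [a]) ([b] @ P @ [a])" by (intro tens_hm'[OF sy_hm idl_hm]) auto
    have h: "idl [b] \<otimes> normal_perm (P @ a # Q) M \<in> hm (b # P @ a # Q) (b # M)"
      using Cons.prems 2 by (intro tens_hm'[OF idl_hm normal_perm_hm]) auto
    have sQ: "sy P [b] \<otimes> idl (a # Q) \<in> hm (P @ b # a # Q) (b # P @ a # Q)"
      by (intro tens_hm'[OF sy_hm idl_hm]) auto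
    have "normal_perm (P @ b # a # Q) (b # M) = (idl [b] \<otimes> normal_perm (P @ a # Q) M) \<cdot> (sy P [b] \<otimes> idl (a # Q))"
      using normal_perm_Cons[of b P "a # Q" M] Cons.prems by simp
    then have "normal_perm (P @ b # a # Q) (b # M) \<cdot> swap P a b Q =
        (idl [b] \<otimes> normal_perm (P @ a # Q) M) \<cdot> ((sy P [b] \<otimes> idl (a # Q)) \<cdot> swap P a b Q)"
      using comp_assoc[OF swap_hm sQ h] by simp
    also have "sy P [b] \<otimes> idl (a # Q) = (sy P [b] \<otimes> idl [a]) \<otimes> idl Q"
      using tens_assoc[OF sy_hm idl_hm idl_hm] tens_idl[of "[a]" Q] by simp
    also have "\<dots> \<cdot> swap P a b Q = ((sy P [b] \<otimes> idl [a]) \<cdot> (idl P \<otimes> sy [a] [b])) \<otimes> idl Q"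
      unfolding swapQ by (rule tens_comp_idl(1)[OF Psab sP])
    also have "(sy P [b] \<otimes> idl [a]) \<cdot> (idl P \<otimes> sy [a] [b]) = sy (P @ [a]) [b]" by (rule sy_append_left[symmetric])
    finally have "normal_perm (P @ b # a # Q) (b # M) \<cdot> swap P a b Q =
        (idl [b] \<otimes> normal_perm (P @ a # Q) M) \<cdot> (sy (P @ [a]) [b] \<otimes> idl Q)" .
    moreover have "b \<notin> set (P @ [a])" using Cons.prems by auto
    ultimately show ?thesis using normal_perm_Cons[of b "P @ [a]" Q M] 2 by simp
  next
    case (3 P1 P2)
    let ?f = "sy P1 [c]" and ?g = "swap P2 a b Q"
    have g: "?g \<in> hm (P2 @ a # b # Q) (P2 @ b # a # Q)" by (rule swap_hm)
    have IH: "normal_perm ((P1 @ P2) @ b # a # Q) M \<cdot> swap (P1 @ P2) a b Q = normal_perm ((P1 @ P2) @ a # b # Q) M"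
      using Cons.prems 3 by (intro Cons.IH) (auto simp: add_mset_commute)
    have pmh: "normal_perm ((P1 @ P2) @ b # a # Q) M \<in> hm ((P1 @ P2) @ b # a # Q) M"
      using Cons.prems(2) 3 by (intro normal_perm_hm) (simp add: add_mset_commute)
    have h: "idl [c] \<otimes> normal_perm (P1 @ P2 @ b # a # Q) M \<in> hm ([c] @ P1 @ P2 @ b # a # Q) ([c] @ M)"
      using pmh by (intro tens_hm idl_hm) auto
    have f: "?f \<otimes> idl (P2 @ b # a # Q) \<in> hm (P1 @ c # P2 @ b # a # Q) ([c] @ P1 @ P2 @ b # a # Q)"
      "?f \<otimes> idl (P2 @ a # b # Q) \<in> hm (P1 @ c # P2 @ a # b # Q) ([c] @ P1 @ P2 @ a # b # Q)"
      by (intro tens_hm'[OF sy_hm idl_hm]; simp)+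
    have sw: "swap P a b Q = idl (P1 @ [c]) \<otimes> ?g"
      unfolding 3 using tens_assoc[OF idl_hm[of "P1 @ [c]"] idl_hm[of P2] tens_hm[OF sy_hm[of "[a]" "[b]"] idl_hm[of Q]]] 
      by (simp add: tens_idl)
    have swh: "swap P a b Q \<in> hm (P1 @ c # P2 @ a # b # Q) (P1 @ c # P2 @ b # a # Q)" 
      using swap_hm[of P a b Q] 3 by simp
    have sw': "idl ([c] @ P1) \<otimes> ?g = idl [c] \<otimes> swap (P1 @ P2) a b Q"
      using tens_assoc[OF idl_hm[of "[c] @ P1"] idl_hm[of P2] tens_hm[OF sy_hm[of "[a]" "[b]"] idl_hm[of Q]]]
       tens_assoc[OF idl_hm[of "[c]"] idl_hm[of "P1 @ P2"] tens_hm[OF sy_hm[of "[a]" "[b]"] idl_hm[of Q]]]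
      by (simp add: tens_idl)
    have swh': "idl [c] \<otimes> swap (P1 @ P2) a b Q \<in> hm ([c] @ P1 @ P2 @ a # b # Q) ([c] @ P1 @ P2 @ b # a # Q)"
      using tens_hm[OF idl_hm[of "[c]"] swap_hm[of "P1 @ P2" a b Q]] by simp
    have "normal_perm (P @ b # a # Q) (c # M) = (idl [c] \<otimes> normal_perm (P1 @ P2 @ b # a # Q) M) \<cdot> (?f \<otimes> idl (P2 @ b # a # Q))"
      using normal_perm_Cons[of c P1 "P2 @ b # a # Q" M] Cons.prems 3 by simp
    then have "normal_perm (P @ b # a # Q) (c # M) \<cdot> swap P a b Q =
       (idl [c] \<otimes> normal_perm (P1 @ P2 @ b # a # Q) M) \<cdot> ((?f \<otimes> idl (P2 @ b # a # Q)) \<cdot> swap P a b Q)"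
      using comp_assoc[OF swh f(1) h] by simp
    also have "(?f \<otimes> idl (P2 @ b # a # Q)) \<cdot> swap P a b Q = (idl ([c] @ P1) \<otimes> ?g) \<cdot> (?f \<otimes> idl (P2 @ a # b # Q))"
      unfolding sw exchange(1)[OF sy_hm g] exchange(2)[OF sy_hm g] ..
    also have "(idl [c] \<otimes> normal_perm (P1 @ P2 @ b # a # Q) M) \<cdot> \<dots> = 
      ((idl [c] \<otimes> normal_perm (P1 @ P2 @ b # a # Q) M) \<cdot> (idl [c] \<otimes> swap (P1 @ P2) a b Q)) \<cdot> (?f \<otimes> idl (P2 @ a # b # Q))"
      unfolding sw' by (rule comp_assoc[OF f(2) swh' h, symmetric])
    also have "(idl [c] \<otimes> normal_perm (P1 @ P2 @ b # a # Q) M) \<cdot> (idl [c] \<otimes> swap (P1 @ P2) a b Q) = 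
        idl [c] \<otimes> normal_perm (P1 @ P2 @ a # b # Q) M"
      using tens_comp_idl(2)[OF swap_hm pmh] IH by simp
    finally show ?thesis using normal_perm_Cons[of c P1 "P2 @ a # b # Q" M] Cons.prems 3 by simp
  next
    case (4 Q1 Q2)
    let ?g = "swap P a b Q1"
    have cn: "c \<notin> set (P @ b # a # Q1)" "c \<notin> set (P @ a # b # Q1)" using Cons.prems(1) 4 by auto
    have g: "?g \<in> hm (P @ a # b # Q1) (P @ b # a # Q1)" by (rule swap_hm)
    have IH: "normal_perm (P @ b # a # Q1 @ Q2) M \<cdot> swap P a b (Q1 @ Q2) = normal_perm (P @ a # b # Q1 @ Q2) M"
      using Cons.prems 4 by (intro Cons.IH) (auto simp: add_mset_commute)
    have pmh: "normal_perm (P @ b # a # Q1 @ Q2) M \<in> hm (P @ b # a # Q1 @ Q2) M"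
      using Cons.prems(2) 4 by (intro normal_perm_hm) (simp add: add_mset_commute)
    have h: "idl [c] \<otimes> normal_perm (P @ b # a # Q1 @ Q2) M \<in> hm ([c] @ P @ b # a # Q1 @ Q2) ([c] @ M)"
      using pmh by (intro tens_hm idl_hm) auto
    have f: "sy (P @ b # a # Q1) [c] \<otimes> idl Q2 \<in> hm (P @ b # a # Q1 @ c # Q2) ([c] @ P @ b # a # Q1 @ Q2)"
      "sy (P @ a # b # Q1) [c] \<otimes> idl Q2 \<in> hm (P @ a # b # Q1 @ c # Q2) ([c] @ P @ a # b # Q1 @ Q2)"
      by (intro tens_hm'[OF sy_hm idl_hm]; simp)+
    have swQ: "swap P a b (Q1 @ R) = ?g \<otimes> idl R" for R
      using tens_assoc[OF idl_hm[of P] tens_hm[OF sy_hm[of "[a]" "[b]"] idl_hm[of Q1]] idl_hm[of R]]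
        tens_assoc[OF sy_hm[of "[a]" "[b]"] idl_hm[of Q1] idl_hm[of R]] by (simp add: tens_idl)
    have sw: "swap P a b Q = (?g \<otimes> idl [c]) \<otimes> idl Q2"
      unfolding 4 swQ using tens_assoc[OF g idl_hm[of "[c]"] idl_hm[of Q2]] by (simp add: tens_idl)
    have gc: "?g \<otimes> idl [c] \<in> hm ((P @ a # b # Q1) @ [c]) ((P @ b # a # Q1) @ [c])"
        "idl [c] \<otimes> ?g \<in> hm ([c] @ P @ a # b # Q1) ([c] @ P @ b # a # Q1)"
      by (intro tens_hm g idl_hm)+
    have swh: "swap P a b Q \<in> hm (P @ a # b # Q1 @ c # Q2) (P @ b # a # Q1 @ c # Q2)" 
      using swap_hm[of P a b Q] 4 by simp
    have sw': "(idl [c] \<otimes> ?g) \<otimes> idl Q2 = idl [c] \<otimes> swap P a b (Q1 @ Q2)"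
      unfolding swQ by (rule tens_assoc[OF idl_hm g idl_hm])
    have swh': "idl [c] \<otimes> swap P a b (Q1 @ Q2) \<in> hm ([c] @ P @ a # b # Q1 @ Q2) ([c] @ P @ b # a # Q1 @ Q2)"
      using tens_hm[OF idl_hm[of "[c]"] swap_hm[of P a b "Q1 @ Q2"]] by simp
    have "normal_perm (P @ b # a # Q) (c # M) = (idl [c] \<otimes> normal_perm (P @ b # a # Q1 @ Q2) M) \<cdot> (sy (P @ b # a # Q1) [c] \<otimes> idl Q2)"
      using normal_perm_Cons[OF cn(1), of Q2 M] 4 by simp
    then have "normal_perm (P @ b # a # Q) (c # M) \<cdot> swap P a b Q =
       (idl [c] \<otimes> normal_perm (P @ b # a # Q1 @ Q2) M) \<cdot> ((sy (P @ b # a # Q1) [c] \<otimes> idl Q2) \<cdot> swap P a b Q)"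
      using comp_assoc[OF swh f(1) h] by simp
    also have "(sy (P @ b # a # Q1) [c] \<otimes> idl Q2) \<cdot> swap P a b Q = 
        (sy (P @ b # a # Q1) [c] \<cdot> (?g \<otimes> idl [c])) \<otimes> idl Q2"
      unfolding sw by (rule tens_comp_idl(1)[OF gc(1) sy_hm])
    also have "sy (P @ b # a # Q1) [c] \<cdot> (?g \<otimes> idl [c]) = (idl [c] \<otimes> ?g) \<cdot> sy (P @ a # b # Q1) [c]"
      by (rule sy_natural[OF g idl_hm])
    also have "\<dots> \<otimes> idl Q2 = ((idl [c] \<otimes> ?g) \<otimes> idl Q2) \<cdot> (sy (P @ a # b # Q1) [c] \<otimes> idl Q2)"
      by (rule tens_comp_idl(1)[OF sy_hm gc(2), symmetric])
    also have "(idl [c] \<otimes> normal_perm (P @ b # a # Q1 @ Q2) M) \<cdot> \<dots> = 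
      ((idl [c] \<otimes> normal_perm (P @ b # a # Q1 @ Q2) M) \<cdot> (idl [c] \<otimes> swap P a b (Q1 @ Q2))) \<cdot> (sy (P @ a # b # Q1) [c] \<otimes> idl Q2)"
      unfolding sw' by (rule comp_assoc[OF f(2) swh' h, symmetric])
    also have "(idl [c] \<otimes> normal_perm (P @ b # a # Q1 @ Q2) M) \<cdot> (idl [c] \<otimes> swap P a b (Q1 @ Q2)) = 
        idl [c] \<otimes> normal_perm (P @ a # b # Q1 @ Q2) M"
      using tens_comp_idl(2)[OF swap_hm pmh] IH by simp
    finally show ?thesis using normal_perm_Cons[OF cn(2), of Q2 M] 4 by simp
  qed
qed

lemma normal_perm_same: "normal_perm M M = idl M"
proof (induction M)
  case (Cons a M)
  have "normal_perm (a # M) (a # M) = (idl [a] \<otimes> idl M) \<cdot> (sy [] [a] \<otimes> idl M)"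
    using normal_perm_Cons[of a "[]" M M] Cons by simp
  then show ?case by (simp add: sy_Nil tens_idl comp_idl[OF idl_hm])
qed simp

text \<open>
  Composing with the normal form removes the transpositions in \<open>f\<close> from last to first, so \<open>f\<close> is determined by its
  ends.  Distinctness is essential: for a repeated label the symmetry and the identity have the same ends.
\<close>

theorem coherence:
  assumes "wperm L M f" "wperm L M g" "distinct L"
  shows "f = g"
proof -
  have "normal_perm N M \<cdot> f = normal_perm L M" if "wperm L N f" "mset L = mset M" for N f
    using that assms(3)
  proof (induction rule: wperm.induct)
    case (wperm_idl L)
    then show ?case using comp_idl[OF normal_perm_hm] by blast
  next
    case (wperm_swap L P a b Q f)
    have m: "mset L = mset (P @ a # b # Q)" using wperm_swap wperm_mset by blast
    then have "distinct (P @ a # b # Q)" using wperm_swap.prems by (metis mset_eq_imp_distinct_iff)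
    then have "normal_perm (P @ b # a # Q) M \<cdot> swap P a b Q = normal_perm (P @ a # b # Q) M" 
      using m wperm_swap.prems by (intro normal_perm_swap) auto
    moreover have "normal_perm (P @ b # a # Q) M \<in> hm (P @ b # a # Q) M" using m wperm_swap.prems by (intro normal_perm_hm) auto
    ultimately show ?case
      using comp_assoc[OF wperm_hm[OF wperm_swap.hyps] swap_hm] wperm_swap by metis
  qed
  from this[of M f] this[of M g] show ?thesis
    using assms idl_comp[OF wperm_hm] wperm_mset by (metis normal_perm_same)
qed

lemma wperm_inverse: "wperm L M f \<Longrightarrow> wperm M L g \<Longrightarrow> distinct L \<Longrightarrow> g \<cdot> f = idl L"
  using coherence[OF wperm_comp wperm_idl] by blast

end

section \<open>Yanking and superposing\<close>

context labelled_traced_category begin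

text \<open>
  The loop is the trace of a symmetry by naturality, hence an identity.
\<close>

lemma tr_yank:
  assumes h: "h \<in> hm (A @ X) M" and k: "k \<in> hm L (A @ X)"
  shows "tr L M X ((h \<otimes> idl X) \<cdot> ((idl A \<otimes> sy X X) \<cdot> (k \<otimes> idl X))) = h \<cdot> k"
proof -
  let ?f = "idl A \<otimes> sy X X"
  have f: "?f \<in> hm ((A @ X) @ X) ((A @ X) @ X)" by (rule tens_hm'[OF idl_hm sy_hm]) auto
  have "tr L M X (((h \<otimes> idl X) \<cdot> ?f) \<cdot> (k \<otimes> idl X)) = (h \<cdot> tr (A @ X) (A @ X) X ?f) \<cdot> k"
    by (rule tr_natural[OF f k h])
  also have "tr (A @ X) (A @ X) X ?f = idl (A @ X)"
    using tr_tens[OF sy_hm idl_hm] by (simp add: tr_sy tens_idl)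
  also have "h \<cdot> idl (A @ X) = h" by (rule comp_idl[OF h])
  finally show ?thesis
    using comp_assoc[OF tens_hm[OF k idl_hm] f tens_hm[OF h idl_hm]] by simp
qed

text \<open>
  The form in which a loop arises from a delta: the wire \<open>X\<close> leaves from the middle of the list, runs once
  around the trace and returns to its place.
\<close>

lemma tr_yank_inside:
  assumes f: "f \<in> hm L (U @ X @ V)" and h: "h \<in> hm (U @ X @ V) M"
  shows "tr L M X (((h \<cdot> (idl U \<otimes> sy V X)) \<otimes> idl X) \<cdot>
     ((idl (U @ V) \<otimes> sy X X) \<cdot> (((idl U \<otimes> sy X V) \<cdot> f) \<otimes> idl X))) = h \<cdot> f"
proof -
  have t: "idl U \<otimes> sy V X \<in> hm ((U @ V) @ X) (U @ X @ V)" by (rule tens_hm'[OF idl_hm sy_hm]) auto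
  have s: "idl U \<otimes> sy X V \<in> hm (U @ X @ V) ((U @ V) @ X)" by (rule tens_hm'[OF idl_hm sy_hm]) auto
  have "(idl U \<otimes> sy V X) \<cdot> (idl U \<otimes> sy X V) = idl (U @ X @ V)"
    by (subst tens_comp_idl(2)[OF sy_hm sy_hm]) (simp add: sy_sy tens_idl)
  then have "(h \<cdot> (idl U \<otimes> sy V X)) \<cdot> ((idl U \<otimes> sy X V) \<cdot> f) = h \<cdot> f"
    using comp_assoc[OF comp_hm[OF f s] t h] comp_assoc[OF f s t] idl_comp[OF f] by simp
  then show ?thesis using tr_yank[OF comp_hm[OF t h] comp_hm[OF f s]] by simp
qed

text \<open>
  Composition is expressed by tensor product, symmetry and trace.
\<close>

lemma tr_comp:
  assumes f: "f \<in> hm L X" and g: "g \<in> hm X M"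
  shows "tr L M X (sy X M \<cdot> (f \<otimes> g)) = g \<cdot> f"
proof -
  have "sy X M \<cdot> (f \<otimes> g) = sy X M \<cdot> ((idl X \<otimes> g) \<cdot> (f \<otimes> idl X))" using exchange(2)[OF f g] by simp
  also have "\<dots> = (sy X M \<cdot> (idl X \<otimes> g)) \<cdot> (f \<otimes> idl X)"
    using comp_assoc[OF tens_hm[OF f idl_hm] tens_hm[OF idl_hm g] sy_hm] by simp
  also have "sy X M \<cdot> (idl X \<otimes> g) = (g \<otimes> idl X) \<cdot> sy X X" by (rule sy_natural[OF idl_hm g])
  also have "tr L M X (((g \<otimes> idl X) \<cdot> sy X X) \<cdot> (f \<otimes> idl X)) = (g \<cdot> tr X X X (sy X X)) \<cdot> f"
    by (rule tr_natural[OF sy_hm f g])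
  finally show ?thesis using comp_idl[OF g] by (simp add: tr_sy)
qed

text \<open>
  Superposing on the right of the trace.  The axiom has the other factor on the left, and conjugation
  with symmetries exchanges the two sides.
\<close>

lemma tr_left:
  assumes f: "f \<in> hm (L @ X) (M @ X)" and g: "g \<in> hm P Q"
  shows "tr (L @ P) (M @ Q) X ((idl M \<otimes> sy X Q) \<cdot> ((f \<otimes> g) \<cdot> (idl L \<otimes> sy P X))) = tr L M X f \<otimes> g"
proof -
  have g2: "g \<otimes> tr L M X f \<in> hm (P @ L) (Q @ M)" by (intro tens_hm g tr_hm f)
  have gf: "g \<otimes> f \<in> hm ((P @ L) @ X) ((Q @ M) @ X)" using tens_hm[OF g f] by simp
  have fg: "f \<otimes> g \<in> hm (L @ X @ P) (M @ X @ Q)" using tens_hm[OF f g] by simp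
  have s1: "sy L P \<otimes> idl X \<in> hm ((L @ P) @ X) (P @ L @ X)" by (rule tens_hm'[OF sy_hm idl_hm]) auto
  have s2: "sy Q M \<otimes> idl X \<in> hm (Q @ M @ X) ((M @ Q) @ X)" by (rule tens_hm'[OF sy_hm idl_hm]) auto
  have s3: "sy P (L @ X) \<in> hm (P @ L @ X) (L @ X @ P)" using sy_hm[of P "L @ X"] by simp
  have s4: "sy (M @ X) Q \<in> hm (M @ X @ Q) (Q @ M @ X)" using sy_hm[of "M @ X" Q] by simp
  have p: "idl L \<otimes> sy P X \<in> hm ((L @ P) @ X) (L @ X @ P)" by (rule tens_hm'[OF idl_hm sy_hm]) auto
  have q: "idl M \<otimes> sy X Q \<in> hm (M @ X @ Q) ((M @ Q) @ X)" by (rule tens_hm'[OF idl_hm sy_hm]) auto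
  have l: "idl L \<otimes> sy P L' \<in> hm (L @ P @ L') (L @ L' @ P)" for L' by (intro tens_hm idl_hm sy_hm)
  have pp: "sy P (L @ X) \<cdot> (sy L P \<otimes> idl X) = idl L \<otimes> sy P X"
  proof -
    have a: "sy P L \<otimes> idl X \<in> hm (P @ L @ X) ((L @ P) @ X)" by (rule tens_hm'[OF sy_hm idl_hm]) auto
    have "sy P (L @ X) \<cdot> (sy L P \<otimes> idl X) = (idl L \<otimes> sy P X) \<cdot> ((sy P L \<otimes> idl X) \<cdot> (sy L P \<otimes> idl X))"
      unfolding sy_append by (rule comp_assoc[OF s1 a p])
    also have "(sy P L \<otimes> idl X) \<cdot> (sy L P \<otimes> idl X) = idl ((L @ P) @ X)"
      by (subst tens_comp_idl(1)[OF sy_hm sy_hm]) (simp add: sy_sy tens_idl)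
    finally show ?thesis using comp_idl[OF p] by simp
  qed
  have qq: "(sy Q M \<otimes> idl X) \<cdot> sy (M @ X) Q = idl M \<otimes> sy X Q"
  proof -
    have a: "sy M Q \<otimes> idl X \<in> hm ((M @ Q) @ X) (Q @ M @ X)" by (rule tens_hm'[OF sy_hm idl_hm]) auto
    have "(sy Q M \<otimes> idl X) \<cdot> sy (M @ X) Q = ((sy Q M \<otimes> idl X) \<cdot> (sy M Q \<otimes> idl X)) \<cdot> (idl M \<otimes> sy X Q)"
      unfolding sy_append_left by (rule comp_assoc[OF q a s2, symmetric])
    also have "(sy Q M \<otimes> idl X) \<cdot> (sy M Q \<otimes> idl X) = idl ((M @ Q) @ X)"
      by (subst tens_comp_idl(1)[OF sy_hm sy_hm]) (simp add: sy_sy tens_idl)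
    finally show ?thesis using idl_comp[OF q] by simp
  qed
  have "(idl M \<otimes> sy X Q) \<cdot> ((f \<otimes> g) \<cdot> (idl L \<otimes> sy P X)) =
      ((sy Q M \<otimes> idl X) \<cdot> sy (M @ X) Q) \<cdot> ((f \<otimes> g) \<cdot> (sy P (L @ X) \<cdot> (sy L P \<otimes> idl X)))"
    unfolding pp qq ..
  also have "\<dots> = (sy Q M \<otimes> idl X) \<cdot> (sy (M @ X) Q \<cdot> ((f \<otimes> g) \<cdot> (sy P (L @ X) \<cdot> (sy L P \<otimes> idl X))))"
    by (rule comp_assoc[OF comp_hm[OF comp_hm[OF s1 s3] fg] s4 s2])
  also have "sy (M @ X) Q \<cdot> ((f \<otimes> g) \<cdot> (sy P (L @ X) \<cdot> (sy L P \<otimes> idl X))) =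
     (sy (M @ X) Q \<cdot> (f \<otimes> g)) \<cdot> (sy P (L @ X) \<cdot> (sy L P \<otimes> idl X))"
    by (rule comp_assoc[OF comp_hm[OF s1 s3] fg s4, symmetric])
  also have "sy (M @ X) Q \<cdot> (f \<otimes> g) = (g \<otimes> f) \<cdot> sy (L @ X) P" by (rule sy_natural[OF f g])
  also have "((g \<otimes> f) \<cdot> sy (L @ X) P) \<cdot> (sy P (L @ X) \<cdot> (sy L P \<otimes> idl X)) = (g \<otimes> f) \<cdot> (sy L P \<otimes> idl X)"
  proof -
    have s5: "sy (L @ X) P \<in> hm (L @ X @ P) (P @ L @ X)" using sy_hm[of "L @ X" P] by simp
    have gf': "g \<otimes> f \<in> hm (P @ L @ X) (Q @ M @ X)" using gf by simp
    have "((g \<otimes> f) \<cdot> sy (L @ X) P) \<cdot> (sy P (L @ X) \<cdot> (sy L P \<otimes> idl X)) =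
       (g \<otimes> f) \<cdot> ((sy (L @ X) P \<cdot> sy P (L @ X)) \<cdot> (sy L P \<otimes> idl X))"
      using comp_assoc[OF comp_hm[OF s1 s3] s5 gf'] comp_assoc[OF s1 s3 s5] by simp
    then show ?thesis using idl_comp[OF s1] by (simp add: sy_sy)
  qed
  also have "(sy Q M \<otimes> idl X) \<cdot> ((g \<otimes> f) \<cdot> (sy L P \<otimes> idl X)) = ((sy Q M \<otimes> idl X) \<cdot> (g \<otimes> f)) \<cdot> (sy L P \<otimes> idl X)"
    using comp_assoc[OF s1 _ s2] gf by simp
  also have "tr (L @ P) (M @ Q) X \<dots> = (sy Q M \<cdot> tr (P @ L) (Q @ M) X (g \<otimes> f)) \<cdot> sy L P"
    by (rule tr_natural[OF gf sy_hm sy_hm])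
  also have "tr (P @ L) (Q @ M) X (g \<otimes> f) = g \<otimes> tr L M X f" by (rule tr_tens[OF f g])
  also have "sy Q M \<cdot> (g \<otimes> tr L M X f) = (tr L M X f \<otimes> g) \<cdot> sy P L" by (rule sy_natural[OF g tr_hm[OF f]])
  also have "((tr L M X f \<otimes> g) \<cdot> sy P L) \<cdot> sy L P = (tr L M X f \<otimes> g) \<cdot> (sy P L \<cdot> sy L P)"
    by (rule comp_assoc[OF sy_hm sy_hm tens_hm[OF tr_hm[OF f] g]])
  also have "\<dots> = tr L M X f \<otimes> g"
    using comp_idl[OF tens_hm[OF tr_hm[OF f] g]] by (simp add: sy_sy)
  finally show ?thesis .
qed

end

section \<open>The value of an Einstein expression\<close>

locale valuation = free_tensor_system \<Lambda> \<A> + strict_traced_category C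
  for \<Lambda> :: "('u, 'l) labelling" and \<A> :: "('s, 'u) alphabet" and C :: "('o, 'c) moncat" (structure) +
  fixes vo :: "'u \<Rightarrow> 'o" and vm :: "'s \<Rightarrow> 'c"
  assumes v: "signature_hom (Sig \<Lambda> \<A>) C (vo, vm)"
begin

text \<open>
  A label whose type lies outside the carrier gets the unit, so that every label has an object.
\<close>

definition label_obj :: "'l \<Rightarrow> 'o" where "label_obj a = (if ty a \<in> types \<Lambda> then vo (ty a) else \<one>)"

lemma vo_Obj: "X \<in> types \<Lambda> \<Longrightarrow> vo X \<in> Obj C"
  using v by (auto simp: signature_hom_def Sig_def)

sublocale labelled_traced_category C label_obj
  by unfold_locales (auto simp: label_obj_def vo_Obj Unit_Obj)

lemma ob_types: "map ty L = map ty M \<Longrightarrow> ob L = ob M"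
proof (rule ob_cong)
  have *: "map label_obj N = map (\<lambda>X. if X \<in> types \<Lambda> then vo X else \<one>) (map ty N)" for N by (simp add: label_obj_def)
  assume "map ty L = map ty M"
  then show "map label_obj L = map label_obj M" unfolding * by simp
qed

lemma ob_vo: "set L \<subseteq> labels \<Lambda> \<Longrightarrow> ob L = OTens_list C (map vo (map ty L))"
proof -
  assume "set L \<subseteq> labels \<Lambda>"
  then have "\<forall>a\<in>set L. ty a \<in> types \<Lambda>" using labelling by (auto simp: labelling_def)
  then have "map label_obj L = map vo (map ty L)" by (simp add: label_obj_def)
  then show ?thesis unfolding ob_def by (rule arg_cong)
qed

lemma label_obj_type_pres: "type_pres r A \<Longrightarrow> a \<in> A \<Longrightarrow> label_obj (r a) = label_obj a"
  by (simp add: label_obj_def type_pres_def)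

primrec entry :: "('s, 'l) elem \<Rightarrow> 'c" where
  "entry (Delta a b) = idl [a]"
| "entry (Tensor \<psi> as bs) = vm \<psi>"

primrec parallel :: "('s, 'l) expr \<Rightarrow> 'c" where
  "parallel [] = idl []"
| "parallel (e # E) = entry e \<otimes> parallel E"

lemma entry_hm: "ok e \<Longrightarrow> entry e \<in> hm (elem_lower e) (elem_upper e)"
proof (cases e)
  case (Delta a b)
  assume "ok e"
  then have "ob [a] = ob [b]" using Delta by (intro ob_types) simp
  then have "hm [a] [b] = hm [a] [a]" by (simp add: hm_def)
  then show ?thesis using Delta by simp
next
  case (Tensor \<psi> as bs)
  assume ok: "ok e"
  then have "vm \<psi> \<in> Hom C (OTens_list C (map vo (map ty as))) (OTens_list C (map vo (map ty bs)))"
    using v Tensor by (simp add: signature_hom_def Sig_def del: map_map)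
  moreover have "set as \<subseteq> labels \<Lambda>" "set bs \<subseteq> labels \<Lambda>" using ok Tensor by auto
  ultimately show ?thesis unfolding hm_def using Tensor by (simp add: ob_vo)
qed

lemma parallel_hm: "(\<And>e. e \<in> set E \<Longrightarrow> ok e) \<Longrightarrow> parallel E \<in> hm (lower E) (upper E)"
  by (induction E) (auto intro: tens_hm entry_hm)

lemma parallel_ein: "ein E \<Longrightarrow> parallel E \<in> hm (lower E) (upper E)"
  by (rule parallel_hm) (simp add: einstein_def)

lemma parallel_append:
  "(\<And>e. e \<in> set (E @ E') \<Longrightarrow> ok e) \<Longrightarrow> parallel (E @ E') = parallel E \<otimes> parallel E'"
proof (induction E)
  case Nil
  then show ?case using tens_Nil(1)[OF parallel_hm] by simp
next
  case (Cons e E)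
  then show ?case using tens_assoc[OF entry_hm parallel_hm parallel_hm] by simp
qed

lemma parallel_emap:
  assumes "\<And>a. a \<in> set (lower E) \<Longrightarrow> ty (f a) = ty a"
  shows "parallel (emap f g E) = parallel E"
proof -
  have "entry (elem_map f g e) = entry e" if "\<And>a. a \<in> set (elem_lower e) \<Longrightarrow> ty (f a) = ty a" for e
  proof (cases e)
    case (Delta a b)
    then have "ob [f a] = ob [a]" using that by (intro ob_types) simp
    then show ?thesis using Delta by (simp add: idl_def)
  qed simp
  with assms show ?thesis by (induction E) auto
qed

text \<open>
  The entry that comes first in \<open>E'\<close> is moved to the front of \<open>E\<close>; naturality of the symmetry carries it past the entries
  before it.
\<close>

lemma parallel_permute:
  assumes "mset E = mset E'" "\<And>e. e \<in> set E \<Longrightarrow> ok e"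
  shows "\<exists>p q. wperm (lower E) (lower E') p \<and> wperm (upper E) (upper E') q \<and> q \<cdot> parallel E = parallel E' \<cdot> p"
  using assms
proof (induction E' arbitrary: E)
  case Nil
  then show ?case using wperm_idl comp_idl[OF idl_hm] by auto
next
  case (Cons e F)
  have "e \<in> set E" using mset_eq_setD[OF Cons.prems(1)] by simp
  then obtain A B where E: "E = A @ e # B" by (metis split_list)
  have ok: "\<And>d. d \<in> set (A @ B) \<Longrightarrow> ok d" "ok e" using Cons.prems(2) E by auto
  have AB: "mset (A @ B) = mset F" using Cons.prems(1) E by simp
  from Cons.IH[OF AB ok(1)] obtain p q where pq: "wperm (lower (A @ B)) (lower F) p" "wperm (upper (A @ B)) (upper F) q" 
     "q \<cdot> parallel (A @ B) = parallel F \<cdot> p" by blast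
  have okF: "\<And>d. d \<in> set F \<Longrightarrow> ok d" using mset_eq_setD[OF AB] ok by auto
  let ?le = "elem_lower e" and ?ue = "elem_upper e"
  have mA: "parallel A \<in> hm (lower A) (upper A)" "parallel B \<in> hm (lower B) (upper B)" "entry e \<in> hm ?le ?ue" 
      "parallel F \<in> hm (lower F) (upper F)" using ok okF by (auto intro!: parallel_hm entry_hm)
  have mAB: "parallel (A @ B) = parallel A \<otimes> parallel B" using ok by (intro parallel_append)
  have mABh: "parallel (A @ B) \<in> hm (lower (A @ B)) (upper (A @ B))" using ok by (intro parallel_hm)
  have mE: "parallel E = parallel A \<otimes> (entry e \<otimes> parallel B)" unfolding E using parallel_append[of A "e # B"] ok by auto
  then have mE': "parallel E = (parallel A \<otimes> entry e) \<otimes> parallel B" using tens_assoc[OF mA(1,3,2)] by simp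
  let ?p0 = "sy (lower A) ?le \<otimes> idl (lower B)" and ?q0 = "sy (upper A) ?ue \<otimes> idl (upper B)"
  have p0: "wperm (lower E) (?le @ lower (A @ B)) ?p0" 
    using wperm_right[OF wperm_sy[of "lower A" ?le], of "lower B"] E by simp
  have q0: "wperm (upper E) (?ue @ upper (A @ B)) ?q0" 
    using wperm_right[OF wperm_sy[of "upper A" ?ue], of "upper B"] E by simp
  have p1: "wperm (?le @ lower (A @ B)) (?le @ lower F) (idl ?le \<otimes> p)" by (rule wperm_left[OF pq(1)])
  have q1: "wperm (?ue @ upper (A @ B)) (?ue @ upper F) (idl ?ue \<otimes> q)" by (rule wperm_left[OF pq(2)])
  have mEh: "parallel E \<in> hm (lower E) (upper E)" using Cons.prems by (intro parallel_hm)
  have Ae: "parallel A \<otimes> entry e \<in> hm (lower A @ ?le) (upper A @ ?ue)" "entry e \<otimes> parallel A \<in> hm (?le @ lower A) (?ue @ upper A)"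
    by (intro tens_hm mA)+
  have 1: "?q0 \<cdot> parallel E = (entry e \<otimes> parallel (A @ B)) \<cdot> ?p0"
  proof -
    have "?q0 \<cdot> parallel E = (sy (upper A) ?ue \<cdot> (parallel A \<otimes> entry e)) \<otimes> (idl (upper B) \<cdot> parallel B)"
      unfolding mE' by (rule tens_comp[OF Ae(1) sy_hm mA(2) idl_hm])
    also have "\<dots> = ((entry e \<otimes> parallel A) \<cdot> sy (lower A) ?le) \<otimes> (parallel B \<cdot> idl (lower B))"
      using sy_natural[OF mA(1,3)] idl_comp[OF mA(2)] comp_idl[OF mA(2)] by simp
    also have "\<dots> = ((entry e \<otimes> parallel A) \<otimes> parallel B) \<cdot> ?p0"
      by (rule tens_comp[OF sy_hm Ae(2) idl_hm mA(2), symmetric])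
    also have "(entry e \<otimes> parallel A) \<otimes> parallel B = entry e \<otimes> parallel (A @ B)"
      unfolding mAB by (rule tens_assoc[OF mA(3,1,2)])
    finally show ?thesis .
  qed
  have eAB: "entry e \<otimes> parallel (A @ B) \<in> hm (?le @ lower (A @ B)) (?ue @ upper (A @ B))" by (intro tens_hm mA mABh)
  have eF: "entry e \<otimes> parallel F \<in> hm (?le @ lower F) (?ue @ upper F)" by (intro tens_hm mA)
  have 2: "(idl ?ue \<otimes> q) \<cdot> (entry e \<otimes> parallel (A @ B)) = (entry e \<otimes> parallel F) \<cdot> (idl ?le \<otimes> p)"
    using tens_comp[OF mA(3) idl_hm mABh wperm_hm[OF pq(2)]] tens_comp[OF idl_hm mA(3) wperm_hm[OF pq(1)] mA(4)]
      idl_comp[OF mA(3)] comp_idl[OF mA(3)] pq(3) by simp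
  have "((idl ?ue \<otimes> q) \<cdot> ?q0) \<cdot> parallel E = (idl ?ue \<otimes> q) \<cdot> (?q0 \<cdot> parallel E)"
    by (rule comp_assoc[OF mEh wperm_hm[OF q0] wperm_hm[OF q1]])
  also have "\<dots> = ((idl ?ue \<otimes> q) \<cdot> (entry e \<otimes> parallel (A @ B))) \<cdot> ?p0"
    unfolding 1 by (rule comp_assoc[OF wperm_hm[OF p0] eAB wperm_hm[OF q1], symmetric])
  also have "\<dots> = (entry e \<otimes> parallel F) \<cdot> ((idl ?le \<otimes> p) \<cdot> ?p0)"
    unfolding 2 by (rule comp_assoc[OF wperm_hm[OF p0] wperm_hm[OF p1] eF])
  finally show ?case
    using wperm_comp[OF p1 p0] wperm_comp[OF q1 q0] by auto
qed

text \<open>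
  The data used to evaluate \<open>E\<close>: an order \<open>B\<close> of the bound wires, and permutations that connect inputs and outputs, each
  followed by the bound wires, with the list of all lower and all upper labels.
\<close>

definition wired :: "('s, 'l) expr \<Rightarrow> 'l list \<Rightarrow> 'l list \<Rightarrow> 'l list \<Rightarrow> 'c \<Rightarrow> 'c \<Rightarrow> bool" where
  "wired E as bs B p q \<longleftrightarrow> distinct B \<and> set B = bound E \<and> wperm (as @ B) (lower E) p \<and> wperm (upper E) (bs @ B) q"

text \<open>
  All data that evaluate \<open>E\<close> give the same arrow (\<open>wired_unique\<close>).
\<close>

definition val :: "('s, 'l) expr \<Rightarrow> 'l list \<Rightarrow> 'l list \<Rightarrow> 'c" where
  "val E as bs = (THE f. \<exists>B p q. wired E as bs B p q \<and> f = tr as bs B (q \<cdot> (parallel E \<cdot> p)))"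

lemma frame_distinct:
  assumes "frame E as bs" "distinct B" "set B = bound E"
  shows "distinct (as @ B)" "distinct (bs @ B)" "mset (as @ B) = mset (lower E)" "mset (upper E) = mset (bs @ B)"
    "distinct (lower E)" "distinct (upper E)"
proof -
  note F = frameD[OF assms(1)]
  show d: "distinct (as @ B)" "distinct (bs @ B)" "distinct (lower E)" "distinct (upper E)"
    using assms F by (auto simp: frame_def einstein_def)
  have "set (as @ B) = set (lower E)" "set (upper E) = set (bs @ B)"
    using assms by (auto simp: frame_def free_lower_alt free_upper_alt bound_def)
  then show "mset (as @ B) = mset (lower E)" "mset (upper E) = mset (bs @ B)"
    using d set_eq_iff_mset_eq_distinct by blast+
qed

lemma ex_wired:
  assumes "frame E as bs" "distinct B" "set B = bound E"
  shows "\<exists>p q. wired E as bs B p q"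
  using wperm_exists[OF frame_distinct(3)[OF assms]] wperm_exists[OF frame_distinct(4)[OF assms]] assms
  by (auto simp: wired_def)

lemma wired_hm:
  assumes "frame E as bs" "wired E as bs B p q"
  shows "q \<cdot> (parallel E \<cdot> p) \<in> hm (as @ B) (bs @ B)"
  using assms(2) comp_hm[OF comp_hm[OF wperm_hm parallel_ein[OF frameD(1)[OF assms(1)]]] wperm_hm]
  unfolding wired_def by blast

text \<open>
  By coherence the permutations for two orders \<open>B\<close> and \<open>B'\<close> differ by a permutation of the bound wires and its
  inverse, and one can be slid around the trace to cancel the other.
\<close>

lemma wired_unique:
  assumes f: "frame E as bs" and w: "wired E as bs B p q" and w': "wired E as bs B' p' q'"
  shows "tr as bs B (q \<cdot> (parallel E \<cdot> p)) = tr as bs B' (q' \<cdot> (parallel E \<cdot> p'))"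
proof -
  have B: "distinct B" "set B = bound E" "wperm (as @ B) (lower E) p" "wperm (upper E) (bs @ B) q" using w by (auto simp: wired_def)
  have B': "distinct B'" "set B' = bound E" "wperm (as @ B') (lower E) p'" "wperm (upper E) (bs @ B') q'" using w' by (auto simp: wired_def)
  have m: "mset B = mset B'" using B B' set_eq_iff_mset_eq_distinct[of B B'] by simp
  obtain s where s: "wperm B B' s" using wperm_exists[OF m] by blast
  obtain t where t: "wperm B' B t" using wperm_exists[OF m[symmetric]] by blast
  let ?c = "q \<cdot> (parallel E \<cdot> p)"
  note mE = parallel_ein[OF frameD(1)[OF f]]
  have c: "?c \<in> hm (as @ B) (bs @ B)" by (rule wired_hm[OF f w])
  have at: "idl as \<otimes> t \<in> hm (as @ B') (as @ B)" "idl as \<otimes> s \<in> hm (as @ B) (as @ B')" "idl bs \<otimes> s \<in> hm (bs @ B) (bs @ B')"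
    by (intro tens_hm idl_hm wperm_hm s t)+
  have p': "p' = p \<cdot> (idl as \<otimes> t)"
    by (rule coherence[OF B'(3) wperm_comp[OF B(3) wperm_left[OF t]] frame_distinct(1)[OF f B'(1,2)]])
  have q': "q' = (idl bs \<otimes> s) \<cdot> q"
    by (rule coherence[OF B'(4) wperm_comp[OF wperm_left[OF s] B(4)] frame_distinct(6)[OF f B(1,2)]])
  have "parallel E \<cdot> p' = (parallel E \<cdot> p) \<cdot> (idl as \<otimes> t)"
    unfolding p' by (rule comp_assoc[OF at(1) wperm_hm[OF B(3)] mE, symmetric])
  then have "q' \<cdot> (parallel E \<cdot> p') = ((idl bs \<otimes> s) \<cdot> q) \<cdot> ((parallel E \<cdot> p) \<cdot> (idl as \<otimes> t))" unfolding q' by simp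
  also have "\<dots> = (idl bs \<otimes> s) \<cdot> (q \<cdot> ((parallel E \<cdot> p) \<cdot> (idl as \<otimes> t)))"
    by (rule comp_assoc[OF comp_hm[OF at(1) comp_hm[OF wperm_hm[OF B(3)] mE]] wperm_hm[OF B(4)] at(3)])
  also have "q \<cdot> ((parallel E \<cdot> p) \<cdot> (idl as \<otimes> t)) = ?c \<cdot> (idl as \<otimes> t)"
    by (rule comp_assoc[OF at(1) comp_hm[OF wperm_hm[OF B(3)] mE] wperm_hm[OF B(4)], symmetric])
  finally have "tr as bs B' (q' \<cdot> (parallel E \<cdot> p')) = tr as bs B ((?c \<cdot> (idl as \<otimes> t)) \<cdot> (idl as \<otimes> s))"
    using tr_slide[OF comp_hm[OF at(1) c] wperm_hm[OF s]] by simp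
  also have "(?c \<cdot> (idl as \<otimes> t)) \<cdot> (idl as \<otimes> s) = ?c \<cdot> ((idl as \<otimes> t) \<cdot> (idl as \<otimes> s))"
    by (rule comp_assoc[OF at(2,1) c])
  also have "(idl as \<otimes> t) \<cdot> (idl as \<otimes> s) = idl (as @ B)"
    using tens_comp_idl(2)[OF wperm_hm[OF s] wperm_hm[OF t]] wperm_inverse[OF s t B(1)] by (simp add: tens_idl)
  also have "?c \<cdot> idl (as @ B) = ?c" by (rule comp_idl[OF c])
  finally show ?thesis ..
qed

lemma val_eq:
  assumes "frame E as bs" "wired E as bs B p q"
  shows "val E as bs = tr as bs B (q \<cdot> (parallel E \<cdot> p))"
  unfolding val_def using wired_unique[OF assms(1)] assms(2) by (intro the_equality) blast+

lemma frame_wired: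
  assumes "frame E as bs"
  obtains B p q where "wired E as bs B p q"
  using finite_distinct_list[OF finite_labels(3)[of E]] ex_wired[OF assms] by metis

lemma val_hm: "frame E as bs \<Longrightarrow> val E as bs \<in> hm as bs"
  using frame_wired val_eq tr_hm[OF wired_hm] by metis

lemma val_ren:
  assumes f: "frame E as bs" and r: "inj_on r (lbl E)" "type_pres r (lbl E)"
  shows "val (ren r E) (map r as) (map r bs) = val E as bs"
proof -
  obtain B p q where w: "wired E as bs B p q" using frame_wired[OF f] .
  have B: "distinct B" "set B = bound E" "wperm (as @ B) (lower E) p" "wperm (upper E) (bs @ B) q" using w by (auto simp: wired_def)
  note F = frameD[OF f]
  have sub: "set (as @ B) \<subseteq> lbl E" "set (upper E) \<subseteq> lbl E" "set (lower E) \<subseteq> lbl E"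
    "set as \<subseteq> lbl E" "set bs \<subseteq> lbl E" "set B \<subseteq> lbl E"
    using B(2) F(5) by (auto simp: expr_labels_def)
  have "wperm (map r (as @ B)) (map r (lower E)) p" "wperm (map r (upper E)) (map r (bs @ B)) q"
    using sub r(2) by (intro wperm_map[OF B(3)] wperm_map[OF B(4)] label_obj_type_pres[of r "lbl E"]; blast)+
  moreover have "distinct (map r B)" using B r(1) sub by (simp add: distinct_map inj_on_subset)
  ultimately have w': "wired (ren r E) (map r as) (map r bs) (map r B) p q"
    using B(2) by (simp add: wired_def bound_ren[OF r(1)])
  have "parallel (ren r E) = parallel E" using r(2) sub by (intro parallel_emap) (auto simp: type_pres_def)
  moreover have "ob (map r as) = ob as" "ob (map r bs) = ob bs" "ob (map r B) = ob B"
    using sub by (intro ob_types map_ty_pres[OF r(2)]; blast)+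
  ultimately show ?thesis
    using val_eq[OF frame_ren[OF f r] w'] val_eq[OF f w] by (simp add: tr_def)
qed

lemma val_permute:
  assumes f: "frame E as bs" and m: "mset E = mset E'"
  shows "val E as bs = val E' as bs"
proof -
  obtain B p q where w: "wired E as bs B p q" using frame_wired[OF f] .
  have B: "distinct B" "set B = bound E" "wperm (as @ B) (lower E) p" "wperm (upper E) (bs @ B) q" using w by (auto simp: wired_def)
  note E = frameD(1)[OF f]
  have f': "frame E' as bs" using f einstein_permute[OF E m] permute_label_sets[OF m] by (simp add: frame_def)
  have B': "set B = bound E'" using B(2) permute_label_sets[OF m] by simp
  obtain p' q' where w': "wired E' as bs B p' q'" using ex_wired[OF f' B(1) B'] by blast
  then have s': "wperm (as @ B) (lower E') p'" "wperm (upper E') (bs @ B) q'" by (auto simp: wired_def)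
  have "\<And>e. e \<in> set E \<Longrightarrow> ok e" using E by (simp add: einstein_def)
  from parallel_permute[OF m this] obtain x y where xy: "wperm (lower E) (lower E') x" "wperm (upper E) (upper E') y" 
    "y \<cdot> parallel E = parallel E' \<cdot> x" by blast
  have p': "p' = x \<cdot> p" by (rule coherence[OF s'(1) wperm_comp[OF xy(1) B(3)] frame_distinct(1)[OF f B(1,2)]])
  have q: "q = q' \<cdot> y" by (rule coherence[OF B(4) wperm_comp[OF s'(2) xy(2)] frame_distinct(6)[OF f B(1,2)]])
  note h = parallel_ein[OF E] parallel_ein[OF frameD(1)[OF f']] 
  note hh = wperm_hm[OF B(3)] wperm_hm[OF xy(1)] wperm_hm[OF xy(2)] wperm_hm[OF s'(2)]
  have "q \<cdot> (parallel E \<cdot> p) = q' \<cdot> (y \<cdot> (parallel E \<cdot> p))"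
    unfolding q by (rule comp_assoc[OF comp_hm[OF hh(1) h(1)] hh(3,4)])
  also have "y \<cdot> (parallel E \<cdot> p) = (y \<cdot> parallel E) \<cdot> p" by (rule comp_assoc[OF hh(1) h(1) hh(3), symmetric])
  also have "\<dots> = parallel E' \<cdot> p'" unfolding xy(3) p' by (rule comp_assoc[OF hh(1,2) h(2)])
  finally show ?thesis using val_eq[OF f w] val_eq[OF f' w'] by simp
qed

text \<open>
  The wire \<open>a\<close> is bound, from an output of \<open>E\<close> to the delta.  Its trace is taken first.  There the permutation of the
  outputs can be chosen to take \<open>a\<close> out of the list, to cross it with the output \<open>b\<close> of the delta and
  to put \<open>b\<close> in its place, so that the loop can be yanked straight.
\<close>

lemma val_delta_upper:
  assumes f: "frame (E @ [Delta a b]) as bs" and a: "a \<in> set (upper E)"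
  shows "val (E @ [Delta a b]) as bs = val (repl_upper a b E) as bs"
proof -
  let ?E1 = "E @ [Delta a b]" and ?E2 = "repl_upper a b E"
  note ein1 = frameD(1)[OF f]
  have eq: "?E1 \<approx> ?E2" using ein1 a by (rule expr_eq.delta_upper)
  have f2: "frame ?E2 as bs" by (rule frame_equiv[OF f eq])
  have ab: "a \<notin> set (lower E)" "b \<notin> set (upper E)" "a \<noteq> b" "distinct (upper E)" "ty a = ty b"
    using ein1 a by (auto simp: einstein_append einstein_delta einstein_def)
  obtain U V where U: "upper E = U @ a # V" using a by (metis split_list)
  have U2: "upper ?E2 = U @ b # V" "lower ?E2 = lower E"
    using U ab(4) by (auto simp: repl_upper_emap intro!: map_idI)
  obtain B p q where w: "wired ?E2 as bs B p q" using frame_wired[OF f2] .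
  have B: "distinct B" "set B = bound ?E2" "wperm (as @ B) (lower E) p" "wperm (U @ b # V) (bs @ B) q"
    using w U2 by (auto simp: wired_def)
  have bd: "bound ?E1 = insert a (bound ?E2)" "a \<notin> bound ?E2"
    using ab U U2 by (auto simp: bound_def)
  let ?s = "idl U \<otimes> sy [a] V" and ?t = "idl U \<otimes> sy V [b]"
  let ?q = "((q \<cdot> ?t) \<otimes> idl [a]) \<cdot> ((idl (U @ V) \<otimes> sy [a] [b]) \<cdot> (?s \<otimes> idl [b]))"
  have s: "wperm (U @ a # V) (U @ V @ [a]) ?s" and t: "wperm (U @ V @ [b]) (U @ b # V) ?t"
    using wperm_left[OF wperm_sy[of "[a]" V], of U] wperm_left[OF wperm_sy[of V "[b]"], of U] by simp_all
  have q1: "wperm (U @ V @ [b, a]) (bs @ B @ [a]) ((q \<cdot> ?t) \<otimes> idl [a])"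
    using wperm_right[OF wperm_comp[OF B(4) t], of "[a]"] by simp
  have q2: "wperm (U @ V @ [a, b]) (U @ V @ [b, a]) (idl (U @ V) \<otimes> sy [a] [b])"
    using wperm_left[OF wperm_sy[of "[a]" "[b]"], of "U @ V"] by simp
  have q3: "wperm (U @ a # V @ [b]) (U @ V @ [a, b]) (?s \<otimes> idl [b])" using wperm_right[OF s, of "[b]"] by simp
  have "wperm (upper ?E1) (bs @ (B @ [a])) ?q" using wperm_comp[OF q1 wperm_comp[OF q2 q3]] U by simp
  moreover have "wperm (as @ (B @ [a])) (lower ?E1) (p \<otimes> idl [a])" using wperm_right[OF B(3), of "[a]"] by simp
  ultimately have w1: "wired ?E1 as bs (B @ [a]) (p \<otimes> idl [a]) ?q" using B bd by (simp add: wired_def)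
  have E: "ein E" using ein1 by (simp add: einstein_append)
  have ok: "\<And>e. e \<in> set ?E1 \<Longrightarrow> ok e" using ein1 unfolding einstein_def by blast
  have obab: "ob [b] = ob [a]" "ob (U @ b # V) = ob (U @ a # V)" using ab(5) by (auto intro!: ob_types)
  have mE: "parallel E \<in> hm (lower E) (U @ [a] @ V)" using parallel_ein[OF E] U by simp
  have "parallel ?E1 = parallel E \<otimes> parallel [Delta a b]" using ok by (intro parallel_append)
  then have m1: "parallel ?E1 = parallel E \<otimes> idl [a]" using tens_Nil(2)[OF idl_hm] by simp
  have m2: "parallel ?E2 = parallel E" unfolding repl_upper_emap by (intro parallel_emap) simp
  have ph: "p \<in> hm (as @ B) (lower E)" by (rule wperm_hm[OF B(3)])
  have qh: "q \<in> hm (U @ [a] @ V) (bs @ B)" using wperm_hm[OF B(4)] obab by (simp add: hm_def)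
  let ?t' = "idl U \<otimes> sy V [a]"
  \<comment> \<open>The labels \<open>a\<close> and \<open>b\<close> have the same type, so \<open>b\<close> may be replaced by \<open>a\<close> on the level of objects.\<close>
  have q': "?q = ((q \<cdot> ?t') \<otimes> idl [a]) \<cdot> ((idl (U @ V) \<otimes> sy [a] [a]) \<cdot> (?s \<otimes> idl [a]))"
    using obab by (simp add: sy_def idl_def)
  let ?k = "parallel E \<cdot> p"
  have kh: "?k \<in> hm (as @ B) (U @ [a] @ V)" by (rule comp_hm[OF ph mE])
  have sh: "?s \<in> hm (U @ [a] @ V) ((U @ V) @ [a])" and th: "?t' \<in> hm ((U @ V) @ [a]) (U @ [a] @ V)"
    by (rule tens_hm'[OF idl_hm sy_hm]; simp)+
  have h1: "parallel ?E1 \<cdot> (p \<otimes> idl [a]) = ?k \<otimes> idl [a]" unfolding m1 by (rule tens_comp_idl(1)[OF ph mE])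
  have x1: "idl (U @ V) \<otimes> sy [a] [a] \<in> hm (((U @ V) @ [a]) @ [a]) (((U @ V) @ [a]) @ [a])"
    by (rule tens_hm'[OF idl_hm sy_hm]; simp)
  have x2: "(q \<cdot> ?t') \<otimes> idl [a] \<in> hm (((U @ V) @ [a]) @ [a]) ((bs @ B) @ [a])"
    by (intro tens_hm comp_hm[OF th qh] idl_hm)
  have x3: "?s \<otimes> idl [a] \<in> hm ((U @ [a] @ V) @ [a]) (((U @ V) @ [a]) @ [a])" by (intro tens_hm sh idl_hm)
  have x4: "?k \<otimes> idl [a] \<in> hm ((as @ B) @ [a]) ((U @ [a] @ V) @ [a])" by (intro tens_hm kh idl_hm)
  have inner: "?q \<cdot> (parallel ?E1 \<cdot> (p \<otimes> idl [a])) = 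
     ((q \<cdot> ?t') \<otimes> idl [a]) \<cdot> ((idl (U @ V) \<otimes> sy [a] [a]) \<cdot> ((?s \<cdot> ?k) \<otimes> idl [a]))"
    unfolding q' h1 comp_assoc[OF x4 comp_hm[OF x3 x1] x2] comp_assoc[OF x4 x3 x1] tens_comp_idl(1)[OF kh sh] ..
  have "val ?E1 as bs = tr as bs (B @ [a]) (?q \<cdot> (parallel ?E1 \<cdot> (p \<otimes> idl [a])))" by (rule val_eq[OF f w1])
  also have "\<dots> = tr as bs B (tr (as @ B) (bs @ B) [a] (?q \<cdot> (parallel ?E1 \<cdot> (p \<otimes> idl [a]))))"
    using wired_hm[OF f w1] by (intro tr_append) simp
  also have "tr (as @ B) (bs @ B) [a] (?q \<cdot> (parallel ?E1 \<cdot> (p \<otimes> idl [a]))) = q \<cdot> ?k"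
    unfolding inner by (rule tr_yank_inside[OF kh qh])
  also have "tr as bs B (q \<cdot> ?k) = val ?E2 as bs" using val_eq[OF f2 w] m2 by simp
  finally show ?thesis .
qed

text \<open>
  The dual argument, with the loop in the permutation of the inputs.
\<close>

lemma val_delta_lower:
  assumes f: "frame (E @ [Delta a b]) as bs" and b: "b \<in> set (lower E)"
  shows "val (E @ [Delta a b]) as bs = val (repl_lower b a E) as bs"
proof -
  let ?E1 = "E @ [Delta a b]" and ?E2 = "repl_lower b a E"
  note ein1 = frameD(1)[OF f]
  have eq: "?E1 \<approx> ?E2" using ein1 b by (rule expr_eq.delta_lower)
  have f2: "frame ?E2 as bs" by (rule frame_equiv[OF f eq])
  have ab: "a \<notin> set (lower E)" "b \<notin> set (upper E)" "a \<noteq> b" "distinct (lower E)" "ty a = ty b"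
    using ein1 b by (auto simp: einstein_append einstein_delta einstein_def)
  obtain U V where U: "lower E = U @ b # V" using b by (metis split_list)
  have U2: "lower ?E2 = U @ a # V" "upper ?E2 = upper E"
    using U ab(4) by (auto simp: repl_lower_emap intro!: map_idI)
  obtain B p q where w: "wired ?E2 as bs B p q" using frame_wired[OF f2] .
  have B: "distinct B" "set B = bound ?E2" "wperm (as @ B) (U @ a # V) p" "wperm (upper E) (bs @ B) q"
    using w U2 by (auto simp: wired_def)
  have bd: "bound ?E1 = insert b (bound ?E2)" "b \<notin> bound ?E2"
    using ab U U2 by (auto simp: bound_def)
  let ?s = "idl U \<otimes> sy [a] V" and ?t = "idl U \<otimes> sy V [b]"
  let ?p = "(?t \<otimes> idl [a]) \<cdot> ((idl (U @ V) \<otimes> sy [a] [b]) \<cdot> ((?s \<cdot> p) \<otimes> idl [b]))"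
  have s: "wperm (U @ a # V) (U @ V @ [a]) ?s" and t: "wperm (U @ V @ [b]) (U @ b # V) ?t"
    using wperm_left[OF wperm_sy[of "[a]" V], of U] wperm_left[OF wperm_sy[of V "[b]"], of U] by simp_all
  have p1: "wperm (U @ V @ [b, a]) (U @ b # V @ [a]) (?t \<otimes> idl [a])" using wperm_right[OF t, of "[a]"] by simp
  have p2: "wperm (U @ V @ [a, b]) (U @ V @ [b, a]) (idl (U @ V) \<otimes> sy [a] [b])"
    using wperm_left[OF wperm_sy[of "[a]" "[b]"], of "U @ V"] by simp
  have p3: "wperm (as @ B @ [b]) (U @ V @ [a, b]) ((?s \<cdot> p) \<otimes> idl [b])"
    using wperm_right[OF wperm_comp[OF s B(3)], of "[b]"] by simp
  have "wperm (as @ (B @ [b])) (lower ?E1) ?p" using wperm_comp[OF p1 wperm_comp[OF p2 p3]] U by simp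
  moreover have "wperm (upper ?E1) (bs @ (B @ [b])) (q \<otimes> idl [b])" using wperm_right[OF B(4), of "[b]"] by simp
  ultimately have w1: "wired ?E1 as bs (B @ [b]) ?p (q \<otimes> idl [b])" using B bd by (simp add: wired_def)
  have E: "ein E" using ein1 by (simp add: einstein_append)
  have ok: "\<And>e. e \<in> set ?E1 \<Longrightarrow> ok e" using ein1 unfolding einstein_def by blast
  have obab: "ob [a] = ob [b]" "ob (U @ a # V) = ob (U @ b # V)" using ab(5) by (auto intro!: ob_types)
  have mE: "parallel E \<in> hm (U @ [b] @ V) (upper E)" using parallel_ein[OF E] U by simp
  have "parallel ?E1 = parallel E \<otimes> parallel [Delta a b]" using ok by (intro parallel_append)
  then have m1: "parallel ?E1 = parallel E \<otimes> idl [b]" using tens_Nil(2)[OF idl_hm, of "[a]"] obab by (simp add: idl_def)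
  have m2: "parallel ?E2 = parallel E" unfolding repl_lower_emap using ab(5) by (intro parallel_emap) simp
  have qh: "q \<in> hm (upper E) (bs @ B)" by (rule wperm_hm[OF B(4)])
  have ph: "p \<in> hm (as @ B) (U @ [b] @ V)" using wperm_hm[OF B(3)] obab by (simp add: hm_def)
  let ?s' = "idl U \<otimes> sy [b] V"
  have p': "?p = (?t \<otimes> idl [b]) \<cdot> ((idl (U @ V) \<otimes> sy [b] [b]) \<cdot> ((?s' \<cdot> p) \<otimes> idl [b]))"
    using obab by (simp add: sy_def idl_def)
  let ?h = "q \<cdot> parallel E"
  have hh: "?h \<in> hm (U @ [b] @ V) (bs @ B)" by (rule comp_hm[OF mE qh])
  have sh: "?s' \<in> hm (U @ [b] @ V) ((U @ V) @ [b])" and th: "?t \<in> hm ((U @ V) @ [b]) (U @ [b] @ V)"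
    by (rule tens_hm'[OF idl_hm sy_hm]; simp)+
  have h1: "(q \<otimes> idl [b]) \<cdot> parallel ?E1 = ?h \<otimes> idl [b]" unfolding m1 by (rule tens_comp_idl(1)[OF mE qh])
  have x1: "idl (U @ V) \<otimes> sy [b] [b] \<in> hm (((U @ V) @ [b]) @ [b]) (((U @ V) @ [b]) @ [b])"
    by (rule tens_hm'[OF idl_hm sy_hm]; simp)
  have x2: "?t \<otimes> idl [b] \<in> hm (((U @ V) @ [b]) @ [b]) ((U @ [b] @ V) @ [b])"
    by (intro tens_hm th idl_hm)
  have x3: "(?s' \<cdot> p) \<otimes> idl [b] \<in> hm ((as @ B) @ [b]) (((U @ V) @ [b]) @ [b])" by (intro tens_hm comp_hm[OF ph sh] idl_hm)
  have x4: "?h \<otimes> idl [b] \<in> hm ((U @ [b] @ V) @ [b]) ((bs @ B) @ [b])" by (intro tens_hm hh idl_hm)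
  have x5: "q \<otimes> idl [b] \<in> hm (upper E @ [b]) ((bs @ B) @ [b])" "parallel ?E1 \<in> hm ((U @ [b] @ V) @ [b]) (upper E @ [b])"
    unfolding m1 by (intro tens_hm qh mE idl_hm)+
  have "(q \<otimes> idl [b]) \<cdot> (parallel ?E1 \<cdot> ?p) = (?h \<otimes> idl [b]) \<cdot> ?p"
    unfolding p' h1[symmetric] by (rule comp_assoc[OF comp_hm[OF comp_hm[OF x3 x1] x2] x5(2,1), symmetric])
  also have "\<dots> = ((?h \<otimes> idl [b]) \<cdot> (?t \<otimes> idl [b])) \<cdot> ((idl (U @ V) \<otimes> sy [b] [b]) \<cdot> ((?s' \<cdot> p) \<otimes> idl [b]))"
    unfolding p' by (rule comp_assoc[OF comp_hm[OF x3 x1] x2 x4, symmetric])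
  finally have inner: "(q \<otimes> idl [b]) \<cdot> (parallel ?E1 \<cdot> ?p) =
     ((?h \<cdot> ?t) \<otimes> idl [b]) \<cdot> ((idl (U @ V) \<otimes> sy [b] [b]) \<cdot> ((?s' \<cdot> p) \<otimes> idl [b]))"
    unfolding tens_comp_idl(1)[OF th hh] .
  have "val ?E1 as bs = tr as bs (B @ [b]) ((q \<otimes> idl [b]) \<cdot> (parallel ?E1 \<cdot> ?p))" by (rule val_eq[OF f w1])
  also have "\<dots> = tr as bs B (tr (as @ B) (bs @ B) [b] ((q \<otimes> idl [b]) \<cdot> (parallel ?E1 \<cdot> ?p)))"
    using wired_hm[OF f w1] by (intro tr_append) simp
  also have "tr (as @ B) (bs @ B) [b] ((q \<otimes> idl [b]) \<cdot> (parallel ?E1 \<cdot> ?p)) = ?h \<cdot> p"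
    unfolding inner by (rule tr_yank_inside[OF ph hh])
  also have "?h \<cdot> p = q \<cdot> (parallel E \<cdot> p)" by (rule comp_assoc[OF ph mE qh])
  also have "tr as bs B (q \<cdot> (parallel E \<cdot> p)) = val ?E2 as bs" using val_eq[OF f2 w] m2 by simp
  finally show ?thesis .
qed

lemma val_equiv: "E \<approx> E' \<Longrightarrow> frame E as bs \<Longrightarrow> val E as bs = val E' as bs"
proof (induction rule: expr_eq.induct)
  case (sym E E')
  then show ?case using frame_equiv[OF sym.prems expr_eq.sym[OF sym.hyps]] by simp
next
  case (trans E E' E'')
  then show ?case using frame_equiv by metis
next
  case (permute E E')
  then show ?case using val_permute by blast
next
  case (rename E a a')
  let ?r = "id(a := a')"
  have r: "inj_on ?r (lbl E)" "type_pres ?r (lbl E)"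
    using rename einstein_labels[OF rename.hyps(1)] by (auto simp: inj_on_def type_pres_def)
  have "map ?r as = as" "map ?r bs = bs" using rename.hyps(2) frameD(3,4)[OF rename.prems] by (auto intro!: map_idI)
  then show ?case using val_ren[OF rename.prems r] by (simp add: repl_lower_emap repl_upper_emap)
next
  case (delta_upper E a b)
  then show ?case using val_delta_upper by blast
next
  case (delta_lower E a b)
  then show ?case using val_delta_lower by blast
qed simp

end

section \<open>The induced functor\<close>

context free_tensor_system begin

lemma frame_symbol:
  assumes "\<psi> \<in> symbols \<A>" "label_list (as @ bs)" "map ty as = lower_types \<A> \<psi>" "map ty bs = upper_types \<A> \<psi>"
  shows "frame [Tensor \<psi> as bs] as bs"
  using assms by (auto simp: frame_def einstein_def label_list_def free_lower_alt free_upper_alt)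

lemma eta_cls:
  assumes "\<psi> \<in> symbols \<A>"
  defines "as \<equiv> can False 0 (lower_types \<A> \<psi>)" and "bs \<equiv> can True 0 (upper_types \<A> \<psi>)"
  shows "frame [Tensor \<psi> as bs] as bs" "snd (eta \<Lambda> \<A>) \<psi> = cls [Tensor \<psi> as bs] as bs"
    "map ty as = lower_types \<A> \<psi>" "map ty bs = upper_types \<A> \<psi>"
proof -
  have t: "lower_types \<A> \<psi> \<in> tylists" "upper_types \<A> \<psi> \<in> tylists"
    using alphabet assms(1) by (auto simp: alphabet_def)
  note p = canons_props[OF t(1), of False 0] canons_props[OF t(2), of True 0]
  show m: "map ty as = lower_types \<A> \<psi>" "map ty bs = upper_types \<A> \<psi>" using p by (simp_all add: as_def bs_def)
  have "label_list (as @ bs)"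
    unfolding as_def bs_def label_list_append by (intro conjI label_list_canons t canons_disjoint) simp
  then show f: "frame [Tensor \<psi> as bs] as bs" using m by (intro frame_symbol assms(1))
  have "lbl [Tensor \<psi> as bs] \<subseteq> labels \<Lambda>" by (rule einstein_labels[OF frameD(1)[OF f]])
  then have "canonizes id [Tensor \<psi> as bs] as bs"
    using m by (auto simp: canonizes_def type_pres_def as_def bs_def)
  then show "snd (eta \<Lambda> \<A>) \<psi> = cls [Tensor \<psi> as bs] as bs"
    using cls_eq[OF f] by (simp add: eta_def ren_id as_def bs_def)
qed

end

context valuation begin

lemma val_reorder:
  assumes f: "frame E as bs" and p: "wperm as' as p" and q: "wperm bs bs' q"
  shows "val E as' bs' = (q \<cdot> val E as bs) \<cdot> p" "frame E as' bs'"
proof -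
  have m: "mset as' = mset as" "mset bs = mset bs'" using wperm_mset[OF p] wperm_mset[OF q] .
  show f': "frame E as' bs'"
    using f m by (auto simp: frame_def dest: mset_eq_setD intro: mset_eq_imp_distinct_iff[THEN iffD1])
  obtain B P Q where w: "wired E as bs B P Q" using frame_wired[OF f] .
  have B: "distinct B" "set B = bound E" "wperm (as @ B) (lower E) P" "wperm (upper E) (bs @ B) Q" using w by (auto simp: wired_def)
  let ?p = "p \<otimes> idl B" and ?q = "q \<otimes> idl B" and ?c = "Q \<cdot> (parallel E \<cdot> P)"
  have w': "wired E as' bs' B (P \<cdot> ?p) (?q \<cdot> Q)"
    unfolding wired_def using B wperm_comp[OF B(3) wperm_right[OF p]] wperm_comp[OF wperm_right[OF q] B(4)] by simp
  note mE = parallel_ein[OF frameD(1)[OF f]] and h = wperm_hm[OF B(3)] wperm_hm[OF B(4)] wperm_hm[OF wperm_right[OF p], of B] wperm_hm[OF wperm_right[OF q], of B]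
  have c: "?c \<in> hm (as @ B) (bs @ B)" by (rule wired_hm[OF f w])
  have "(?q \<cdot> Q) \<cdot> (parallel E \<cdot> (P \<cdot> ?p)) = (?q \<cdot> Q) \<cdot> ((parallel E \<cdot> P) \<cdot> ?p)"
    unfolding comp_assoc[OF h(3,1) mE] ..
  also have "\<dots> = ?q \<cdot> (Q \<cdot> ((parallel E \<cdot> P) \<cdot> ?p))"
    by (rule comp_assoc[OF comp_hm[OF h(3) comp_hm[OF h(1) mE]] h(2,4)])
  also have "\<dots> = ?q \<cdot> (?c \<cdot> ?p)" unfolding comp_assoc[OF h(3) comp_hm[OF h(1) mE] h(2)] ..
  also have "\<dots> = (?q \<cdot> ?c) \<cdot> ?p" by (rule comp_assoc[OF h(3) c h(4), symmetric])
  finally have "val E as' bs' = tr as' bs' B ((?q \<cdot> ?c) \<cdot> ?p)" using val_eq[OF f' w'] by simp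
  also have "\<dots> = (q \<cdot> tr as bs B ?c) \<cdot> p" by (rule tr_natural[OF c wperm_hm[OF p] wperm_hm[OF q]])
  finally show "val E as' bs' = (q \<cdot> val E as bs) \<cdot> p" using val_eq[OF f w] by simp
qed

text \<open>
  The bound wires of both factors are traced at the end of the combined list.  The trace over \<open>B'\<close> passes to the right
  factor by superposing, and the trace over \<open>B\<close> to the left factor by superposing on the other side.
\<close>

lemma val_tens:
  assumes f: "frame E as bs" and f': "frame E' as' bs'" and d: "lbl E \<inter> lbl E' = {}"
  shows "val (E @ E') (as @ as') (bs @ bs') = val E as bs \<otimes> val E' as' bs'"
proof -
  note fr = frame_tens[OF f f' d]
  obtain B p q where w: "wired E as bs B p q" using frame_wired[OF f] .
  have B: "distinct B" "set B = bound E" "wperm (as @ B) (lower E) p" "wperm (upper E) (bs @ B) q" using w by (auto simp: wired_def)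
  obtain B' p' q' where w': "wired E' as' bs' B' p' q'" using frame_wired[OF f'] .
  have B': "distinct B'" "set B' = bound E'" "wperm (as' @ B') (lower E') p'" "wperm (upper E') (bs' @ B') q'" using w' by (auto simp: wired_def)
  let ?c = "q \<cdot> (parallel E \<cdot> p)" and ?c' = "q' \<cdot> (parallel E' \<cdot> p')"
  have c: "?c \<in> hm (as @ B) (bs @ B)" "?c' \<in> hm (as' @ B') (bs' @ B')" by (rule wired_hm[OF f w] wired_hm[OF f' w'])+
  \<comment> \<open>The list of inputs ends with both lists of bound wires, so \<open>as'\<close> and \<open>B\<close> have to be exchanged.\<close>
  let ?y = "idl as \<otimes> sy as' B" and ?x = "idl bs \<otimes> sy B bs'"
  have y: "wperm (as @ as' @ B) (as @ B @ as') ?y" and x: "wperm (bs @ B @ bs') (bs @ bs' @ B) ?x"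
    by (intro wperm_left wperm_sy)+
  let ?P = "(p \<otimes> p') \<cdot> (?y \<otimes> idl B')" and ?Q = "(?x \<otimes> idl B') \<cdot> (q \<otimes> q')"
  have y1: "wperm ((as @ as') @ (B @ B')) ((as @ B) @ (as' @ B')) (?y \<otimes> idl B')"
    and x1: "wperm ((bs @ B) @ (bs' @ B')) ((bs @ bs') @ (B @ B')) (?x \<otimes> idl B')"
    using wperm_right[OF y, of B'] wperm_right[OF x, of B'] by simp_all
  have P: "wperm ((as @ as') @ (B @ B')) (lower (E @ E')) ?P" using wperm_comp[OF wperm_tens[OF B(3) B'(3)] y1] by simp
  have Q: "wperm (upper (E @ E')) ((bs @ bs') @ (B @ B')) ?Q" using wperm_comp[OF x1 wperm_tens[OF B(4) B'(4)]] by simp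
  have "set (B @ B') = bound (E @ E')" "distinct (B @ B')"
    using B(1,2) B'(1,2) d by (auto simp: bound_def expr_labels_def)
  then have W: "wired (E @ E') (as @ as') (bs @ bs') (B @ B') ?P ?Q" using P Q by (simp add: wired_def)
  note m = parallel_ein[OF frameD(1)[OF f]] parallel_ein[OF frameD(1)[OF f']]
  have mm: "parallel (E @ E') = parallel E \<otimes> parallel E'"
    using frameD(1)[OF fr] by (intro parallel_append) (simp add: einstein_def)
  note h = wperm_hm[OF B(3)] wperm_hm[OF B(4)] wperm_hm[OF B'(3)] wperm_hm[OF B'(4)] wperm_hm[OF y1] wperm_hm[OF x1]
  have pp: "p \<otimes> p' \<in> hm ((as @ B) @ (as' @ B')) (lower E @ lower E')" "q \<otimes> q' \<in> hm (upper E @ upper E') ((bs @ B) @ (bs' @ B'))"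
     "parallel E \<otimes> parallel E' \<in> hm (lower E @ lower E') (upper E @ upper E')" by (intro tens_hm h m)+
  have cc: "?c \<otimes> ?c' = (q \<otimes> q') \<cdot> ((parallel E \<otimes> parallel E') \<cdot> (p \<otimes> p'))"
    unfolding tens_comp[OF h(1) m(1) h(3) m(2)] tens_comp[OF comp_hm[OF h(1) m(1)] h(2) comp_hm[OF h(3) m(2)] h(4)] ..
  have ch: "?c \<otimes> ?c' \<in> hm ((as @ B) @ (as' @ B')) ((bs @ B) @ (bs' @ B'))" by (intro tens_hm c)
  have "?Q \<cdot> (parallel (E @ E') \<cdot> ?P) = ?Q \<cdot> (((parallel E \<otimes> parallel E') \<cdot> (p \<otimes> p')) \<cdot> (?y \<otimes> idl B'))"
    unfolding mm comp_assoc[OF h(5) pp(1,3)] ..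
  also have "\<dots> = (?x \<otimes> idl B') \<cdot> ((q \<otimes> q') \<cdot> (((parallel E \<otimes> parallel E') \<cdot> (p \<otimes> p')) \<cdot> (?y \<otimes> idl B')))"
    by (rule comp_assoc[OF comp_hm[OF h(5) comp_hm[OF pp(1,3)]] pp(2) h(6)])
  also have "\<dots> = (?x \<otimes> idl B') \<cdot> ((?c \<otimes> ?c') \<cdot> (?y \<otimes> idl B'))"
    unfolding cc comp_assoc[OF h(5) comp_hm[OF pp(1,3)] pp(2)] ..
  also have "\<dots> = ((?x \<otimes> idl B') \<cdot> (?c \<otimes> ?c')) \<cdot> (?y \<otimes> idl B')"
    by (rule comp_assoc[OF h(5) ch h(6), symmetric])
  finally have *: "?Q \<cdot> (parallel (E @ E') \<cdot> ?P) = ((?x \<otimes> idl B') \<cdot> (?c \<otimes> ?c')) \<cdot> (?y \<otimes> idl B')" .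
  have ch': "?c \<otimes> ?c' \<in> hm ((as @ B @ as') @ B') ((bs @ B @ bs') @ B')" using ch by simp
  let ?k = "tr as' bs' B' ?c'"
  have k: "?k \<in> hm as' bs'" by (rule tr_hm[OF c(2)])
  have "tr (as @ as' @ B) (bs @ bs' @ B) B' (((?x \<otimes> idl B') \<cdot> (?c \<otimes> ?c')) \<cdot> (?y \<otimes> idl B')) =
     (?x \<cdot> tr (as @ B @ as') (bs @ B @ bs') B' (?c \<otimes> ?c')) \<cdot> ?y"
    by (rule tr_natural[OF ch' wperm_hm[OF y] wperm_hm[OF x]])
  also have "tr (as @ B @ as') (bs @ B @ bs') B' (?c \<otimes> ?c') = ?c \<otimes> ?k"
    using tr_tens[OF c(2) c(1)] by simp
  also have "(?x \<cdot> (?c \<otimes> ?k)) \<cdot> ?y = ?x \<cdot> ((?c \<otimes> ?k) \<cdot> ?y)"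
    using comp_assoc[OF wperm_hm[OF y] _ wperm_hm[OF x], of "?c \<otimes> ?k"] tens_hm[OF c(1) k] by simp
  finally have **: "tr (as @ as' @ B) (bs @ bs' @ B) B' (((?x \<otimes> idl B') \<cdot> (?c \<otimes> ?c')) \<cdot> (?y \<otimes> idl B')) =
     ?x \<cdot> ((?c \<otimes> ?k) \<cdot> ?y)" .
  have "val (E @ E') (as @ as') (bs @ bs') = tr (as @ as') (bs @ bs') (B @ B') (?Q \<cdot> (parallel (E @ E') \<cdot> ?P))"
    by (rule val_eq[OF fr W])
  also have "\<dots> = tr (as @ as') (bs @ bs') B (tr (as @ as' @ B) (bs @ bs' @ B) B' (?Q \<cdot> (parallel (E @ E') \<cdot> ?P)))"
    using tr_append[of "?Q \<cdot> (parallel (E @ E') \<cdot> ?P)" "as @ as'" B B' "bs @ bs'"] wired_hm[OF fr W] by simp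
  also have "\<dots> = tr as bs B ?c \<otimes> ?k"
    unfolding * ** by (rule tr_left[OF c(1) k])
  finally show ?thesis using val_eq[OF f w] val_eq[OF f' w'] by simp
qed

text \<open>
  Identified labels become bound wires, traced after those that were bound before.
\<close>

lemma val_trace:
  assumes f: "frame E (as @ cs) (bs @ ds)" and ty: "map ty cs = map ty ds" and g: "map g ds = cs"
    "\<And>a. a \<in> set (upper E) - set ds \<Longrightarrow> g a = a"
  shows "val (emap id g E) as bs = tr as bs cs (val E (as @ cs) (bs @ ds))"
proof -
  note fr = frame_trace[OF f ty g]
  obtain B p q where w: "wired E (as @ cs) (bs @ ds) B p q" using frame_wired[OF f] .
  have B: "distinct B" "set B = bound E" "wperm ((as @ cs) @ B) (lower E) p" "wperm (upper E) ((bs @ ds) @ B) q" using w by (auto simp: wired_def)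
  note F = frameD[OF f]
  have ob: "ob ds = ob cs" using ty by (intro ob_types) simp
  have sub: "set bs \<union> set B \<subseteq> set (upper E) - set ds"
    using F(4,7) B(2) f by (auto simp: frame_def free_upper_alt bound_def)
  have gid: "map g bs = bs" "map g B = B" using g(2) sub by (auto intro!: map_idI)
  have "ty (g a) = ty a" if "a \<in> set (upper E)" for a
  proof (cases "a \<in> set ds")
    case True
    have "map ty (map g ds) = map ty ds" using ty g(1) by simp
    then show ?thesis using True by simp
  next
    case False then show ?thesis using g(2) that by simp
  qed
  then have "wperm (map g (upper E)) (map g ((bs @ ds) @ B)) q" by (intro wperm_map[OF B(4)]) (simp add: label_obj_def)
  then have q': "wperm (upper (emap id g E)) (bs @ (cs @ B)) q" using gid g(1) by simp
  have "set (cs @ B) = bound (emap id g E)" using fr(3) B(2) by auto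
  moreover have "distinct (cs @ B)" using B(1,2) F(3,6) by (auto simp: label_list_def)
  ultimately have w': "wired (emap id g E) as bs (cs @ B) p q" using q' B(3) by (simp add: wired_def)
  have m: "parallel (emap id g E) = parallel E" by (rule parallel_emap) simp
  let ?c = "q \<cdot> (parallel E \<cdot> p)"
  have "?c \<in> hm (as @ cs @ B) (bs @ cs @ B)" using wired_hm[OF fr(1) w'] m by simp
  then have "val (emap id g E) as bs = tr as bs cs (tr (as @ cs) (bs @ cs) B ?c)"
    using val_eq[OF fr(1) w'] m by (simp add: tr_append)
  also have "tr (as @ cs) (bs @ cs) B ?c = tr (as @ cs) (bs @ ds) B ?c" by (simp add: tr_def ob_append ob)
  finally show ?thesis unfolding val_eq[OF f w] .
qed

text \<open>
  Reduces composition to the operations treated before: with the shared labels separated, the value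
  is a tensor product, and joining them again is a trace as in \<open>tr_comp\<close>.
\<close>

lemma val_comp:
  assumes f: "frame E as bs" and f': "frame E' bs cs" and int: "lbl E \<inter> lbl E' = set bs"
  shows "val (E @ E') as cs = val E' bs cs \<cdot> val E as bs"
proof -
  note F = frameD[OF f] and F' = frameD[OF f']
  obtain bs' where bs': "label_list bs'" "set bs' \<inter> (lbl E \<union> lbl E') = {}" "map ty bs' = map ty bs"
    using ex_copy[OF F(7), of "lbl E \<union> lbl E'"] by auto
  let ?r = "lmap bs bs'"
  have len: "length bs = length bs'" using bs'(3) by (metis length_map)
  have m: "map ?r bs = bs'" using F(7) len by (intro map_lmap) (auto simp: label_list_def)
  have sub: "set bs \<subseteq> lbl E" "set bs \<subseteq> lbl E'" "set as \<subseteq> lbl E" "set cs \<subseteq> lbl E'"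
    using frame_sub[OF f] frame_sub[OF f'] by auto
  have inj: "inj_on ?r L" if "L \<inter> set bs' = {}" for L
    using bs'(1) m that by (intro inj_on_replace[of bs' ?r bs]) (auto simp: label_list_def lmap_other)
  have tp: "type_pres ?r L" if "L \<subseteq> labels \<Lambda>" for L
    using bs' m that by (intro type_pres_replace[of bs bs']) (auto simp: label_list_def lmap_other)
  have l: "lbl E \<subseteq> labels \<Lambda>" "lbl E' \<subseteq> labels \<Lambda>" using einstein_labels F(1) F'(1) by auto
  have i': "inj_on ?r (lbl E')" and t': "type_pres ?r (lbl E')" 
    using inj[of "lbl E'"] tp[of "lbl E'"] bs'(2) l by blast+
  let ?E' = "ren ?r E'"
  have mcs: "map ?r cs = cs" "map ?r as = as" using F'(2) F(2) by (auto intro!: map_idI lmap_other)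
  have fE: "frame ?E' bs' cs" "val ?E' bs' cs = val E' bs cs"
    using frame_ren[OF f' i' t'] val_ren[OF f' i' t'] m mcs by simp_all
  have lE': "lbl ?E' \<subseteq> set bs' \<union> (lbl E' - set bs)"
  proof -
    have "?r ` set bs = set bs'" using m by (metis set_map)
    moreover have "?r ` (lbl E' - set bs) = lbl E' - set bs" by (intro lmap_image_other) blast
    moreover have "lbl E' = set bs \<union> (lbl E' - set bs)" using sub by blast
    ultimately show ?thesis unfolding expr_labels_ren by blast
  qed
  have d: "lbl E \<inter> lbl ?E' = {}" using lE' int bs'(2) by blast
  note fr = frame_tens[OF f fE(1) d]
  let ?f = "val E as bs" and ?g = "val E' bs cs"
  have "ob bs' = ob bs" using bs'(3) by (rule ob_types)
  then have hm_bs': "hm bs' cs = hm bs cs" "\<And>h. tr as cs bs' h = tr as cs bs h" by (simp_all add: hm_def tr_def)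
  have h: "?f \<in> hm as bs" "?g \<in> hm bs cs" "?g \<in> hm bs' cs" using val_hm[OF f] val_hm[OF f'] hm_bs' by auto
  have "val (E @ ?E') (as @ bs') (cs @ bs) = (sy bs cs \<cdot> (?f \<otimes> ?g)) \<cdot> idl (as @ bs')"
    using val_reorder(1)[OF fr wperm_idl wperm_sy] val_tens[OF f fE(1) d] fE(2) by simp
  also have "\<dots> = sy bs cs \<cdot> (?f \<otimes> ?g)"
    by (rule comp_idl[OF comp_hm[OF tens_hm[OF h(1,3)] sy_hm]])
  finally have 1: "val (E @ ?E') (as @ bs') (cs @ bs) = sy bs cs \<cdot> (?f \<otimes> ?g)" .
  have fr': "frame (E @ ?E') (as @ bs') (cs @ bs)" by (rule val_reorder(2)[OF fr wperm_idl wperm_sy])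
  have "val (emap id ?r (E @ ?E')) as cs = tr as cs bs' (val (E @ ?E') (as @ bs') (cs @ bs))"
    using bs'(3) m by (intro val_trace[OF fr']) (auto simp: lmap_other)
  also have "\<dots> = ?g \<cdot> ?f" unfolding 1 hm_bs'(2) by (rule tr_comp[OF h(1,2)])
  also have "emap id ?r (E @ ?E') = ren ?r (E @ E')"
  proof -
    have "emap id ?r E = ren ?r E"
    proof (rule emap_cong)
      fix a assume "a \<in> set (lower E)"
      then have "a \<notin> set bs" using f by (auto simp: frame_def free_upper_alt)
      then show "id a = ?r a" by (simp add: lmap_other)
    qed simp
    moreover have "emap id ?r ?E' = ?E'"
    proof (rule emap_idI)
      fix a assume "a \<in> set (upper ?E')"
      then have "a \<in> lbl ?E'" by (simp add: expr_labels_def)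
      then have "a \<notin> set bs" using d sub(1) by blast
      then show "?r a = a" by (rule lmap_other)
    qed simp
    ultimately show ?thesis by simp
  qed
  also have "val (ren ?r (E @ E')) as cs = val (E @ E') as cs"
  proof -
    note fc = frame_comp[OF f f' int]
    have "inj_on ?r (lbl (E @ E'))" "type_pres ?r (lbl (E @ E'))"
      using bs'(2) l by (auto intro!: inj tp)
    from val_ren[OF fc this] show ?thesis using mcs by simp
  qed
  finally show ?thesis .
qed

lemma parallel_dels: "length as = length bs \<Longrightarrow> parallel (dels as bs) = idl as"
proof (induction as bs rule: list_induct2)
  case (Cons a as b bs)
  then show ?case using tens_idl[of "[a]" as] by simp
qed simp

lemma val_dels:
  assumes l: "label_list (as @ bs)" and t: "map ty as = map ty bs" and q: "wperm bs bs' q"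
  shows "val (dels as bs) as bs' = q"
proof -
  have f0: "frame (dels as bs) as bs" by (rule frame_dels[OF l t])
  have len: "length as = length bs" using t by (rule same_types_length)
  have m: "mset bs = mset bs'" by (rule wperm_mset[OF q])
  have f: "frame (dels as bs) as bs'"
    using f0 m by (auto simp: frame_def dest: mset_eq_setD intro: mset_eq_imp_distinct_iff[THEN iffD1])
  have bd: "bound (dels as bs) = {}" using l len by (auto simp: bound_def label_list_def)
  have w: "wired (dels as bs) as bs' [] (idl as) q"
    unfolding wired_def bd using len q wperm_idl by simp
  have "ob as = ob bs" using t by (rule ob_types)
  then have qh: "q \<in> hm as bs'" using wperm_hm[OF q] by (simp add: hm_def)
  have "val (dels as bs) as bs' = tr as bs' [] (q \<cdot> (parallel (dels as bs) \<cdot> idl as))" by (rule val_eq[OF f w])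
  also have "\<dots> = q" using tr_Nil[OF qh] comp_idl[OF idl_hm] comp_idl[OF qh] by (simp add: parallel_dels[OF len])
  finally show ?thesis .
qed

lemma val_symbol:
  assumes f: "frame [Tensor \<psi> as bs] as bs"
  shows "val [Tensor \<psi> as bs] as bs = vm \<psi>"
proof -
  let ?E = "[Tensor \<psi> as bs]"
  have "bound ?E = {}" using frameD(2)[OF f] by (simp add: bound_def)
  then have w: "wired ?E as bs [] (idl as) (idl bs)" using wperm_idl by (simp add: wired_def)
  have m: "vm \<psi> \<in> hm as bs" using entry_hm[of "Tensor \<psi> as bs"] frameD(1)[OF f] by (simp add: einstein_def)
  have "val ?E as bs = tr as bs [] (idl bs \<cdot> (parallel ?E \<cdot> idl as))" by (rule val_eq[OF f w])
  then show ?thesis using m by (simp add: tens_Nil(2)[OF m] comp_idl[OF m] idl_comp[OF m] tr_Nil[OF m])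
qed

definition Fo :: "'u list \<Rightarrow> 'o" where
  "Fo = (\<lambda>X\<in>tylists. OTens_list C (map vo X))"

text \<open>
  Any representative that is an element of the class has the canonical labels of the arrow as its free labels, so it can be
  evaluated with these.
\<close>

definition Fm :: "('s, 'l) expr set \<Rightarrow> 'c" where
  "Fm = (\<lambda>t\<in>Arr K. val (SOME E. E \<in> t) (can False 0 (domK t)) (can True 0 (codK t)))"

lemma Fo_ob: "label_list L \<Longrightarrow> Fo (map ty L) = ob L"
  using label_list_types[of L] by (simp add: Fo_def ob_vo label_list_def)

lemma cls_Arr: "frame E as bs \<Longrightarrow> cls E as bs \<in> Arr K"
  using cls_Hom by (auto simp: Hom_def)

lemma Fm_cls:
  assumes f: "frame E as bs"
  shows "Fm (cls E as bs) = val E as bs"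
proof -
  obtain r where r: "canonizes r E as bs" using ex_canonizes[OF f] by blast
  then have r': "inj_on r (lbl E)" "type_pres r (lbl E)" "map r as = can False 0 (map ty as)"
     "map r bs = can True 0 (map ty bs)" by (auto simp: canonizes_def)
  let ?t = "cls E as bs"
  have t: "?t = cl (ren r E)" by (rule cls_eq[OF f r])
  have fr: "frame (ren r E) (map r as) (map r bs)" by (rule frame_ren[OF f r'(1,2)])
  have "ren r E \<in> ?t" unfolding t by (rule self_mem_class[OF frameD(1)[OF fr]])
  then have "(SOME E. E \<in> ?t) \<in> ?t" by (rule someI)
  then have eq: "ren r E \<approx> (SOME E. E \<in> ?t)" unfolding t by (simp add: expr_class_def)
  have "Fm ?t = val (SOME E. E \<in> ?t) (map r as) (map r bs)"
    using f cls_Arr[OF f] by (simp add: Fm_def r')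
  also have "\<dots> = val (ren r E) (map r as) (map r bs)" using val_equiv[OF eq fr] ..
  also have "\<dots> = val E as bs" by (rule val_ren[OF f r'(1,2)])
  finally show ?thesis .
qed

lemma Fo_append:
  assumes "A \<in> tylists" "B \<in> tylists"
  shows "Fo (A @ B) = Fo A \<odot> Fo B"
proof -
  obtain a where a: "label_list a" "map ty a = A" using ex_label_list[OF assms(1), of "{}"] by auto
  obtain b where b: "label_list b" "map ty b = B" "set b \<inter> set a = {}" using ex_label_list[OF assms(2), of "set a"] by auto
  have "label_list (a @ b)" using a b by (auto simp: label_list_append)
  then show ?thesis using Fo_ob[of a] Fo_ob[of b] Fo_ob[of "a @ b"] a b by (simp add: ob_append)
qed

lemma Fo_Obj: "A \<in> tylists \<Longrightarrow> Fo A \<in> Obj C"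
proof -
  assume "A \<in> tylists"
  from ex_label_list[OF this, of "{}"] obtain a where a: "label_list a" "map ty a = A" by auto
  then show ?thesis using Fo_ob[OF a(1)] by auto
qed

lemma functor_F: "strict_traced_functor K C (Fo, Fm)"
  unfolding strict_traced_functor_def prod.case
proof (intro conjI ballI impI)
  show "Fo \<in> Obj K \<rightarrow>\<^sub>E Obj C" using Fo_Obj by (auto simp: Fo_def)
  have A: "Fm t \<in> Hom C (Fo (domK t)) (Fo (codK t))" if t: "t \<in> Arr K" for t
  proof -
    from Arr_HomE[OF t] obtain X Y where h: "t \<in> Hom K X Y" by blast
    from represent[OF h, of "{}"] obtain E a b where f: "frame E a b" "t = cls E a b" by auto
    then show ?thesis
      using val_hm[OF f(1)] Fo_ob[OF frameD(6)[OF f(1)]] Fo_ob[OF frameD(7)[OF f(1)]] by (simp add: Fm_cls hm_def)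
  qed
  then show "Fm \<in> Arr K \<rightarrow>\<^sub>E Arr C" by (auto simp: Fm_def Hom_def)
  show "Dom C (Fm t) = Fo (Dom K t)" "Cod C (Fm t) = Fo (Cod K t)" if "t \<in> Arr K" for t
    using A[OF that] by (simp_all add: Hom_def)
  show "Fm (idK A) = Ide C (Fo A)" if "A \<in> Obj K" for A
  proof -
    have A: "A \<in> tylists" using that by simp
    obtain a where a: "label_list a" "map ty a = A" using ex_label_list[OF A, of "{}"] by auto
    obtain b where b: "label_list b" "map ty b = A" "set b \<inter> set a = {}" using ex_label_list[OF A, of "set a"] by auto
    have l: "label_list (a @ b)" "map ty a = map ty b" using a b by (auto simp: label_list_append)
    have "ob a = ob b" using l(2) by (rule ob_types)
    then show ?thesis
      using Ide_cls[OF l] Fm_cls[OF frame_dels[OF l]] val_dels[OF l wperm_idl] Fo_ob[OF a(1)] a(2) by (simp add: idl_def)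
  qed
  show "Fm (g \<cdot>\<^bsub>K\<^esub> f) = Fm g \<cdot> Fm f" if f: "f \<in> Arr K" and g: "g \<in> Arr K" and fg: "Dom K g = Cod K f" for f g
  proof -
    have "f \<in> Hom K (domK f) (codK f)" using f Arr_K by blast
    from represent[OF this, of "{}"] obtain F a b where F: "frame F a b" "f = cls F a b" "map ty b = codK f" by auto
    have "g \<in> Hom K (map ty b) (codK g)" using g fg F(3) Arr_K by simp
    from represent_after[OF this frameD(7)[OF F(1)], of "lbl F"] 
    obtain G d where G: "frame G b d" "g = cls G b d" "lbl G \<inter> lbl F \<subseteq> set b" by auto
    note j = joint[OF F(1) G(1,3)]
    show ?thesis
      using comp_cls[OF F(1) G(1) j] Fm_cls[OF frame_comp[OF F(1) G(1) j]] val_comp[OF F(1) G(1) j] Fm_cls[OF F(1)] Fm_cls[OF G(1)]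
      F(2) G(2) by simp
  qed
  show "Fo \<one>\<^bsub>K\<^esub> = \<one>" by (simp add: Fo_def OTens_list_def)
  show "Fo (A \<odot>\<^bsub>K\<^esub> B) = Fo A \<odot> Fo B" if "A \<in> Obj K" "B \<in> Obj K" for A B using that Fo_append by simp
  show "Fm (f \<otimes>\<^bsub>K\<^esub> g) = Fm f \<otimes> Fm g" if f: "f \<in> Arr K" and g: "g \<in> Arr K" for f g
  proof -
    from f g obtain X Y X' Y' where "f \<in> Hom K X Y" "g \<in> Hom K X' Y'" using Arr_HomE by blast
    from represent_disjoint[OF this] obtain F a b G a' b' where *: "frame F a b" "f = cls F a b" "frame G a' b'" "g = cls G a' b'"
      "lbl F \<inter> lbl G = {}" by blast
    show ?thesis
      using tens_cls[OF *(1,3,5)] Fm_cls[OF frame_tens[OF *(1,3,5)]] val_tens[OF *(1,3,5)] Fm_cls[OF *(1)] Fm_cls[OF *(3)] *(2,4)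
      by simp
  qed
  show "Fm (Symm K A B) = Symm C (Fo A) (Fo B)" if "A \<in> Obj K" "B \<in> Obj K" for A B
  proof -
    have AB: "A \<in> tylists" "B \<in> tylists" using that by auto
    from symm_represent[OF AB, of "{}"] obtain a b a' b' where
      l: "label_list ((a @ b) @ (a' @ b'))" and t: "map ty a = A" "map ty b = B" "map ty a' = A" "map ty b' = B" and
      s: "symmK A B = cls (dels (a @ b) (a' @ b')) (a @ b) (b' @ a')" by auto
    have fr: "frame (dels (a @ b) (a' @ b')) (a @ b) (b' @ a')" using frame_symm[OF l] t by simp
    have "map ty (a @ b) = map ty (a' @ b')" using t by simp
    from val_dels[OF l this wperm_sy] have "Fm (symmK A B) = sy a' b'" unfolding s Fm_cls[OF fr] .
    moreover have "label_list a'" "label_list b'" using l by (auto simp: label_list_append)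
    ultimately show ?thesis using Fo_ob[of a'] Fo_ob[of b'] t by (simp add: sy_def)
  qed
  show "Fm (Tr K A B X f) = Tr C (Fo A) (Fo B) (Fo X) (Fm f)"
    if "A \<in> Obj K" "B \<in> Obj K" "X \<in> Obj K" "f \<in> Hom K (A \<odot>\<^bsub>K\<^esub> X) (B \<odot>\<^bsub>K\<^esub> X)" for A B X f
  proof -
    have "f \<in> Hom K (A @ X) (B @ X)" using that by simp
    from trace_represent[OF this, of "{}"] obtain F a x b y where F: "frame F (a @ x) (b @ y)" "f = cls F (a @ x) (b @ y)"
      and t: "map ty a = A" "map ty x = X" "map ty b = B" "map ty y = X" by auto
    have ty: "map ty x = map ty y" using t by simp
    note T = trace_lmap[OF F(1) ty]
    have l: "label_list a" "label_list x" "label_list b" "label_list y"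
      using frameD(6,7)[OF F(1)] by (auto simp: label_list_append)
    have "map (lmap y x) y = x" using l same_types_length[OF ty] by (intro map_lmap) (auto simp: label_list_def)
    then have "val (emap id (lmap y x) F) a b = tr a b x (val F (a @ x) (b @ y))"
      by (intro val_trace[OF F(1) ty]) (auto simp: lmap_other)
    then have "Fm (trK A B X f) = tr a b x (Fm f)"
      using T(1) Fm_cls[OF T(2)] Fm_cls[OF F(1)] F(2) t by simp
    then show ?thesis using Fo_ob[OF l(1)] Fo_ob[OF l(2)] Fo_ob[OF l(3)] t by (simp add: tr_def)
  qed
qed

lemma extends_F: "extends_along (Sig \<Lambda> \<A>) (eta \<Lambda> \<A>) (Fo, Fm) (vo, vm)"
  unfolding extends_along_def fst_conv snd_conv
proof (intro conjI ballI)
  fix X assume "X \<in> sig_obj (Sig \<Lambda> \<A>)"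
  then have X: "X \<in> types \<Lambda>" by (simp add: Sig_def)
  then show "Fo (fst (eta \<Lambda> \<A>) X) = vo X"
    using OTens_Unit[OF vo_Obj[OF X]] by (simp add: eta_def Fo_def OTens_list_def)
next
  fix \<psi> assume "\<psi> \<in> sig_mor (Sig \<Lambda> \<A>)"
  then have "\<psi> \<in> symbols \<A>" by (simp add: Sig_def)
  from eta_cls[OF this] show "Fm (snd (eta \<Lambda> \<A>) \<psi>) = vm \<psi>" by (simp add: Fm_cls val_symbol)
qed

end

section \<open>Generation of the arrows and uniqueness\<close>

context free_tensor_system begin

text \<open>
  Giving the upper end of each bound wire a new name cuts the wire, and the trace joins it again.
\<close>

lemma open_bound:
  assumes f: "frame E as bs"
  shows "\<exists>E' B B'. frame E' (as @ B) (bs @ B') \<and> bound E' = {} \<and> map ty B = map ty B' \<and>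
    cls E as bs = trK (map ty as) (map ty bs) (map ty B) (cls E' (as @ B) (bs @ B'))"
proof -
  note F = frameD[OF f]
  obtain B where B: "distinct B" "set B = bound E" using finite_distinct_list[OF finite_labels(3)[of E]] by blast
  have lB: "label_list B" using B F(5) einstein_labels[OF F(1)] by (auto simp: label_list_def)
  obtain B' where B': "label_list B'" "set B' \<inter> lbl E = {}" "map ty B' = map ty B"
    using ex_copy[OF lB, of "lbl E"] by auto
  let ?g = "lmap B B'"
  have len: "length B = length B'" using B' by (metis length_map)
  have m: "map ?g B = B'" by (rule map_lmap[OF len B(1)])
  let ?E = "emap id ?g E"
  have l: "lbl E \<subseteq> labels \<Lambda>" by (rule einstein_labels[OF F(1)])
  have U: "set (upper E) \<subseteq> lbl E" "set (lower E) \<subseteq> lbl E" by (auto simp: expr_labels_def)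
  have inj: "inj_on ?g (set (upper E))"
    using B' U m by (intro inj_on_replace[of B' ?g B]) (auto simp: label_list_def lmap_other)
  have "type_pres ?g (set (upper E))"
    using B' U m l by (intro type_pres_replace[of B B']) (auto simp: label_list_def lmap_other)
  then have ein: "ein ?E" using inj F(1) U l by (intro einstein_emap) (auto simp: type_pres_def)
  have Bu: "set B \<subseteq> set (upper E)" "set B \<subseteq> set (lower E)" using B by (auto simp: bound_def)
  have "?g ` set (upper E) = ?g ` set B \<union> ?g ` (set (upper E) - set B)" using Bu by blast
  also have "?g ` set B = set B'" using m by (metis set_map)
  also have "?g ` (set (upper E) - set B) = set (upper E) - set B" by (intro lmap_image_other) blast
  finally have up: "set (upper ?E) = set B' \<union> (set (upper E) - set B)" by simp
  have b0: "set (upper ?E) \<inter> set (lower E) = {}"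
  proof -
    have "set B' \<inter> set (lower E) = {}" using B'(2) U by blast
    moreover have "(set (upper E) - set B) \<inter> set (lower E) = {}" unfolding B(2) bound_def by blast
    ultimately show ?thesis unfolding up by blast
  qed
  have "set (as @ B) = set (lower E)" using f B(2) by (auto simp: frame_def free_lower_def bound_def)
  moreover have "set (bs @ B') = set (upper ?E)"
    using f B(2) unfolding up by (auto simp: frame_def free_upper_def)
  moreover have "set bs \<inter> set B' = {}" using B'(2) F(5) by blast
  then have "distinct (bs @ B')" "distinct (as @ B)" using F(3,6,7) B B'(1) by (auto simp: label_list_def)
  ultimately have f': "frame ?E (as @ B) (bs @ B')"
    using ein b0 by (auto simp: frame_def free_lower_alt free_upper_alt)
  have bE: "bound ?E = {}" using b0 by (auto simp: bound_def)
  have "emap id (lmap B' B) ?E = E"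
    unfolding emap_emap
  proof (rule emap_idI)
    fix a assume a: "a \<in> set (upper E)"
    have m': "map (lmap B' B) B' = B" using len B'(1) by (intro map_lmap) (auto simp: label_list_def)
    have "map (lmap B' B \<circ> ?g) B = map id B" unfolding map_map[symmetric] m m' by simp
    then have *: "(lmap B' B \<circ> ?g) a = a" if "a \<in> set B" using that unfolding map_eq_conv by simp
    show "(lmap B' B \<circ> ?g) a = a"
    proof (cases "a \<in> set B")
      case False
      moreover have "a \<notin> set B'" using a U B'(2) by blast
      ultimately show ?thesis by (simp add: lmap_other)
    qed (rule *)
  qed simp
  then have "trK (map ty as) (map ty bs) (map ty B) (cls ?E (as @ B) (bs @ B')) = cls E as bs"
    using trace_lmap(1)[OF f' B'(3)[symmetric]] by simp
  then show ?thesis using f' bE B'(3) by (intro exI[of _ ?E] exI[of _ B] exI[of _ B']) simp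
qed

text \<open>
  Induction over the arrows.  An expression without bound labels is, up to the order of its ends, the tensor product
  of its entries, and each order of the ends is reached by composing with symmetries; an arbitrary expression
  is the trace of one without bound labels.
\<close>

lemma generated:
  assumes ide: "\<And>X. X \<in> tylists \<Longrightarrow> P (idK X)"
    and sym: "\<And>X Y. X \<in> tylists \<Longrightarrow> Y \<in> tylists \<Longrightarrow> P (symmK X Y)"
    and gen: "\<And>\<psi>. \<psi> \<in> symbols \<A> \<Longrightarrow> P (snd (eta \<Lambda> \<A>) \<psi>)"
    and comp: "\<And>f g X Y Z. f \<in> Hom K X Y \<Longrightarrow> g \<in> Hom K Y Z \<Longrightarrow> P f \<Longrightarrow> P g \<Longrightarrow> P (compK g f)"
    and tens: "\<And>f g. f \<in> Arr K \<Longrightarrow> g \<in> Arr K \<Longrightarrow> P f \<Longrightarrow> P g \<Longrightarrow> P (tensK f g)"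
    and trace: "\<And>f A B X. A \<in> tylists \<Longrightarrow> B \<in> tylists \<Longrightarrow> X \<in> tylists \<Longrightarrow> 
       f \<in> Hom K (A @ X) (B @ X) \<Longrightarrow> P f \<Longrightarrow> P (trK A B X f)"
    and f: "f \<in> Arr K"
  shows "P f"
proof -
  have sw: "block_swap R A B Q \<in> Hom K (R @ A @ B @ Q) (R @ B @ A @ Q) \<and> P (block_swap R A B Q)"
    if "R \<in> tylists" "A \<in> tylists" "B \<in> tylists" "Q \<in> tylists" for R A B Q
  proof -
    have h: "idK R \<in> Hom K R R" "symmK A B \<in> Hom K (A @ B) (B @ A)" "idK Q \<in> Hom K Q Q"
      using that by (auto intro: Ide_Hom_K Symm_Hom_K)
    note h1 = ATens_Hom_K[OF h(2,3)]
    have arr: "g \<in> Hom K X Y \<Longrightarrow> g \<in> Arr K" for g X Y by (simp add: Hom_def)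
    have "P (block_swap R A B Q)" unfolding block_swap_def
      using that by (intro tens ide sym arr[OF h(1)] arr[OF h(2)] arr[OF h(3)] arr[OF h1])
    moreover have "block_swap R A B Q \<in> Hom K (R @ A @ B @ Q) (R @ B @ A @ Q)"
      unfolding block_swap_def using ATens_Hom_K[OF h(1) h1] by simp
    ultimately show ?thesis by blast
  qed
  \<comment> \<open>The tensor product of the entries, with inputs and outputs in the order of the list.\<close>
  have disc: "P (cls E (lower E) (upper E)) \<and> frame E (lower E) (upper E)" if "ein E" "bound E = {}" for E
    using that
  proof (induction E)
    case Nil
    have "label_list ([] @ [])" by (simp add: label_list_def)
    from Ide_cls[OF this] have "idK [] = cls [] [] []" by simp
    then show ?case using ide[of "[]"] frame_Nil by simp
  next
    case (Cons e E)
    have ee: "ein [e]" "ein E" "bound [e] = {}" "bound E = {}" "lbl [e] \<inter> lbl E = {}"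
      using Cons.prems by (auto simp: einstein_def bound_def expr_labels_def)
    note IH = Cons.IH[OF ee(2,4)]
    have "P (cls [e] (elem_lower e) (elem_upper e)) \<and> frame [e] (elem_lower e) (elem_upper e)"
    proof (cases e)
      case (Delta a b)
      then have "label_list ([a] @ [b])" "map ty [a] = map ty [b]"
        using ee(1,3) by (auto simp: einstein_delta label_list_def bound_def)
      with Ide_cls[OF this] frame_dels[OF this] show ?thesis
        using ide[of "map ty [a]"] label_list_types[of "[a]"] Delta by (auto simp: label_list_def)
    next
      case (Tensor \<psi> as bs)
      then have \<psi>: "\<psi> \<in> symbols \<A>" "map ty as = lower_types \<A> \<psi>" "map ty bs = upper_types \<A> \<psi>" 
        and l: "label_list (as @ bs)" using ee(1,3) by (auto simp: einstein_def label_list_def bound_def)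
      have fT: "frame [Tensor \<psi> as bs] as bs" by (rule frame_symbol[OF \<psi>(1) l \<psi>(2,3)])
      let ?x = "can False 0 (lower_types \<A> \<psi>)" and ?y = "can True 0 (upper_types \<A> \<psi>)"
      note e = eta_cls[OF \<psi>(1)]
      obtain r where r: "canonizes r [Tensor \<psi> as bs] as bs" using ex_canonizes[OF fT] by blast
      then have r': "inj_on r (lbl [Tensor \<psi> as bs])" "type_pres r (lbl [Tensor \<psi> as bs])"
        "map r as = ?x" "map r bs = ?y" using \<psi> by (auto simp: canonizes_def)
      have "snd (eta \<Lambda> \<A>) \<psi> = cls [Tensor \<psi> as bs] as bs"
        using cls_ren[OF fT r'(1,2)] r'(3,4) e(2) by (simp add: emap_def)
      then show ?thesis using gen[OF \<psi>(1)] fT Tensor by simp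
    qed
    then have 1: "P (cls [e] (elem_lower e) (elem_upper e))" "frame [e] (elem_lower e) (elem_upper e)" by auto
    have "cls [e] (elem_lower e) (elem_upper e) \<in> Arr K" "cls E (lower E) (upper E) \<in> Arr K"
      using cls_Hom[OF 1(2)] cls_Hom[of E "lower E" "upper E"] IH by (auto simp: Hom_def)
    with tens_cls[OF 1(2) _ ee(5)] frame_tens[OF 1(2) _ ee(5)] tens 1 IH show ?case by fastforce
  qed
  \<comment> \<open>The outputs behind \<open>R\<close> are sorted by moving the next wanted one to their front.\<close>
  have permU: "P (cls E as (R @ bs')) \<and> frame E as (R @ bs')"
    if "frame E as (R @ bs)" "P (cls E as (R @ bs))" "mset bs = mset bs'" for E as R bs bs'
    using that
  proof (induction bs' arbitrary: R bs)
    case (Cons c bs')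
    then obtain A Q where bs: "bs = A @ c # Q" by (metis list.set_intros(1) mset_eq_setD split_list)
    have f1: "frame E as (R @ A @ [c] @ Q)" using Cons.prems bs by simp
    have l: "label_list R" "label_list A" "label_list [c]" "label_list Q"
      using frameD(7)[OF f1] unfolding label_list_append by blast+
    note t = l[THEN label_list_types]
    note s = swap_after[OF f1]
    have "P (cls E as (R @ [c] @ A @ Q))"
      unfolding s(1)[symmetric] using sw[OF t] Cons.prems bs cls_Hom[OF f1] by (intro comp[of _ "map ty as" "map ty (R @ A @ [c] @ Q)"]) auto
    then have "P (cls E as ((R @ [c]) @ (A @ Q)))" "frame E as ((R @ [c]) @ (A @ Q))" using s(2) by simp_all
    from Cons.IH[OF this(2,1)] Cons.prems bs show ?case by simp
  qed simp
  have permL: "P (cls E (R @ as') bs) \<and> frame E (R @ as') bs"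
    if "frame E (R @ as) bs" "P (cls E (R @ as) bs)" "mset as = mset as'" for E R as as' bs
    using that
  proof (induction as' arbitrary: R as)
    case (Cons c as')
    then obtain A Q where as: "as = A @ c # Q" by (metis list.set_intros(1) mset_eq_setD split_list)
    have f1: "frame E (R @ A @ [c] @ Q) bs" using Cons.prems as by simp
    have l: "label_list R" "label_list A" "label_list [c]" "label_list Q"
      using frameD(6)[OF f1] unfolding label_list_append by blast+
    note t = l[THEN label_list_types]
    note s = swap_before[OF f1]
    have "P (cls E (R @ [c] @ A @ Q) bs)"
      unfolding s(1)[symmetric] using sw[OF t(1,3,2,4)] Cons.prems as cls_Hom[OF f1] 
      by (intro comp[of _ _ "map ty (R @ A @ [c] @ Q)" _ "map ty bs"]) auto
    then have "P (cls E ((R @ [c]) @ (A @ Q)) bs)" "frame E ((R @ [c]) @ (A @ Q)) bs" using s(2) by simp_all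
    from Cons.IH[OF this(2,1)] Cons.prems as show ?case by simp
  qed simp
  have opened: "P (cls E as bs)" if fr: "frame E as bs" "bound E = {}" for E as bs
  proof -
    have E: "ein E" by (rule frameD(1)[OF fr(1)])
    have m: "mset (lower E) = mset as" "mset (upper E) = mset bs"
      using fr E set_eq_iff_mset_eq_distinct[of "lower E" as] set_eq_iff_mset_eq_distinct[of "upper E" bs]
      by (auto simp: frame_def einstein_def free_lower_def free_upper_def)
    from disc[OF E fr(2)] permU[of E "lower E" "[]" "upper E" bs] m 
    have "P (cls E (lower E) bs)" "frame E (lower E) bs" by auto
    then show ?thesis using permL[of E "[]" "lower E" bs as] m by simp
  qed
  obtain X Y where "f \<in> Hom K X Y" using Arr_HomE[OF f] by blast
  from represent[OF this, of "{}"] obtain E as bs where E: "frame E as bs" "f = cls E as bs" by auto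
  from open_bound[OF E(1)] obtain E' B B' where E': "frame E' (as @ B) (bs @ B')" "bound E' = {}" "map ty B = map ty B'"
    "cls E as bs = trK (map ty as) (map ty bs) (map ty B) (cls E' (as @ B) (bs @ B'))" by blast
  have l: "label_list as" "label_list bs" "label_list B"
    using frameD(6,7)[OF E'(1)] unfolding label_list_append by blast+
  note t = l[THEN label_list_types]
  show ?thesis unfolding E(2) E'(4)
    using cls_Hom[OF E'(1)] E'(3) t by (intro trace opened[OF E'(1,2)]) simp_all
qed

lemma functor_laws:
  fixes C :: "('o, 'c) moncat"
  assumes "strict_traced_functor K C (Fo, Fm)"
  shows "Fo \<in> extensional (tylists)" "Fm \<in> extensional (Arr K)"
    and "\<And>X. X \<in> tylists \<Longrightarrow> Fm (idK X) = Ide C (Fo X)"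
    and "\<And>f g. f \<in> Arr K \<Longrightarrow> g \<in> Arr K \<Longrightarrow> domK g = codK f \<Longrightarrow> Fm (compK g f) = Fm g \<cdot>\<^bsub>C\<^esub> Fm f"
    and "Fo [] = \<one>\<^bsub>C\<^esub>"
    and "\<And>X Y. X \<in> tylists \<Longrightarrow> Y \<in> tylists \<Longrightarrow> Fo (X @ Y) = Fo X \<odot>\<^bsub>C\<^esub> Fo Y"
    and "\<And>f g. f \<in> Arr K \<Longrightarrow> g \<in> Arr K \<Longrightarrow> Fm (tensK f g) = Fm f \<otimes>\<^bsub>C\<^esub> Fm g"
    and "\<And>X Y. X \<in> tylists \<Longrightarrow> Y \<in> tylists \<Longrightarrow> Fm (symmK X Y) = Symm C (Fo X) (Fo Y)"
    and "\<And>A B X f. A \<in> tylists \<Longrightarrow> B \<in> tylists \<Longrightarrow> X \<in> tylists \<Longrightarrow>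
      f \<in> Hom K (A @ X) (B @ X) \<Longrightarrow> Fm (trK A B X f) = Tr C (Fo A) (Fo B) (Fo X) (Fm f)"
proof -
  note f = assms[unfolded strict_traced_functor_def prod.case K_simps]
  show "Fo \<in> extensional (tylists)" using f[THEN conjunct1] by (simp add: PiE_def)
  show "Fm \<in> extensional (Arr K)" using f[THEN conjunct2, THEN conjunct1] by (simp add: PiE_def)
qed (insert assms[unfolded strict_traced_functor_def prod.case K_simps], blast+)

lemma functor_unique:
  fixes C :: "('o, 'c) moncat"
  assumes F: "strict_traced_functor K C F" "extends_along (Sig \<Lambda> \<A>) (eta \<Lambda> \<A>) F v"
    and G: "strict_traced_functor K C G" "extends_along (Sig \<Lambda> \<A>) (eta \<Lambda> \<A>) G v"
  shows "F = G"
proof -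
  obtain Fo Fm where Fp: "F = (Fo, Fm)" by (cases F)
  obtain Go Gm where Gp: "G = (Go, Gm)" by (cases G)
  note f = functor_laws[OF F(1)[unfolded Fp]]
  note g = functor_laws[OF G(1)[unfolded Gp]]
  have e: "Fo [A] = Go [A]" if "A \<in> types \<Lambda>" for A
    using F(2) G(2) that by (simp add: extends_along_def Fp Gp eta_def Sig_def)
  have e': "Fm (snd (eta \<Lambda> \<A>) \<psi>) = Gm (snd (eta \<Lambda> \<A>) \<psi>)" if "\<psi> \<in> symbols \<A>" for \<psi>
    using F(2) G(2) that by (simp add: extends_along_def Fp Gp Sig_def)
  have o: "Fo X = Go X" if "X \<in> tylists" for X
    using that
  proof (induction X)
    case Nil
    show ?case by (simp only: f(5) g(5))
  next
    case (Cons A X)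
    have "[A] \<in> tylists" "X \<in> tylists" using Cons.hyps by auto
    then have "Fo ([A] @ X) = Go ([A] @ X)" using e Cons by (simp only: f(6) g(6))
    then show ?case by simp
  qed
  have m: "Fm t = Gm t" if "t \<in> Arr K" for t
  proof (rule generated[OF _ _ _ _ _ _ that])
    have arr: "h \<in> Arr K" if "h \<in> Hom K X Y" for h X Y using that by (simp add: Hom_def)
    show "Fm (idK X) = Gm (idK X)" if "X \<in> tylists" for X
      using that by (simp only: f(3) g(3) o)
    show "Fm (symmK X Y) = Gm (symmK X Y)" if "X \<in> tylists" "Y \<in> tylists" for X Y
      using that by (simp only: f(8) g(8) o)
    show "Fm (compK k h) = Gm (compK k h)"
      if hk: "h \<in> Hom K X Y" "k \<in> Hom K Y Z" and eq: "Fm h = Gm h" "Fm k = Gm k" for h k X Y Z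
    proof -
      have d: "domK k = codK h" using hk by (simp add: Hom_def)
      show ?thesis using f(4)[OF arr[OF hk(1)] arr[OF hk(2)] d] g(4)[OF arr[OF hk(1)] arr[OF hk(2)] d] eq by simp
    qed
    show "Fm (tensK h k) = Gm (tensK h k)"
      if "h \<in> Arr K" "k \<in> Arr K" "Fm h = Gm h" "Fm k = Gm k" for h k
      using f(7)[OF that(1,2)] g(7)[OF that(1,2)] that by simp
    show "Fm (trK A B X h) = Gm (trK A B X h)"
      if "A \<in> tylists" "B \<in> tylists" "X \<in> tylists" "h \<in> Hom K (A @ X) (B @ X)" "Fm h = Gm h" for h A B X
      using f(9)[OF that(1-4)] g(9)[OF that(1-4)] that o by simp
  qed (rule e')
  have "Fo = Go" by (rule extensionalityI[OF f(1) g(1) o])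
  moreover have "Fm = Gm" by (rule extensionalityI[OF f(2) g(2) m])
  ultimately show ?thesis by (simp add: Fp Gp)
qed

lemma eta_signature_hom: "signature_hom (Sig \<Lambda> \<A>) K (eta \<Lambda> \<A>)"
proof -
  have o: "OTens_list K (map (\<lambda>X. [X]) Xs) = Xs" for Xs :: "'u list"
    by (induction Xs) (auto simp: OTens_list_def)
  have "snd (eta \<Lambda> \<A>) \<psi> \<in> Hom K (lower_types \<A> \<psi>) (upper_types \<A> \<psi>)" if "\<psi> \<in> symbols \<A>" for \<psi>
    using cls_Hom[OF eta_cls(1)[OF that]] eta_cls(2-4)[OF that] by simp
  then show ?thesis
    unfolding signature_hom_def eta_def prod.case by (simp add: Sig_def o eta_def)
qed

end

theorem theorem6p10:
  fixes \<Lambda> :: "('u, 'l) labelling" and \<A> :: "('s, 'u) alphabet"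
  assumes "labelling \<Lambda>" and "alphabet \<Lambda> \<A>"
  shows "strict_traced_category (Cat \<Lambda> (Free \<Lambda> \<A>)) \<and>
    signature_hom (Sig \<Lambda> \<A>) (Cat \<Lambda> (Free \<Lambda> \<A>)) (eta \<Lambda> \<A>) \<and>
    (\<forall>(C :: ('o, 'c) moncat) v.
       strict_traced_category C \<and> signature_hom (Sig \<Lambda> \<A>) C v \<longrightarrow>
       (\<exists>!F. strict_traced_functor (Cat \<Lambda> (Free \<Lambda> \<A>)) C F \<and>
             extends_along (Sig \<Lambda> \<A>) (eta \<Lambda> \<A>) F v))"
proof -
  interpret free_tensor_system \<Lambda> \<A> using assms by unfold_locales
  have "\<exists>!F. strict_traced_functor (Cat \<Lambda> (Free \<Lambda> \<A>)) C F \<and> extends_along (Sig \<Lambda> \<A>) (eta \<Lambda> \<A>) F v"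
    if C: "strict_traced_category C" and v: "signature_hom (Sig \<Lambda> \<A>) C v" for C :: "('o, 'c) moncat" and v
  proof -
    obtain vo vm where vp: "v = (vo, vm)" by (cases v)
    interpret C: strict_traced_category C by (rule C)
    interpret V: valuation \<Lambda> \<A> C vo vm using v vp by unfold_locales simp
    show ?thesis
      using V.functor_F V.extends_F functor_unique vp by blast
  qed
  then show ?thesis using strict_traced_category_K eta_signature_hom by blast
qed

end
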